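(* Let $k$ be an $F$-finite field of prime characteristic $p$ and let $G$ be a simple connected bipartite graph on the vertex set $[d]=\{1,\dots,d\}$. If $G$ is accessible, then $G$ is weakly closed.
   Context: A graph is simple if it is undirected, without loops and without multiple edges. For a simple graph $G$ with vertex set $[d]$ and edge set $E$, the binomial edge ideal is $J_G=(x_iy_j-x_jy_i \mid \{i,j\}\in E)\subseteq R=k[x_1,\dots,x_d,y_1,\dots,y_d]$. $J_G$ is unmixed if all its associated primes have the same height. A field $k$ of characteristic $p$ is $F$-finite if $k$ is a finite extension of $k^p$. For $S\subseteq[d]$, let $T_1,\dots,T_{c(S)}$ be the vertex sets of the connected components of the induced subgraph of $G$ on $[d]\setminus S$ (so $c(S)$ is the number of components), let $\tilde G_{T_i}$ be the complete graph on $T_i$, and set $\mathfrak p_S=J_{\tilde G_{T_1}}+\dots+J_{\tilde G_{T_{c(S)}}}+(x_i,y_i\mid i\in S)$, a prime ideal of $R$. For connected $G$, $S$ is a cut set of $G$ if $\mathfrak p_S$ is a minimal prime of $J_G$; equivalently, $S=\emptyset$ or $c(S\setminus\{s\})<c(S)$ for every $s\in S$. $G$ is accessible if $J_G$ is unmixed and for every nonempty cut set $S$ of $G$ there is $s\in S$ such that $S\setminus\{s\}$ is a cut set of $G$. A simple graph with $d$ vertices and edge set $E$ is weakly closed if its vertices can be labeled by $[d]$ so that whenever $\{i,k\}\in E$ and $i<j<k$, then $\{i,j\}\in E$ or $\{j,k\}\in E$. *)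

theory Defs
  imports
    "HOL-Algebra.Algebra"
    "HOL-Algebra.Algebraic_Closure_Type"
    "HOL-Library.Poly_Mapping"
    "HOL-Library.Extended_Nat"
begin

section \<open>Simple graphs on the vertex set [d]\<close>

text \<open>A graph on \<open>{1..d}\<close> is given by its edge set, a set of two-element subsets.\<close>

definition simple_graph :: "nat \<Rightarrow> nat set set \<Rightarrow> bool" where
  "simple_graph d E \<longleftrightarrow> (\<forall>e\<in>E. \<exists>i\<in>{1..d}. \<exists>j\<in>{1..d}. i \<noteq> j \<and> e = {i, j})"

definition complete_edges :: "nat set \<Rightarrow> nat set set" where
  "complete_edges T = {{i, j} | i j. i \<in> T \<and> j \<in> T \<and> i \<noteq> j}"

definition induced_adj :: "nat set set \<Rightarrow> nat set \<Rightarrow> (nat \<times> nat) set" where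
  "induced_adj E V = {(u, v). u \<in> V \<and> v \<in> V \<and> {u, v} \<in> E}"

text \<open>The vertex sets of the connected components of the induced subgraph on
  \<open>{1..d} - S\<close>, as the classes of the reachability relation.\<close>

definition components :: "nat \<Rightarrow> nat set set \<Rightarrow> nat set \<Rightarrow> nat set set" where
  "components d E S = ({1..d} - S) // (induced_adj E ({1..d} - S))\<^sup>*"

definition connected_graph :: "nat \<Rightarrow> nat set set \<Rightarrow> bool" where
  "connected_graph d E \<longleftrightarrow>
     {1..d} \<noteq> {} \<and> (\<forall>u\<in>{1..d}. \<forall>v\<in>{1..d}. (u, v) \<in> (induced_adj E {1..d})\<^sup>*)"

definition bipartite :: "nat \<Rightarrow> nat set set \<Rightarrow> bool" where
  "bipartite d E \<longleftrightarrow> (\<exists>A B. A \<union> B = {1..d} \<and> A \<inter> B = {} \<and>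
     (\<forall>e\<in>E. \<exists>a\<in>A. \<exists>b\<in>B. e = {a, b}))"

text \<open>\<open>\<sigma> v\<close> is the label of the vertex \<open>v\<close>, and \<open>(`) \<sigma> ` E\<close> is the relabelled edge set.\<close>

definition weakly_closed :: "nat \<Rightarrow> nat set set \<Rightarrow> bool" where
  "weakly_closed d E \<longleftrightarrow> (\<exists>\<sigma>. bij_betw \<sigma> {1..d} {1..d} \<and>
     (\<forall>i j k. {i, k} \<in> (`) \<sigma> ` E \<and> i < j \<and> j < k \<longrightarrow>
        {i, j} \<in> (`) \<sigma> ` E \<or> {j, k} \<in> (`) \<sigma> ` E))"


section \<open>Primes of a commutative ring\<close>

definition minimal_prime :: "('a, 'b) ring_scheme \<Rightarrow> 'a set \<Rightarrow> 'a set \<Rightarrow> bool" where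
  "minimal_prime R J P \<longleftrightarrow> primeideal P R \<and> J \<subseteq> P \<and>
     (\<forall>Q. primeideal Q R \<and> J \<subseteq> Q \<and> Q \<subseteq> P \<longrightarrow> Q = P)"

text \<open>The associated primes of the \<open>R\<close>-module \<open>R/J\<close>: the colon ideal \<open>(J : f)\<close> is the
  annihilator of the class of \<open>f\<close> in \<open>R/J\<close>.\<close>

definition associated_primes :: "('a, 'b) ring_scheme \<Rightarrow> 'a set \<Rightarrow> 'a set set" where
  "associated_primes R J =
     {P. primeideal P R \<and> (\<exists>f\<in>carrier R. P = {g \<in> carrier R. g \<otimes>\<^bsub>R\<^esub> f \<in> J})}"

definition ideal_height :: "('a, 'b) ring_scheme \<Rightarrow> 'a set \<Rightarrow> enat" where
  "ideal_height R P = Sup {enat n | n. \<exists>C :: nat \<Rightarrow> 'a set.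
     (\<forall>i\<le>n. primeideal (C i) R) \<and> (\<forall>i<n. C i \<subset> C (Suc i)) \<and> C n = P}"

definition unmixed :: "('a, 'b) ring_scheme \<Rightarrow> 'a set \<Rightarrow> bool" where
  "unmixed R J \<longleftrightarrow>
     (\<forall>P\<in>associated_primes R J. \<forall>Q\<in>associated_primes R J. ideal_height R P = ideal_height R Q)"


section \<open>Binomial edge ideals\<close>

datatype var = VarX nat | VarY nat

type_synonym 'k mpoly = "(var \<Rightarrow>\<^sub>0 nat) \<Rightarrow>\<^sub>0 'k"

definition xvar :: "nat \<Rightarrow> 'k::field mpoly" where
  "xvar i = Poly_Mapping.single (Poly_Mapping.single (VarX i) 1) 1"

definition yvar :: "nat \<Rightarrow> 'k::field mpoly" where
  "yvar i = Poly_Mapping.single (Poly_Mapping.single (VarY i) 1) 1"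

text \<open>The polynomial ring \<open>k[x\<^sub>1, \<dots>, x\<^sub>d, y\<^sub>1, \<dots>, y\<^sub>d]\<close> as a subring of the polynomial
  ring in all the variables \<open>x\<^sub>i, y\<^sub>i\<close>.\<close>

definition xy_ring :: "nat \<Rightarrow> 'k::field mpoly ring" where
  "xy_ring d = ring_of_type_algebra
     \<lparr>carrier := {f. \<forall>m\<in>Poly_Mapping.keys f.
                       Poly_Mapping.keys m \<subseteq> VarX ` {1..d} \<union> VarY ` {1..d}}\<rparr>"

definition binomial_edge_ideal :: "nat \<Rightarrow> nat set set \<Rightarrow> 'k::field mpoly set" where
  "binomial_edge_ideal d E = Idl\<^bsub>xy_ring d\<^esub> {xvar i * yvar j - xvar j * yvar i | i j. {i, j} \<in> E}"

text \<open>The sum of the ideals is the ideal generated by their union.\<close>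

definition cut_prime :: "nat \<Rightarrow> nat set set \<Rightarrow> nat set \<Rightarrow> 'k::field mpoly set" where
  "cut_prime d E S = Idl\<^bsub>xy_ring d\<^esub>
     ((\<Union>T\<in>components d E S. binomial_edge_ideal d (complete_edges T)) \<union> xvar ` S \<union> yvar ` S)"

definition cut_set :: "'k::field itself \<Rightarrow> nat \<Rightarrow> nat set set \<Rightarrow> nat set \<Rightarrow> bool" where
  "cut_set _ d E S \<longleftrightarrow> S \<subseteq> {1..d} \<and>
     minimal_prime (xy_ring d) (binomial_edge_ideal d E) (cut_prime d E S :: 'k mpoly set)"

definition accessible :: "'k::field itself \<Rightarrow> nat \<Rightarrow> nat set set \<Rightarrow> bool" where
  "accessible k d E \<longleftrightarrow>
     unmixed (xy_ring d) (binomial_edge_ideal d E :: 'k mpoly set) \<and>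
     (\<forall>S. cut_set k d E S \<and> S \<noteq> {} \<longrightarrow> (\<exists>s\<in>S. cut_set k d E (S - {s})))"


section \<open>F-finite fields\<close>

text \<open>The field has finite dimension as a vector space over its subfield of \<open>p\<close>-th powers,
  where \<open>p\<close> is the characteristic.\<close>

definition F_finite :: "'k::field itself \<Rightarrow> bool" where
  "F_finite _ \<longleftrightarrow> ring.finite_dimension (ring_of_type_algebra :: 'k ring)
     ((\<lambda>a. a ^ CHAR('k)) ` UNIV) UNIV"

end

(*
  Algebra. Let r pick a representative of each component of G - S. The prime p_S is the kernel of
  x_i, y_i -> 0 (i in S), x_i -> x_i, y_i -> x_i y_(r i) (i not in S), because two monomials with the
  same image differ by swaps inside the components. Its height is d + |S| - c(S): chains of such
  kernels bound it from below, and from above one counts monomials in elements that are algebraically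
  independent modulo p_S. If every s in S touches two components of G - S, then some w outside p_S
  satisfies w p_S <= J_G. So p_S is a minimal and an associated prime of J_G, and unmixedness gives
  c(S) = |S| + 1.

  Combinatorics. Cut the graph at its cut vertices. A piece V remembers the set K of its vertices at
  which something was cut off, each counting as one more component. If a piece with sides A and B has
  no cut vertex, the cut sets A and B give |A| = |B| and K = {a0, b0}. A minimal separator of a0 from
  a non-neighbour would be a cut set without a cut vertex, so a0 is joined to all of B and b0 to all
  of A. A descending chain of cut sets from A to {a0} matches B - {b0} with A - {a0}, and counting
  components makes the neighbourhoods nested. This orders the piece with a0 first and b0 last; the
  pieces are then concatenated. Throughout, the order is a strict partial order in which exactly the
  pairs of non-adjacent vertices are comparable: every linear extension of it is a labelling of a
  weakly closed graph.
*)
theory Submission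
  imports Defs
begin

section \<open>Components and cut sets\<close>

text \<open>Why pieces carry \<open>K\<close>: once the graph is cut at \<open>v\<close> into
  \<open>L\<close> and \<open>R\<close>, a cut set containing \<open>v\<close> no longer sees the
  component \<open>R\<close> when viewed inside \<open>insert v L\<close>, so the half alone need
  not be accessible. Marking \<open>v\<close> restores both the count and the condition that
  \<open>v\<close> touches two components. Why orders carry two ends: halves are concatenated at
  \<open>v\<close>, so \<open>v\<close> must be maximal on one side and minimal on the other, and an
  older mark has to sit at the opposite end. The induction therefore has to prove that every mark is
  an end of its piece. Why neighbourhoods are nested: the matching \<open>m\<close> turns inclusion
  into adjacency, since \<open>l'\<close> is adjacent to \<open>m l\<close> exactly when
  \<open>nb l \<subseteq> nb l'\<close>. A piece is thus determined by a poset, and two incomparable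
  elements of this poset yield a cut set with one component too many.\<close>

locale graph =
  fixes adj :: "'a \<Rightarrow> 'a \<Rightarrow> bool"
  assumes adj_sym: "adj u v \<Longrightarrow> adj v u"
begin

definition reach :: "'a set \<Rightarrow> ('a \<times> 'a) set" where
  "reach U = {(u, v). u \<in> U \<and> v \<in> U \<and> adj u v}\<^sup>*"

definition comps :: "'a set \<Rightarrow> 'a set set" where
  "comps U = U // reach U"

definition conn :: "'a set \<Rightarrow> bool" where
  "conn U \<longleftrightarrow> (\<forall>u\<in>U. \<forall>v\<in>U. (u, v) \<in> reach U)"

lemma reach_refl [simp]: "(u, u) \<in> reach U"
  by (simp add: reach_def)

lemma reach_trans: "(u, v) \<in> reach U \<Longrightarrow> (v, w) \<in> reach U \<Longrightarrow> (u, w) \<in> reach U"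
  unfolding reach_def by (rule rtrancl_trans)

lemma reach_step: "u \<in> U \<Longrightarrow> v \<in> U \<Longrightarrow> adj u v \<Longrightarrow> (u, v) \<in> reach U"
  unfolding reach_def by blast

lemma reach_sym: "(u, v) \<in> reach U \<Longrightarrow> (v, u) \<in> reach U"
proof -
  have "sym {(u, v). u \<in> U \<and> v \<in> U \<and> adj u v}"
    using adj_sym by (auto simp: sym_def)
  then show "(u, v) \<in> reach U \<Longrightarrow> (v, u) \<in> reach U"
    unfolding reach_def by (meson sym_rtrancl symD)
qed

lemma reach_mono: "U \<subseteq> W \<Longrightarrow> (u, v) \<in> reach U \<Longrightarrow> (u, v) \<in> reach W"
  unfolding reach_def by (rule subsetD[OF rtrancl_mono]) auto

lemma reach_induct [consumes 1, case_names refl step]: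
  assumes "(u, v) \<in> reach U" "P u"
    "\<And>v w. (u, v) \<in> reach U \<Longrightarrow> v \<in> U \<Longrightarrow> w \<in> U \<Longrightarrow> adj v w \<Longrightarrow> P v \<Longrightarrow> P w"
  shows "P v"
  using assms(1) unfolding reach_def
  by (induction rule: rtrancl_induct) (use assms(2,3) in \<open>auto simp: reach_def\<close>)

lemma reach_closed:
  assumes "(u, v) \<in> reach U" "u \<in> C" "\<And>x y. x \<in> C \<Longrightarrow> y \<in> U \<Longrightarrow> adj x y \<Longrightarrow> y \<in> C"
  shows "v \<in> C"
  using assms(1) by (induction rule: reach_induct) (use assms in auto)

lemma reach_mem: "(u, v) \<in> reach U \<Longrightarrow> u \<in> U \<Longrightarrow> v \<in> U"
  by (erule reach_closed) auto

lemma class_eq_iff: "reach U `` {u} = reach U `` {v} \<longleftrightarrow> (u, v) \<in> reach U"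
proof
  assume "reach U `` {u} = reach U `` {v}"
  then have "v \<in> reach U `` {u}" by simp
  then show "(u, v) \<in> reach U" by simp
next
  assume "(u, v) \<in> reach U"
  then have "(u, w) \<in> reach U \<longleftrightarrow> (v, w) \<in> reach U" for w
    using reach_trans[of u v U w] reach_trans[of v u U w] reach_sym[of u v U] by blast
  then show "reach U `` {u} = reach U `` {v}" by blast
qed

section \<open>Counting components through representatives\<close>

lemma comps_eq: "comps U = (\<lambda>u. reach U `` {u}) ` U"
  by (auto simp: comps_def quotient_def)

lemma finite_comps [simp]: "finite U \<Longrightarrow> finite (comps U)"
  by (simp add: comps_eq)

lemma card_comps_reps:
  assumes "T \<subseteq> U" "\<And>u. u \<in> U \<Longrightarrow> \<exists>t\<in>T. (u, t) \<in> reach U"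
    "\<And>s t. s \<in> T \<Longrightarrow> t \<in> T \<Longrightarrow> (s, t) \<in> reach U \<Longrightarrow> s = t"
  shows "card (comps U) = card T"
proof -
  have "comps U = (\<lambda>u. reach U `` {u}) ` T"
    unfolding comps_eq
  proof
    show "(\<lambda>u. reach U `` {u}) ` U \<subseteq> (\<lambda>u. reach U `` {u}) ` T"
    proof
      fix C assume "C \<in> (\<lambda>u. reach U `` {u}) ` U"
      then obtain u where u: "u \<in> U" "C = reach U `` {u}" by blast
      then obtain t where "t \<in> T" "(u, t) \<in> reach U" using assms(2) by blast
      then show "C \<in> (\<lambda>u. reach U `` {u}) ` T" using u class_eq_iff by (metis imageI)
    qed
  qed (use assms(1) in blast)
  moreover have "inj_on (\<lambda>u. reach U `` {u}) T"
    using assms(3) by (auto simp: inj_on_def class_eq_iff)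
  ultimately show ?thesis by (simp add: card_image)
qed

lemma card_comps_ge:
  assumes "finite U" "T \<subseteq> U" "\<And>s t. s \<in> T \<Longrightarrow> t \<in> T \<Longrightarrow> (s, t) \<in> reach U \<Longrightarrow> s = t"
  shows "card T \<le> card (comps U)"
proof -
  have "inj_on (\<lambda>u. reach U `` {u}) T"
    using assms(3) by (auto simp: inj_on_def class_eq_iff)
  moreover have "(\<lambda>u. reach U `` {u}) ` T \<subseteq> comps U"
    using assms(2) by (auto simp: comps_eq)
  ultimately show ?thesis using assms(1) card_inj_on_le finite_comps by blast
qed

text \<open>The choice predicate is the same function for all vertices of one component, so
  \<open>SOME\<close> picks the same vertex throughout it. Outside \<open>U\<close> the vertex
  itself is returned, as \<open>rep_fun\<close> demands.\<close>

definition comp_rep :: "'a set \<Rightarrow> 'a \<Rightarrow> 'a" where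
  "comp_rep U u = (if u \<in> U then SOME t. (u, t) \<in> reach U else u)"

lemma comp_rep_reach: "(u, comp_rep U u) \<in> reach U"
  unfolding comp_rep_def using someI[of "\<lambda>t. (u, t) \<in> reach U" u] by simp

lemma comp_rep_in: "u \<in> U \<Longrightarrow> comp_rep U u \<in> U"
  using comp_rep_reach reach_mem by blast

lemma comp_rep_eq_iff:
  assumes "u \<in> U" "v \<in> U"
  shows "comp_rep U u = comp_rep U v \<longleftrightarrow> (u, v) \<in> reach U"
proof
  assume "comp_rep U u = comp_rep U v"
  then show "(u, v) \<in> reach U" using comp_rep_reach reach_sym reach_trans by metis
next
  assume "(u, v) \<in> reach U"
  then have "(\<lambda>t. (u, t) \<in> reach U) = (\<lambda>t. (v, t) \<in> reach U)" using reach_trans reach_sym by blast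
  then show "comp_rep U u = comp_rep U v" using assms by (simp add: comp_rep_def)
qed

lemma reps_exist: "\<exists>T. T \<subseteq> U \<and> (\<forall>u\<in>U. \<exists>t\<in>T. (u, t) \<in> reach U) \<and>
    (\<forall>s\<in>T. \<forall>t\<in>T. (s, t) \<in> reach U \<longrightarrow> s = t)"
proof (intro exI[of _ "comp_rep U ` U"] conjI ballI impI)
  show "comp_rep U ` U \<subseteq> U" using comp_rep_in by blast
  show "\<exists>t\<in>comp_rep U ` U. (u, t) \<in> reach U" if "u \<in> U" for u using that comp_rep_reach by blast
  fix s t assume "s \<in> comp_rep U ` U" "t \<in> comp_rep U ` U" "(s, t) \<in> reach U"
  then obtain u v where "s = comp_rep U u" "t = comp_rep U v" "u \<in> U" "v \<in> U" by blast
  moreover then have "(u, v) \<in> reach U"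
    using \<open>(s, t) \<in> reach U\<close> comp_rep_reach reach_sym reach_trans by metis
  ultimately show "s = t" using comp_rep_eq_iff by blast
qed

lemma card_comps_comp_rep: "card (comps U) = card (comp_rep U ` U)"
proof (rule card_comps_reps)
  show "comp_rep U ` U \<subseteq> U" using comp_rep_in by blast
  show "\<exists>t\<in>comp_rep U ` U. (u, t) \<in> reach U" if "u \<in> U" for u using that comp_rep_reach by blast
  fix s t assume "s \<in> comp_rep U ` U" "t \<in> comp_rep U ` U" "(s, t) \<in> reach U"
  then obtain u v where "s = comp_rep U u" "t = comp_rep U v" "u \<in> U" "v \<in> U" by blast
  moreover then have "(u, v) \<in> reach U"
    using \<open>(s, t) \<in> reach U\<close> comp_rep_reach reach_sym reach_trans by metis
  ultimately show "s = t" using comp_rep_eq_iff by blast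
qed

lemma card_comps_conn:
  assumes "U \<noteq> {}" "conn U" shows "card (comps U) = 1"
proof -
  obtain u where "u \<in> U" using assms by blast
  then show ?thesis
    using card_comps_reps[of "{u}" U] assms by (auto simp: conn_def)
qed

lemma card_comps_edgeless:
  assumes "\<And>u v. u \<in> U \<Longrightarrow> v \<in> U \<Longrightarrow> \<not> adj u v"
  shows "card (comps U) = card U"
proof (rule card_comps_reps)
  show "s = t" if "(s, t) \<in> reach U" "s \<in> U" "t \<in> U" for s t
    using reach_closed[of s t U "{s}"] assms that by blast
qed (use reach_refl in blast)+

lemma reach_Un_no_edges:
  assumes "(x, y) \<in> reach (U \<union> W)" "x \<in> U" "\<And>u v. u \<in> U \<Longrightarrow> v \<in> W \<Longrightarrow> \<not> adj u v"
  shows "(x, y) \<in> reach U \<and> y \<in> U"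
  using assms(1)
proof (induction rule: reach_induct)
  case (step v w)
  then have "w \<in> U" using assms(3) by blast
  then show ?case using step reach_step[of v U w] reach_trans by blast
qed (use assms(2) in simp)

lemma comps_Un:
  assumes "\<And>u v. u \<in> U \<Longrightarrow> v \<in> W \<Longrightarrow> \<not> adj u v" "U \<inter> W = {}" "finite U" "finite W"
  shows "card (comps (U \<union> W)) = card (comps U) + card (comps W)"
proof -
  have WU: "\<not> adj u v" if "u \<in> W" "v \<in> U" for u v using assms that adj_sym by blast
  obtain S where S: "S \<subseteq> U" "\<forall>u\<in>U. \<exists>t\<in>S. (u, t) \<in> reach U"
      "\<forall>s\<in>S. \<forall>t\<in>S. (s, t) \<in> reach U \<longrightarrow> s = t" using reps_exist by meson
  obtain T where T: "T \<subseteq> W" "\<forall>u\<in>W. \<exists>t\<in>T. (u, t) \<in> reach W"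
      "\<forall>s\<in>T. \<forall>t\<in>T. (s, t) \<in> reach W \<longrightarrow> s = t" using reps_exist by meson
  have c: "card (comps U) = card S" "card (comps W) = card T"
    using S T by (auto intro!: card_comps_reps)
  have "card (comps (U \<union> W)) = card (S \<union> T)"
  proof (rule card_comps_reps)
    show "S \<union> T \<subseteq> U \<union> W" using S T by blast
    show "\<exists>t\<in>S \<union> T. (u, t) \<in> reach (U \<union> W)" if "u \<in> U \<union> W" for u
      using that S(2) T(2) reach_mono[of U "U \<union> W"] reach_mono[of W "U \<union> W"] by blast
    show "s = t" if "s \<in> S \<union> T" "t \<in> S \<union> T" "(s, t) \<in> reach (U \<union> W)" for s t
    proof (cases "s \<in> S")
      case True
      then have "(s, t) \<in> reach U \<and> t \<in> U" using reach_Un_no_edges[of s t U W] that assms S by blast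
      then show ?thesis using True that S T assms(2) by blast
    next
      case False
      then have "(s, t) \<in> reach W \<and> t \<in> W" using reach_Un_no_edges[of s t W U] that WU T by (auto simp: Un_commute)
      then show ?thesis using False that S T assms(2) by blast
    qed
  qed
  moreover have "card (S \<union> T) = card S + card T"
    using S(1) T(1) assms finite_subset by (intro card_Un_disjoint) blast+
  ultimately show ?thesis using c by simp
qed

text \<open>Every component of \<open>W\<close> meets \<open>U\<close>, and walks outside
  \<open>U\<close> join nothing new, so a system of representatives for \<open>U\<close> also serves
  \<open>W\<close>. Used when the part hanging at a vertex is dropped.\<close>

lemma comps_inclusion:
  assumes "U \<subseteq> W" "\<And>x y. x \<in> U \<Longrightarrow> y \<in> U \<Longrightarrow> (x, y) \<in> reach W \<Longrightarrow> (x, y) \<in> reach U"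
    "\<And>w. w \<in> W \<Longrightarrow> \<exists>u\<in>U. (w, u) \<in> reach W"
  shows "card (comps W) = card (comps U)"
proof -
  obtain S where S: "S \<subseteq> U" "\<forall>u\<in>U. \<exists>t\<in>S. (u, t) \<in> reach U"
      "\<forall>s\<in>S. \<forall>t\<in>S. (s, t) \<in> reach U \<longrightarrow> s = t" using reps_exist by meson
  have "card (comps U) = card S" using S by (intro card_comps_reps) auto
  moreover have "card (comps W) = card S"
  proof (rule card_comps_reps)
    show "S \<subseteq> W" using S assms by blast
    show "\<exists>t\<in>S. (u, t) \<in> reach W" if "u \<in> W" for u
      using assms(3)[OF that] S(2) reach_mono[OF assms(1)] reach_trans by meson
    show "s = t" if "s \<in> S" "t \<in> S" "(s, t) \<in> reach W" for s t
      using that S assms by blast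
  qed
  ultimately show ?thesis by simp
qed

text \<open>A walk can leave \<open>U\<close> only through \<open>s\<close>, so before doing so it
  has reached a neighbour of \<open>s\<close> inside \<open>U\<close>.\<close>

lemma reach_insert:
  assumes "(x, z) \<in> reach (insert s U)" "x \<in> U"
  shows "(x, z) \<in> reach U \<or> (\<exists>w. adj s w \<and> (x, w) \<in> reach U)"
  using assms(1)
proof (induction rule: reach_induct)
  case (step v w)
  show ?case
  proof (cases "\<exists>w. adj s w \<and> (x, w) \<in> reach U")
    case False
    then have v: "(x, v) \<in> reach U" "v \<in> U" using step reach_mem assms(2) by blast+
    then show ?thesis
      using step reach_step reach_trans adj_sym False by (metis insertE)
  qed simp
qed simp

text \<open>A vertex of \<open>K\<close> has one further component attached to it that is not part of \<open>V\<close>; for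
  \<open>K = {}\<close> these are the cut sets and the accessibility of the graph on \<open>V\<close>.\<close>

definition wcut :: "'a set \<Rightarrow> 'a set \<Rightarrow> 'a set \<Rightarrow> bool" where
  "wcut V K S \<longleftrightarrow> S \<subseteq> V \<and> (\<forall>s\<in>S. \<exists>u\<in>V - S. adj s u \<and>
     (s \<in> K \<or> (\<exists>w\<in>V - S. adj s w \<and> (u, w) \<notin> reach (V - S))))"

definition acc :: "'a set \<Rightarrow> 'a set \<Rightarrow> bool" where
  "acc V K \<longleftrightarrow> (\<forall>S. wcut V K S \<longrightarrow> card (comps (V - S)) + card (S \<inter> K) = card S + 1 \<and>
     (S \<noteq> {} \<longrightarrow> (\<exists>s\<in>S. wcut V K (S - {s}))))"

text \<open>Shrink \<open>T\<close> while it still separates. When no vertex can be given back, each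
  \<open>s\<close> in \<open>T\<close> has a neighbour in the component of \<open>x\<close> and one
  in that of \<open>y\<close>, which makes \<open>T\<close> a cut set whatever \<open>K\<close>
  is.\<close>

lemma minimal_separator:
  assumes "finite T" "T \<subseteq> V" "x \<in> V - T" "y \<in> V - T" "(x, y) \<notin> reach (V - T)"
  shows "\<exists>S\<subseteq>T. wcut V K S \<and> (x, y) \<notin> reach (V - S)"
  using assms
proof (induction "card T" arbitrary: T rule: less_induct)
  case less
  show ?case
  proof (cases "\<exists>s\<in>T. (x, y) \<notin> reach (V - (T - {s}))")
    case True
    then obtain s where s: "s \<in> T" "(x, y) \<notin> reach (V - (T - {s}))" by blast
    have "\<exists>S\<subseteq>T - {s}. wcut V K S \<and> (x, y) \<notin> reach (V - S)"
      using less.prems s by (intro less.hyps) (auto intro!: card_Diff1_less simp del: card_Diff_insert card_Diff_singleton)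
    then show ?thesis by blast
  next
    case False
    have "wcut V K T" unfolding wcut_def
    proof (intro conjI ballI)
      fix s assume s: "s \<in> T"
      have e: "V - (T - {s}) = insert s (V - T)" using s less.prems by blast
      have "(x, y) \<in> reach (insert s (V - T))" using False s e by auto
      then obtain u where u: "adj s u" "(x, u) \<in> reach (V - T)"
        using reach_insert[of x y s "V - T"] less.prems by blast
      have "(y, x) \<in> reach (insert s (V - T))" using \<open>(x, y) \<in> _\<close> reach_sym by blast
      then obtain w where w: "adj s w" "(y, w) \<in> reach (V - T)"
        using reach_insert[of y x s "V - T"] less.prems reach_sym by blast
      have "u \<in> V - T" "w \<in> V - T" using u w less.prems reach_mem by blast+
      moreover have "(u, w) \<notin> reach (V - T)" using u w less.prems reach_trans reach_sym by meson
      ultimately show "\<exists>u\<in>V - T. adj s u \<and> (s \<in> K \<or> (\<exists>w\<in>V - T. adj s w \<and> (u, w) \<notin> reach (V - T)))"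
        using u w by blast
    qed (use less.prems in blast)
    then show ?thesis using less.prems by blast
  qed
qed

lemma acc_card:
  "acc V K \<Longrightarrow> wcut V K S \<Longrightarrow> card (comps (V - S)) + card (S \<inter> K) = card S + 1"
  by (simp add: acc_def)

text \<open>The descending chain of cut sets provided by accessibility passes through a singleton
  just before it reaches the empty set.\<close>

lemma acc_singleton:
  assumes "acc V K" "wcut V K S" "S \<noteq> {}" "finite S"
  shows "\<exists>s\<in>S. wcut V K {s}"
  using assms
proof (induction "card S" arbitrary: S rule: less_induct)
  case less
  then obtain s where s: "s \<in> S" "wcut V K (S - {s})" unfolding acc_def by blast
  show ?case
  proof (cases "S - {s} = {}")
    case True
    then have "S = {s}" using s by blast
    then show ?thesis using less by blast
  next
    case False
    then have "\<exists>t\<in>S - {s}. wcut V K {t}"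
      using less.prems s by (intro less.hyps) (auto intro!: card_Diff1_less simp del: card_Diff_insert card_Diff_singleton)
    then show ?thesis by blast
  qed
qed

end

section \<open>Pieces without a cut vertex\<close>

text \<open>\<open>a0\<close> and \<open>b0\<close> are the two marks. The assumptions treat
  \<open>A\<close> and \<open>B\<close> alike, so that \<open>block_swap\<close> transfers results
  from one side to the other.\<close>

locale block = graph adj for adj :: "'a \<Rightarrow> 'a \<Rightarrow> bool" +
  fixes A B :: "'a set" and a0 b0 :: 'a
  assumes finA: "finite A" and finB: "finite B"
    and noA: "a \<in> A \<Longrightarrow> a' \<in> A \<Longrightarrow> \<not> adj a a'" and noB: "b \<in> B \<Longrightarrow> b' \<in> B \<Longrightarrow> \<not> adj b b'"
    and a0: "a0 \<in> A" and b0: "b0 \<in> B"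
    and domA: "b \<in> B \<Longrightarrow> adj a0 b" and domB: "a \<in> A \<Longrightarrow> adj b0 a"
    and accV: "acc (A \<union> B) {a0, b0}"
    and no_cut_vertex: "wcut (A \<union> B) {a0, b0} {s} \<Longrightarrow> s \<in> {a0, b0}"
    and cutA: "wcut (A \<union> B) {a0, b0} A" and cutB: "wcut (A \<union> B) {a0, b0} B"
begin

lemma block_swap: "block adj B A b0 a0"
  using finA finB noA noB a0 b0 domA domB accV no_cut_vertex cutA cutB
  by unfold_locales (simp_all add: Un_commute insert_commute)

lemma disjoint: "A \<inter> B = {}"
  using domA noA a0 by blast

definition nb :: "'a \<Rightarrow> 'a set" where
  "nb x = {y \<in> A \<union> B. adj x y}"

lemma nbB: "b \<in> B \<Longrightarrow> nb b = {a \<in> A. adj b a}"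
  using noB by (auto simp: nb_def)

text \<open>The vertices isolated by deleting \<open>S \<subseteq> A\<close>. \<open>b0\<close> is
  kept out even for \<open>S = A\<close>: it always stands for the one component that
  \<open>card_comps_diff\<close> counts separately.\<close>

definition D :: "'a set \<Rightarrow> 'a set" where
  "D S = {b \<in> B - {b0}. nb b \<subseteq> S}"

lemma finD [simp]: "finite (D S)"
  using finB by (auto simp: D_def)

text \<open>What survives outside \<open>D S\<close> hangs on \<open>b0\<close>: a vertex of
  \<open>A - S\<close> is adjacent to it, and any other vertex of \<open>B - D S\<close> has a
  neighbour in \<open>A - S\<close>.\<close>

lemma card_comps_diff:
  assumes "S \<subseteq> A"
  shows "card (comps (A \<union> B - S)) = card (D S) + 1"
proof -
  define W where "W = (A - S) \<union> (B - D S)"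
  have e: "A \<union> B - S = D S \<union> W" using assms disjoint by (auto simp: W_def D_def)
  have DB: "D S \<subseteq> B" by (auto simp: D_def)
  have b0W: "b0 \<in> W" using b0 by (auto simp: W_def D_def)
  have r: "(b0, w) \<in> reach W" if w: "w \<in> W" for w
  proof -
    have ra: "(b0, a) \<in> reach W" if "a \<in> A - S" for a
      using that b0W domB by (intro reach_step) (auto simp: W_def)
    consider "w \<in> A - S" | "w = b0" | "w \<in> B - D S" "w \<noteq> b0" using w unfolding W_def by blast
    then show ?thesis
    proof cases
      case 3
      then obtain a where a: "a \<in> A - S" "adj w a" by (auto simp: D_def nbB)
      then have "(a, w) \<in> reach W" using w adj_sym by (intro reach_step) (auto simp: W_def)
      then show ?thesis using ra[OF a(1)] reach_trans by blast
    qed (use ra in auto)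
  qed
  have "conn W" unfolding conn_def using r reach_sym reach_trans by meson
  then have "card (comps W) = 1" using card_comps_conn b0W by blast
  moreover have "card (comps (D S)) = card (D S)"
    using noB DB by (intro card_comps_edgeless) blast
  moreover have "card (comps (D S \<union> W)) = card (comps (D S)) + card (comps W)"
  proof (rule comps_Un)
    show "\<not> adj u v" if "u \<in> D S" "v \<in> W" for u v
    proof
      assume "adj u v"
      have "u \<in> B" "nb u \<subseteq> S" using that by (auto simp: D_def)
      moreover have "v \<in> A - S \<or> v \<in> B" using that by (auto simp: W_def)
      ultimately show False using \<open>adj u v\<close> noB nbB by blast
    qed
    show "D S \<inter> W = {}" using DB disjoint by (auto simp: W_def)
  qed (auto simp: W_def finA finB)
  ultimately show ?thesis using e by simp
qed

text \<open>Some vertex of \<open>S\<close> is a cut set by itself, hence a mark, and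
  \<open>b0\<close> lies on the other side.\<close>

lemma a0_in_cut:
  assumes "wcut (A \<union> B) {a0, b0} S" "S \<subseteq> A" "S \<noteq> {}"
  shows "a0 \<in> S"
proof -
  have "finite S" using assms(2) finA finite_subset by blast
  then obtain s where "s \<in> S" "s \<in> {a0, b0}"
    using acc_singleton[OF accV assms(1,3)] no_cut_vertex by blast
  then show ?thesis using assms(2) b0 disjoint by auto
qed

lemma card_cut:
  assumes "wcut (A \<union> B) {a0, b0} S" "S \<subseteq> A" "S \<noteq> {}"
  shows "card (D S) + 1 = card S"
proof -
  have "S \<inter> {a0, b0} = {a0}" using a0_in_cut[OF assms] assms(2) b0 disjoint by auto
  then show ?thesis using acc_card[OF accV assms(1)] card_comps_diff[OF assms(2)] by simp
qed

section \<open>Matching and nested neighbourhoods\<close>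

lemma a0_nb: "b \<in> B \<Longrightarrow> a0 \<in> nb b"
  using domA adj_sym a0 by (auto simp: nb_def)

text \<open>Deleting \<open>s\<close> from a cut set in the chain lowers its size by one, so by
  \<open>card_cut\<close> exactly one \<open>b\<close> drops out of \<open>D S\<close>. Then
  \<open>s\<close> lies in \<open>nb b\<close> but in no neighbourhood of the vertices left:
  \<open>b\<close> is matched with \<open>s\<close>, and \<open>nb b\<close> is a new set.\<close>

lemma matching_cut:
  assumes "wcut (A \<union> B) {a0, b0} S" "S \<subseteq> A"
  shows "\<exists>m. inj_on m (D S) \<and> (\<forall>b\<in>D S. m b \<in> nb b - {a0}) \<and> inj_on nb (D S)"
  using assms
proof (induction "card S" arbitrary: S rule: less_induct)
  case less
  have finS: "finite S" using less.prems finA finite_subset by blast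
  show ?case
  proof (cases "S = {}")
    case True
    then have "D S = {}" using a0_nb by (auto simp: D_def)
    then show ?thesis by simp
  next
    case False
    then obtain s where s: "s \<in> S" "wcut (A \<union> B) {a0, b0} (S - {s})"
      using accV less.prems unfolding acc_def by blast
    define S' where "S' = S - {s}"
    have S': "wcut (A \<union> B) {a0, b0} S'" "S' \<subseteq> A" "card S = Suc (card S')"
      using s less.prems finS card_Suc_Diff1[of S s] by (auto simp: S'_def)
    show ?thesis
    proof (cases "S' = {}")
      case True
      \<comment> \<open>\<open>card_cut\<close> holds for nonempty cut sets only, so the singleton
        at the bottom of the chain is treated apart; nothing has to be matched there.\<close>
      then have "card S = 1" using S' by simp
      then have "D S = {}" using card_cut[OF less.prems False] by simp
      then show ?thesis by simp
    next
      case False': False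
      obtain m where m: "inj_on m (D S')" "\<forall>b\<in>D S'. m b \<in> nb b - {a0}" "inj_on nb (D S')"
        using less.hyps[of S'] S' by auto
      have c: "card (D S) = Suc (card (D S'))"
        using card_cut[OF less.prems False] card_cut[OF S'(1,2) False'] S'(3) by simp
      have sub: "D S' \<subseteq> D S" by (auto simp: D_def S'_def)
      have "card (D S - D S') = 1" using c sub by (simp add: card_Diff_subset)
      then obtain b where "D S - D S' = {b}" by (meson card_1_singletonE)
      then have b: "D S = insert b (D S')" "b \<notin> D S'" using sub by auto
      have sb: "s \<in> nb b"
      proof -
        have "b \<in> D S" using b by blast
        then have "nb b \<subseteq> S" "\<not> nb b \<subseteq> S'" using b(2) by (auto simp: D_def)
        then show ?thesis by (auto simp: S'_def)
      qed
      \<comment> \<open>\<open>a0\<close> stays in every nonempty cut set of the chain, so it is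
        never the deleted vertex and the matching avoids it.\<close>
      have sa0: "s \<noteq> a0" using a0_in_cut[OF S'(1,2) False'] by (auto simp: S'_def)
      have ns: "s \<notin> nb b'" if "b' \<in> D S'" for b'
        using that by (auto simp: D_def S'_def)
      have "s \<notin> m ` D S'" using m(2) ns by auto
      then have "inj_on (m(b := s)) (D S)"
        unfolding b(1) using inj_on_fun_updI[OF m(1), of s b] b(2) by (simp add: image_def)
      moreover have "\<forall>b'\<in>D S. (m(b := s)) b' \<in> nb b' - {a0}"
        using m(2) b sb sa0 by auto
      moreover have "inj_on nb (D S)"
        unfolding b(1) inj_on_insert using m(3) ns sb by auto
      ultimately show ?thesis by blast
    qed
  qed
qed

lemma D_A: "D A = B - {b0}"
  using nbB by (auto simp: D_def)

lemma inj_nbB: "inj_on nb (B - {b0})"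
  using matching_cut[OF cutA] D_A by auto

text \<open>Deleting \<open>nb b\<close> isolates \<open>b\<close> and spares \<open>b0\<close>;
  each deleted vertex is adjacent to both.\<close>

lemma cut_nb:
  assumes "b \<in> B - {b0}" shows "wcut (A \<union> B) {a0, b0} (nb b)"
  unfolding wcut_def
proof (intro conjI ballI)
  show "nb b \<subseteq> A \<union> B" by (auto simp: nb_def)
  fix s assume s: "s \<in> nb b"
  have sA: "s \<in> A" using s assms nbB by auto
  have b: "b \<in> A \<union> B - nb b" "b0 \<in> A \<union> B - nb b"
    using assms b0 disjoint by (auto simp: nbB)
  have "b0 \<notin> {b}" using assms by auto
  then have "(b, b0) \<notin> reach (A \<union> B - nb b)"
    using reach_closed[of b b0 "A \<union> B - nb b" "{b}"] nbB assms noB by (auto simp: nb_def)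
  moreover have "adj s b" "adj s b0" using s sA domB adj_sym by (auto simp: nb_def)
  ultimately show "\<exists>u\<in>A \<union> B - nb b. adj s u \<and> (s \<in> {a0, b0} \<or>
      (\<exists>w\<in>A \<union> B - nb b. adj s w \<and> (u, w) \<notin> reach (A \<union> B - nb b)))"
    using b by blast
qed

text \<open>By contradiction. \<open>m\<close> is a bijection from \<open>B'\<close> onto
  \<open>A - {a0}\<close>, so the block can be read off from \<open>B'\<close> ordered by inclusion
  of neighbourhoods, and an incomparable pair is turned into a cut set that violates the component
  count.\<close>

lemma nested:
  assumes b: "b \<in> B - {b0}" and b': "b' \<in> B - {b0}"
  shows "nb b \<subseteq> nb b' \<or> nb b' \<subseteq> nb b"
proof (rule ccontr)
  assume nn: "\<not> (nb b \<subseteq> nb b' \<or> nb b' \<subseteq> nb b)"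
  define B' where "B' = B - {b0}"
  obtain m where m: "inj_on m B'" "\<And>l. l \<in> B' \<Longrightarrow> m l \<in> nb l - {a0}"
    using matching_cut[OF cutA] D_A by (auto simp: B'_def)
  have mA: "m l \<in> A - {a0}" if "l \<in> B'" for l using m(2)[OF that] that nbB by (auto simp: B'_def)
  have "card (D A) + 1 = card A" using card_cut[OF cutA] a0 by auto
  then have "card (m ` B') = card (A - {a0})"
    using m(1) a0 finA D_A by (simp add: card_image B'_def)
  then have mim: "m ` B' = A - {a0}" using mA finA by (intro card_subset_eq) auto
  \<comment> \<open>The cut set \<open>nb l'\<close> has, besides \<open>a0\<close>, as many
    vertices as \<open>D (nb l')\<close>, so \<open>m\<close> maps \<open>D (nb l')\<close> onto
    them. By injectivity \<open>m l\<close> in \<open>nb l'\<close> forces \<open>l\<close> into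
    \<open>D (nb l')\<close>.\<close>
  have tr: "nb l \<subseteq> nb l'" if l: "l \<in> B'" "l' \<in> B'" "m l \<in> nb l'" for l l'
  proof -
    let ?S = "nb l'"
    have S: "?S \<subseteq> A" "?S \<noteq> {}" "wcut (A \<union> B) {a0, b0} ?S" "finite ?S"
      using l nbB a0_nb cut_nb finA by (auto simp: B'_def)
    have DB': "D ?S \<subseteq> B'" by (auto simp: D_def B'_def)
    have "m ` D ?S \<subseteq> ?S - {a0}" using m(2) DB' by (fastforce simp: D_def)
    moreover have "card (m ` D ?S) = card (?S - {a0})"
    proof -
      have "a0 \<in> ?S" using l a0_nb by (auto simp: B'_def)
      moreover have "card (D ?S) + 1 = card ?S" using card_cut S by blast
      moreover have "card (m ` D ?S) = card (D ?S)"
        using inj_on_subset[OF m(1) DB'] by (rule card_image)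
      ultimately show ?thesis using S by simp
    qed
    ultimately have "m ` D ?S = ?S - {a0}" using S by (intro card_subset_eq) auto
    then obtain l'' where "l'' \<in> D ?S" "m l'' = m l" using l m(2)[OF l(1)] by (metis Diff_iff imageE)
    then have "l \<in> D ?S" using m(1) DB' l by (auto simp: inj_on_def)
    then show ?thesis by (simp add: D_def)
  qed
  have injN: "l = l'" if "l \<in> B'" "l' \<in> B'" "nb l \<subseteq> nb l'" "nb l' \<subseteq> nb l" for l l'
    using inj_nbB that by (auto simp: inj_on_def B'_def)
  have adjm: "nb l \<subseteq> nb l' \<longleftrightarrow> adj l' (m l)" if "l \<in> B'" "l' \<in> B'" for l l'
  proof
    show "adj l' (m l)" if "nb l \<subseteq> nb l'" using that m(2) \<open>l \<in> B'\<close> by (auto simp: nb_def)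
    show "nb l \<subseteq> nb l'" if "adj l' (m l)"
      using that tr[of l l'] mA \<open>l \<in> B'\<close> \<open>l' \<in> B'\<close> by (auto simp: nb_def)
  qed
  have bB: "b \<in> B'" "b' \<in> B'" "b \<noteq> b'" using b b' nn by (auto simp: B'_def)
  \<comment> \<open>Below and above \<open>b\<close> or \<open>b'\<close>, strictly so by
    \<open>injN\<close>. Incomparability makes the two sets disjoint and keeps \<open>b\<close> and
    \<open>b'\<close> out of both.\<close>
  define Dn where "Dn = {l \<in> B'. l \<noteq> b \<and> nb l \<subseteq> nb b \<or> l \<in> B' \<and> l \<noteq> b' \<and> nb l \<subseteq> nb b'}"
  define Up where "Up = {l \<in> B'. l \<noteq> b \<and> nb b \<subseteq> nb l \<or> l \<in> B' \<and> l \<noteq> b' \<and> nb b' \<subseteq> nb l}"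
  have sub: "Dn \<subseteq> B'" "Up \<subseteq> B'" by (auto simp: Dn_def Up_def)
  have "finite B'" using finB by (simp add: B'_def)
  then have fin: "finite Dn" "finite Up" using sub finite_subset by blast+
  have disj: "Dn \<inter> Up = {}"
    using injN bB nn by (auto simp: Dn_def Up_def)
  have bn: "b \<notin> Dn" "b \<notin> Up" "b' \<notin> Dn" "b' \<notin> Up"
    using nn by (auto simp: Dn_def Up_def)
  \<comment> \<open>The neighbours of \<open>b\<close> are \<open>a0\<close> and the
    \<open>m l\<close> with \<open>l\<close> weakly below \<open>b\<close>; those of
    \<open>m b\<close> are \<open>b0\<close> and the \<open>l\<close> weakly above \<open>b\<close>.
    Deleting \<open>S\<close> leaves of these only the edge between \<open>b\<close> and
    \<open>m b\<close>, and likewise at \<open>b'\<close>.\<close>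
  define S where "S = {a0, b0} \<union> m ` Dn \<union> Up"
  define V where "V = A \<union> B"
  have SV: "S \<subseteq> V" using a0 b0 mA sub by (fastforce simp: S_def V_def B'_def)
  have mB: "m l \<notin> B" if "l \<in> B'" for l using mA[OF that] disjoint by blast
  have mS: "m l \<in> S \<longleftrightarrow> l \<in> Dn" if "l \<in> B'" for l
    using mA[OF that] mB[OF that] b0 m(1) sub that by (auto simp: S_def inj_on_def B'_def subset_iff)
  have lS: "l \<in> S \<longleftrightarrow> l \<in> Up" if "l \<in> B'" for l
    using that a0 disjoint mA sub by (fastforce simp: S_def B'_def)
  have nbV: "x = a0 \<or> (\<exists>l'\<in>B'. x = m l' \<and> nb l' \<subseteq> nb l)" if "l \<in> B'" "adj l x" "x \<in> V" for l x
  proof -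
    have "x \<in> A" using that noB by (auto simp: V_def B'_def)
    then consider "x = a0" | "x \<in> m ` B'" using mim by blast
    then show ?thesis using adjm that by cases auto
  qed
  have nmV: "x = b0 \<or> (x \<in> B' \<and> nb l \<subseteq> nb x)" if "l \<in> B'" "adj (m l) x" "x \<in> V" for l x
  proof -
    have "x \<in> B" using that noA mA by (auto simp: V_def)
    then show ?thesis using adjm adj_sym that by (auto simp: B'_def)
  qed
  \<comment> \<open>\<open>C t\<close> is the expected component of \<open>t\<close> in
    \<open>V - S\<close>: an edge for \<open>b\<close> and \<open>b'\<close>, a single vertex for
    \<open>Dn\<close> and for the partners of \<open>Up\<close>. Proving it closed under adjacency
    is enough to separate the representatives in \<open>T\<close>.\<close>
  define C where "C t = (if t = b then {b, m b} else if t = b' then {b', m b'} else {t})" for t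
  define T where "T = {b, b'} \<union> Dn \<union> m ` Up"
  have KS: "a0 \<in> S" "b0 \<in> S" by (auto simp: S_def)
  have closed: "y \<in> C t" if "t \<in> T" "x \<in> C t" "y \<in> V - S" "adj x y" for t x y
  proof -
    have y: "y \<in> V" "y \<notin> S" "y \<noteq> a0" "y \<noteq> b0" using that KS by auto
    have main: "y \<in> {c, m c}" if c: "c \<in> {b, b'}" "x \<in> {c, m c}" for c
    proof (cases "x = c")
      case True
      then obtain l' where l': "l' \<in> B'" "y = m l'" "nb l' \<subseteq> nb c"
        using nbV[of c y] y c bB \<open>adj x y\<close> by blast
      then have "l' \<notin> Dn" using y mS by blast
      then have "l' = c" using l' c by (auto simp: Dn_def)
      then show ?thesis using l' by simp
    next
      case False
      then have "y \<in> B'" "nb c \<subseteq> nb y" using nmV[of c y] y c bB \<open>adj x y\<close> by auto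
      moreover have "y \<notin> Up" using y lS \<open>y \<in> B'\<close> by blast
      ultimately have "y = c" using c by (auto simp: Up_def)
      then show ?thesis by simp
    qed
    consider "t = b" | "t = b'" "t \<noteq> b" | "t \<in> Dn" "t \<noteq> b" "t \<noteq> b'" | l where "l \<in> Up" "t = m l"
        "t \<noteq> b" "t \<noteq> b'"
      using \<open>t \<in> T\<close> by (auto simp: T_def)
    then show ?thesis
    proof cases
      case 1 then show ?thesis using main[of b] \<open>x \<in> C t\<close> by (auto simp: C_def)
    next
      case 2 then show ?thesis using main[of b'] \<open>x \<in> C t\<close> by (auto simp: C_def)
    next
      case 3
      then have x: "x = t" "t \<in> B'" using \<open>x \<in> C t\<close> sub by (auto simp: C_def)
      then obtain l' where l': "l' \<in> B'" "y = m l'" "nb l' \<subseteq> nb t"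
        using nbV[of t y] y \<open>adj x y\<close> by blast
      have "l' \<in> Dn \<or> l' \<in> {b, b'}" using 3 l' by (auto simp: Dn_def)
      moreover have "l' \<notin> Dn" using mS l' y by blast
      \<comment> \<open>If \<open>b\<close> were below some \<open>t\<close> in \<open>Dn\<close>,
        then \<open>t = b\<close> or \<open>b\<close> would be below \<open>b'\<close>; the same
        with \<open>b\<close> and \<open>b'\<close> exchanged.\<close>
      moreover have "l' \<notin> {b, b'}"
        using 3 l' nn injN[of l' t] x bB by (auto simp: Dn_def)
      ultimately show ?thesis by blast
    next
      case 4
      then have x: "x = m l" "l \<in> B'" using \<open>x \<in> C t\<close> sub by (auto simp: C_def)
      then have y': "y \<in> B'" "nb l \<subseteq> nb y" using nmV[of l y] y \<open>adj x y\<close> by auto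
      have "y \<in> Up \<or> y \<in> {b, b'}" using 4 y' by (auto simp: Up_def)
      moreover have "y \<notin> Up" using lS y' y by blast
      moreover have "y \<notin> {b, b'}"
        using 4 y' nn injN[of y l] x bB by (auto simp: Up_def)
      ultimately show ?thesis by blast
    qed
  qed
  have CT: "u = t" if "t \<in> T" "u \<in> T" "u \<in> C t" for t u
  proof -
    have "m c \<notin> T" if c: "c \<in> {b, b'}" for c
    proof
      assume "m c \<in> T"
      have cB: "c \<in> B'" "c \<notin> Up" using c bB bn by auto
      then have "m c \<notin> B" using mB by blast
      then have "m c \<in> m ` Up" using \<open>m c \<in> T\<close> bB sub by (auto simp: T_def B'_def)
      then obtain l where "l \<in> Up" "m c = m l" by blast
      then have "c = l" using inj_onD[OF m(1)] cB sub by blast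
      then show False using \<open>l \<in> Up\<close> cB by blast
    qed
    then show ?thesis using that unfolding C_def by (auto split: if_splits)
  qed
  have TV: "T \<subseteq> V - S"
    using bB bn sub lS mS disj mA unfolding T_def V_def B'_def by blast
  have sep: "u = t" if "t \<in> T" "u \<in> T" "(t, u) \<in> reach (V - S)" for t u
  proof -
    have "t \<in> C t" by (auto simp: C_def)
    then have "u \<in> C t" using reach_closed[OF that(3)] closed[OF that(1)] by blast
    then show ?thesis using CT that by blast
  qed
  \<comment> \<open>A partner \<open>m l\<close> with \<open>l\<close> below \<open>c\<close>
    touches the separated vertices \<open>l\<close> and \<open>c\<close>; an \<open>s\<close> above
    \<open>c\<close> touches \<open>m s\<close> and \<open>m c\<close>. The marks \<open>a0\<close>
    and \<open>b0\<close> need a single surviving neighbour.\<close>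
  have "wcut V {a0, b0} S" unfolding wcut_def
  proof (intro conjI ballI)
    fix s assume s: "s \<in> S"
    have bT: "b \<in> T" "b' \<in> T" by (auto simp: T_def)
    have mbV: "m b \<in> V - S" "m b' \<in> V - S" using mS bB bn mA by (auto simp: V_def)
    consider "s = a0" | "s = b0" | l where "l \<in> Dn" "s = m l" | "s \<in> Up" using s by (auto simp: S_def)
    then show "\<exists>u\<in>V - S. adj s u \<and> (s \<in> {a0, b0} \<or> (\<exists>w\<in>V - S. adj s w \<and> (u, w) \<notin> reach (V - S)))"
    proof cases
      case 1
      then show ?thesis using bT TV domA b by blast
    next
      case 2
      then show ?thesis using mbV domB mA bB by blast
    next
      case 3
      then obtain c where c: "c \<in> {b, b'}" "nb l \<subseteq> nb c" "l \<noteq> c" by (auto simp: Dn_def)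
      have "adj s c" "adj s l" using 3 c adjm[of l c] adjm[of l l] sub bB adj_sym by auto
      moreover have "(c, l) \<notin> reach (V - S)" using sep[of c l] 3 c by (auto simp: T_def)
      moreover have "c \<in> V - S" "l \<in> V - S" using TV c 3 by (auto simp: T_def)
      ultimately show ?thesis by blast
    next
      case 4
      then obtain c where c: "c \<in> {b, b'}" "nb c \<subseteq> nb s" "s \<noteq> c" by (auto simp: Up_def)
      have "adj s (m c)" "adj s (m s)" using 4 c adjm[of c s] adjm[of s s] sub bB by auto
      moreover have "(m c, m s) \<notin> reach (V - S)"
      proof
        assume r: "(m c, m s) \<in> reach (V - S)"
        have "(c, m c) \<in> reach (V - S)"
          using c bT TV mbV adjm[of c c] bB by (intro reach_step) auto
        then have "(c, m s) \<in> reach (V - S)" using r reach_trans by blast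
        then have "m s = c" using sep[of c "m s"] 4 c by (auto simp: T_def)
        moreover have "m s \<notin> B" "c \<in> B" using mB[of s] sub 4 c bB by (auto simp: B'_def)
        ultimately show False by simp
      qed
      moreover have "m c \<in> V - S" "m s \<in> V - S" using TV mbV c 4 by (auto simp: T_def)
      ultimately show ?thesis by blast
    qed
  qed (rule SV)
  then have cnt: "card (comps (V - S)) + card (S \<inter> {a0, b0}) = card S + 1"
    using acc_card accV by (simp add: V_def)
  have "a0 \<noteq> b0" using a0 b0 disjoint by blast
  then have "card (S \<inter> {a0, b0}) = 2" using KS by simp
  moreover have "card T \<le> card (comps (V - S))"
    using TV sep finA finB by (intro card_comps_ge) (auto simp: V_def)
  moreover have "card T = card Dn + card Up + 2"
  proof -
    have "card (m ` Up) = card Up" using m(1) sub inj_on_subset by (intro card_image) blast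
    moreover have "Dn \<inter> m ` Up = {}" using mB sub by (auto simp: B'_def)
    moreover have "({b, b'} \<union> Dn) \<inter> m ` Up = {}" "{b, b'} \<inter> Dn = {}"
      using mB sub bB bn by (auto simp: B'_def)
    ultimately show ?thesis using fin bB by (simp add: T_def card_Un_disjoint)
  qed
  moreover have "card S \<le> card Dn + card Up + 2"
  proof -
    have "card S \<le> card ({a0, b0} \<union> m ` Dn) + card Up" unfolding S_def by (rule card_Un_le)
    also have "\<dots> \<le> card {a0, b0} + card (m ` Dn) + card Up" using card_Un_le add_right_mono by blast
    also have "\<dots> \<le> 2 + card Dn + card Up"
      using card_image_le[OF fin(1), of m] by (auto simp: card_insert_if)
    finally show ?thesis by simp
  qed
  \<comment> \<open>The count permits \<open>card S - 1\<close> components, hence at most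
    \<open>card Dn + card Up + 1\<close>, and \<open>T\<close> exhibits one more.\<close>
  ultimately show False using cnt by simp
qed

section \<open>The order on a block\<close>

lemma nbA: "a \<in> A \<Longrightarrow> nb a = {b \<in> B. adj a b}"
  using noA by (auto simp: nb_def)

lemma nested_and_inj_A:
  shows "inj_on nb (A - {a0})"
    and "a \<in> A - {a0} \<Longrightarrow> a' \<in> A - {a0} \<Longrightarrow> nb a \<subseteq> nb a' \<or> nb a' \<subseteq> nb a"
proof -
  interpret other: block adj B A b0 a0 by (rule block_swap)
  have e: "other.nb = nb" by (simp add: fun_eq_iff nb_def other.nb_def Un_commute)
  show "inj_on nb (A - {a0})" using other.inj_nbB e by simp
  show "a \<in> A - {a0} \<Longrightarrow> a' \<in> A - {a0} \<Longrightarrow> nb a \<subseteq> nb a' \<or> nb a' \<subseteq> nb a"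
    using other.nested e by simp
qed

text \<open>No vertex of \<open>A\<close> precedes one of \<open>B\<close>, and inclusion runs in
  opposite directions on the two sides, so that non-adjacency is passed on in both mixed cases of
  transitivity. The clauses \<open>x \<noteq> b0\<close> and \<open>y \<noteq> a0\<close> break
  ties: \<open>nb\<close> is known to be injective only away from \<open>b0\<close> and
  \<open>a0\<close>.\<close>

definition prec :: "'a \<Rightarrow> 'a \<Rightarrow> bool" where
  "prec x y \<longleftrightarrow> x \<noteq> y \<and>
     (x \<in> B \<and> y \<in> A \<and> \<not> adj x y \<or>
      x \<in> B \<and> y \<in> B \<and> x \<noteq> b0 \<and> nb x \<subseteq> nb y \<or>
      x \<in> A \<and> y \<in> A \<and> y \<noteq> a0 \<and> nb y \<subseteq> nb x)"

lemma prec_trans: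
  assumes "prec x y" "prec y z" shows "prec x z"
proof -
  have BA: "\<And>x. x \<in> B \<Longrightarrow> x \<notin> A" using disjoint by blast
  consider "x \<in> B" "y \<in> B" "z \<in> B" | "x \<in> B" "y \<in> B" "z \<in> A" | "x \<in> B" "y \<in> A" "z \<in> A"
    | "x \<in> A" "y \<in> A" "z \<in> A"
    using assms BA unfolding prec_def by blast
  then show ?thesis
  proof cases
    case 1
    have "x \<noteq> z"
    proof
      assume "x = z"
      then have "x \<in> B - {b0}" "y \<in> B - {b0}" "nb x = nb y" "x \<noteq> y"
        using assms 1 BA unfolding prec_def by auto
      then show False using inj_nbB by (auto simp: inj_on_def)
    qed
    then show ?thesis using assms 1 BA unfolding prec_def by auto
  next
    case 2
    have "nb x \<subseteq> nb y" "\<not> adj y z" using assms 2 BA unfolding prec_def by auto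
    then have "\<not> adj x z" using 2 by (auto simp: nb_def)
    then show ?thesis using 2 BA unfolding prec_def by auto
  next
    case 3
    have "nb z \<subseteq> nb y" "\<not> adj x y" using assms 3 BA unfolding prec_def by auto
    then have "\<not> adj x z" using 3 adj_sym by (auto simp: nb_def)
    then show ?thesis using 3 BA unfolding prec_def by auto
  next
    case 4
    have "x \<noteq> z"
    proof
      assume "x = z"
      then have "x \<in> A - {a0}" "y \<in> A - {a0}" "nb x = nb y" "x \<noteq> y"
        using assms 4 BA unfolding prec_def by auto
      then show False using nested_and_inj_A(1) by (auto simp: inj_on_def)
    qed
    then show ?thesis using assms 4 BA unfolding prec_def by auto
  qed
qed

lemma prec_comparable:
  assumes "x \<in> A \<union> B" "y \<in> A \<union> B" "x \<noteq> y"
  shows "adj x y \<longleftrightarrow> \<not> prec x y \<and> \<not> prec y x"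
proof -
  have BA: "\<And>x. x \<in> B \<Longrightarrow> x \<notin> A" using disjoint by blast
  consider "x \<in> A" "y \<in> A" | "x \<in> B" "y \<in> B" | "x \<in> A" "y \<in> B" | "x \<in> B" "y \<in> A" using assms by blast
  then show ?thesis
  proof cases
    case 1
    have "nb y \<subseteq> nb x" if "x = a0" using 1 that domA by (auto simp: nbA)
    moreover have "nb x \<subseteq> nb y" if "y = a0" using 1 that domA by (auto simp: nbA)
    ultimately have "prec x y \<or> prec y x"
      using 1 assms nested_and_inj_A(2)[of x y] unfolding prec_def by blast
    then show ?thesis using 1 noA by blast
  next
    case 2
    have "nb y \<subseteq> nb x" if "x = b0" using 2 that domB by (auto simp: nbB)
    moreover have "nb x \<subseteq> nb y" if "y = b0" using 2 that domB by (auto simp: nbB)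
    ultimately have "prec x y \<or> prec y x"
      using 2 assms nested[of x y] unfolding prec_def by blast
    then show ?thesis using 2 noB by blast
  next
    case 3
    then show ?thesis using BA adj_sym assms unfolding prec_def by blast
  next
    case 4
    then show ?thesis using BA adj_sym assms unfolding prec_def by blast
  qed
qed

lemma prec_ends: "\<not> prec x a0" "\<not> prec b0 x"
  using disjoint a0 b0 domA domB adj_sym unfolding prec_def by blast+

lemma prec_mem: "prec x y \<Longrightarrow> x \<in> A \<union> B \<and> y \<in> A \<union> B"
  unfolding prec_def by blast

end

section \<open>Ordering a bipartite graph\<close>

locale bip_graph = graph adj for adj :: "'a \<Rightarrow> 'a \<Rightarrow> bool" +
  fixes side :: "'a \<Rightarrow> bool"
  assumes adj_side: "adj u v \<Longrightarrow> side u \<noteq> side v"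
begin

text \<open>The ends \<open>Kl\<close> and \<open>Kr\<close> are sets with at most one element, so
  that pieces with fewer than two marks need no dummy ends.\<close>

definition good_order :: "'a set \<Rightarrow> 'a set \<Rightarrow> ('a \<Rightarrow> 'a \<Rightarrow> bool) \<Rightarrow> 'a set \<Rightarrow> 'a set \<Rightarrow> bool" where
  "good_order V K lt Kl Kr \<longleftrightarrow>
     (\<forall>x y. lt x y \<longrightarrow> x \<in> V \<and> y \<in> V) \<and> (\<forall>x. \<not> lt x x) \<and>
     (\<forall>x y z. lt x y \<longrightarrow> lt y z \<longrightarrow> lt x z) \<and>
     (\<forall>x\<in>V. \<forall>y\<in>V. x \<noteq> y \<longrightarrow> (adj x y \<longleftrightarrow> \<not> lt x y \<and> \<not> lt y x)) \<and>
     K \<subseteq> Kl \<union> Kr \<and> (\<forall>x\<in>Kl. \<forall>y\<in>Kl. x = y) \<and> (\<forall>x\<in>Kr. \<forall>y\<in>Kr. x = y) \<and>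
     (\<forall>p\<in>Kl. \<forall>x. \<not> lt x p) \<and> (\<forall>q\<in>Kr. \<forall>x. \<not> lt q x)"

lemma good_orderI:
  assumes "\<And>x y. lt x y \<Longrightarrow> x \<in> V \<and> y \<in> V" "\<And>x. \<not> lt x x" "\<And>x y z. lt x y \<Longrightarrow> lt y z \<Longrightarrow> lt x z"
    "\<And>x y. x \<in> V \<Longrightarrow> y \<in> V \<Longrightarrow> x \<noteq> y \<Longrightarrow> adj x y \<longleftrightarrow> \<not> lt x y \<and> \<not> lt y x"
    "K \<subseteq> Kl \<union> Kr" "\<And>x y. x \<in> Kl \<Longrightarrow> y \<in> Kl \<Longrightarrow> x = y" "\<And>x y. x \<in> Kr \<Longrightarrow> y \<in> Kr \<Longrightarrow> x = y"
    "\<And>p x. p \<in> Kl \<Longrightarrow> \<not> lt x p" "\<And>q x. q \<in> Kr \<Longrightarrow> \<not> lt q x"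
  shows "good_order V K lt Kl Kr"
  unfolding good_order_def
proof (intro conjI)
  show "\<forall>x y. lt x y \<longrightarrow> x \<in> V \<and> y \<in> V" using assms(1) by blast
  show "\<forall>x. \<not> lt x x" using assms(2) by blast
  show "\<forall>x y z. lt x y \<longrightarrow> lt y z \<longrightarrow> lt x z" using assms(3) by blast
  show "\<forall>x\<in>V. \<forall>y\<in>V. x \<noteq> y \<longrightarrow> (adj x y \<longleftrightarrow> \<not> lt x y \<and> \<not> lt y x)" using assms(4) by blast
  show "K \<subseteq> Kl \<union> Kr" by (rule assms(5))
  show "\<forall>x\<in>Kl. \<forall>y\<in>Kl. x = y" "\<forall>x\<in>Kr. \<forall>y\<in>Kr. x = y" using assms(6,7) by blast+
  show "\<forall>p\<in>Kl. \<forall>x. \<not> lt x p" "\<forall>q\<in>Kr. \<forall>x. \<not> lt q x" using assms(8,9) by blast+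
qed

lemma good_orderD:
  assumes "good_order V K lt Kl Kr"
  shows "lt x y \<Longrightarrow> x \<in> V \<and> y \<in> V" and "\<not> lt x x" and "lt x y \<Longrightarrow> lt y z \<Longrightarrow> lt x z"
    and "x \<in> V \<Longrightarrow> y \<in> V \<Longrightarrow> x \<noteq> y \<Longrightarrow> adj x y \<longleftrightarrow> \<not> lt x y \<and> \<not> lt y x"
    and "K \<subseteq> Kl \<union> Kr" and "x \<in> Kl \<Longrightarrow> y \<in> Kl \<Longrightarrow> x = y" and "x \<in> Kr \<Longrightarrow> y \<in> Kr \<Longrightarrow> x = y"
    and "x \<in> Kl \<Longrightarrow> \<not> lt y x" and "x \<in> Kr \<Longrightarrow> \<not> lt x y"
proof -
  have "\<forall>x y. lt x y \<longrightarrow> x \<in> V \<and> y \<in> V" "\<forall>x. \<not> lt x x" "\<forall>x y z. lt x y \<longrightarrow> lt y z \<longrightarrow> lt x z"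
    "\<forall>x\<in>V. \<forall>y\<in>V. x \<noteq> y \<longrightarrow> (adj x y \<longleftrightarrow> \<not> lt x y \<and> \<not> lt y x)" "K \<subseteq> Kl \<union> Kr"
    "\<forall>x\<in>Kl. \<forall>y\<in>Kl. x = y" "\<forall>x\<in>Kr. \<forall>y\<in>Kr. x = y" "\<forall>p\<in>Kl. \<forall>x. \<not> lt x p" "\<forall>q\<in>Kr. \<forall>x. \<not> lt q x"
    using assms unfolding good_order_def by - (elim conjE, assumption)+
  then show "lt x y \<Longrightarrow> x \<in> V \<and> y \<in> V" "\<not> lt x x" "lt x y \<Longrightarrow> lt y z \<Longrightarrow> lt x z"
    "x \<in> V \<Longrightarrow> y \<in> V \<Longrightarrow> x \<noteq> y \<Longrightarrow> adj x y \<longleftrightarrow> \<not> lt x y \<and> \<not> lt y x"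
    "K \<subseteq> Kl \<union> Kr" "x \<in> Kl \<Longrightarrow> y \<in> Kl \<Longrightarrow> x = y" "x \<in> Kr \<Longrightarrow> y \<in> Kr \<Longrightarrow> x = y"
    "x \<in> Kl \<Longrightarrow> \<not> lt y x" "x \<in> Kr \<Longrightarrow> \<not> lt x y"
    by metis+
qed

lemma good_order_reverse:
  assumes "good_order V K lt Kl Kr" shows "good_order V K (\<lambda>x y. lt y x) Kr Kl"
proof (rule good_orderI)
  note D = good_orderD[OF assms]
  show "K \<subseteq> Kr \<union> Kl" using D(5) by blast
  show "lt z x" if "lt y x" "lt z y" for x y z using D(3) that by blast
  show "adj x y \<longleftrightarrow> \<not> lt y x \<and> \<not> lt x y" if "x \<in> V" "y \<in> V" "x \<noteq> y" for x y using D(4) that by blast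
  show "x \<in> V \<and> y \<in> V" if "lt y x" for x y using D(1)[OF that] by blast
  show "\<not> lt x x" for x by (rule D(2))
  show "x = y" if "x \<in> Kr" "y \<in> Kr" for x y using D(7) that by blast
  show "x = y" if "x \<in> Kl" "y \<in> Kl" for x y using D(6) that by blast
  show "\<not> lt p x" if "p \<in> Kr" for p x using D(9) that by blast
  show "\<not> lt x q" if "q \<in> Kl" for q x using D(8) that by blast
qed

lemma neighbour_exists:
  assumes "conn U" "x \<in> U" "y \<in> U" "x \<noteq> y"
  shows "\<exists>z\<in>U. adj x z"
proof (rule ccontr)
  assume "\<not> (\<exists>z\<in>U. adj x z)"
  moreover have "(x, y) \<in> reach U" using assms by (auto simp: conn_def)
  ultimately show False using reach_closed[of x y U "{x}"] assms by blast
qed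

text \<open>A connected piece with at most two vertices has no non-adjacent pair, so the empty order
  works and any vertex may serve as either end.\<close>

lemma order_small:
  assumes "finite V" "V \<noteq> {}" "conn V" "K \<subseteq> V" "card V \<le> 2"
  shows "\<exists>lt Kl Kr. good_order V K lt Kl Kr"
proof -
  obtain x where x: "x \<in> V" using assms by blast
  show ?thesis
  proof (cases "V = {x}")
    case True
    have "good_order V K (\<lambda>_ _. False) {x} {}"
      using assms True unfolding good_order_def by auto
    then show ?thesis by blast
  next
    case False
    then obtain y where y: "y \<in> V" "y \<noteq> x" using x by blast
    have V: "V = {x, y}"
      using assms(1,5) x y by (intro card_seteq[symmetric]) auto
    have "adj x y" using neighbour_exists[OF assms(3) x y(1)] y V adj_side by auto
    then have "good_order V K (\<lambda>_ _. False) {x} {y}"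
      using assms V adj_sym unfolding good_order_def by auto
    then show ?thesis by blast
  qed
qed

lemma order_block:
  assumes fin: "finite V" and con: "conn V" and KV: "K \<subseteq> V" and ac: "acc V K" and three: "card V \<ge> 3"
    and nocut: "\<And>v. v \<in> V \<Longrightarrow> conn (V - {v})"
  shows "\<exists>lt Kl Kr. good_order V K lt Kl Kr"
proof -
  have third: "\<exists>z\<in>V. z \<noteq> x \<and> z \<noteq> y" for x y
  proof (rule ccontr)
    assume "\<not> ?thesis"
    then have "V \<subseteq> {x, y}" by blast
    then have "card V \<le> card {x, y}" by (intro card_mono) auto
    then show False using three by (auto simp: card_insert_if split: if_splits)
  qed
  \<comment> \<open>\<open>V - {u}\<close> is connected and has a vertex besides \<open>v\<close>,
    so a second neighbour of \<open>v\<close> survives the deletion of the first.\<close>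
  have two: "\<exists>u\<in>V. \<exists>w\<in>V. u \<noteq> w \<and> adj v u \<and> adj v w" if v: "v \<in> V" for v
  proof -
    obtain z where "z \<in> V" "z \<noteq> v" using third by blast
    then obtain u where u: "u \<in> V" "adj v u" using neighbour_exists[OF con v] by blast
    obtain z' where z': "z' \<in> V" "z' \<noteq> v" "z' \<noteq> u" using third by blast
    have "v \<noteq> u" using u adj_side by blast
    then obtain w where "w \<in> V - {u}" "adj v w"
      using neighbour_exists[OF nocut[OF u(1)], of v z'] v z' by blast
    then show ?thesis using u by blast
  qed
  have no_cut_vertex: "s \<in> K" if "wcut V K {s}" for s
    using that nocut[of s] unfolding wcut_def conn_def by blast
  have inK: "\<exists>s\<in>S. s \<in> K" if "wcut V K S" "S \<noteq> {}" for S
  proof -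
    have "S \<subseteq> V" using that by (simp add: wcut_def)
    then have "finite S" using fin finite_subset by blast
    then show ?thesis using acc_singleton[OF ac that] no_cut_vertex by blast
  qed
  define part where "part c = {v \<in> V. side v = c}" for c
  have V_minus_part: "V - part c = part (\<not> c)" for c by (auto simp: part_def)
  have edgeless: "\<not> adj u w" if "u \<in> part c" "w \<in> part c" for u w c
    using that adj_side by (auto simp: part_def)
  \<comment> \<open>Deleting a whole side leaves isolated vertices, so two neighbours of
    \<open>s\<close> lie in different components.\<close>
  have cut_part: "wcut V K (part c)" for c
    unfolding wcut_def
  proof (intro conjI ballI)
    fix s assume s: "s \<in> part c"
    then obtain u w where u: "u \<in> V" "w \<in> V" "u \<noteq> w" "adj s u" "adj s w"
      using two[of s] unfolding part_def by blast
    then have uw: "u \<in> V - part c" "w \<in> V - part c" using s adj_side by (auto simp: part_def)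
    then have "(u, w) \<notin> reach (V - part c)"
      using reach_closed[of u w "V - part c" "{u}"] u edgeless[of u "\<not> c"] V_minus_part by blast
    then show "\<exists>u\<in>V - part c. adj s u \<and> (s \<in> K \<or> (\<exists>w\<in>V - part c. adj s w \<and> (u, w) \<notin> reach (V - part c)))"
      using u uw by blast
  qed (auto simp: part_def)
  have fin_part: "finite (part c)" for c using fin by (auto simp: part_def)
  have part_ne: "part c \<noteq> {}" for c
  proof -
    obtain v where v: "v \<in> V" using third by blast
    then obtain u where "u \<in> V" "adj v u" using two by blast
    then show ?thesis using v adj_side by (auto simp: part_def) 
  qed
  have cnt: "card (part (\<not> c)) + card (part c \<inter> K) = card (part c) + 1" for c
    using acc_card[OF ac cut_part[of c]] card_comps_edgeless[of "part (\<not> c)"] edgeless V_minus_part by metis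
  have ge: "card (part c \<inter> K) \<ge> 1" for c
    using inK[OF cut_part part_ne] fin_part by (metis IntI One_nat_def Suc_leI card_gt_0_iff empty_iff finite_Int)
  \<comment> \<open>Adding the equations for both sides gives two marks in total, and each side has
    at least one.\<close>
  have "card (part c \<inter> K) = 1" for c
    using cnt[of True] cnt[of False] ge[of True] ge[of False] by (cases c) auto
  then have "\<forall>c. \<exists>x. part c \<inter> K = {x}" by (simp add: card_1_singleton_iff)
  from choice[OF this] obtain k where k: "part c \<inter> K = {k c}" for c by blast
  define a0 where "a0 = k True" define b0 where "b0 = k False"
  have V_parts: "V = part True \<union> part False" by (auto simp: part_def)
  have K: "K = {a0, b0}" using k[of True] k[of False] KV V_parts by (auto simp: a0_def b0_def)
  have k_part: "k c \<in> part c" for c using k by blast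
  have dom: "adj (k c) y" if y: "y \<in> part (\<not> c)" for c y
  proof (rule ccontr)
    assume n: "\<not> adj (k c) y"
    \<comment> \<open>All neighbours of \<open>y\<close> lie in \<open>part c\<close>, and
      \<open>k c\<close> is not among them, so deleting \<open>T\<close> isolates \<open>y\<close>;
      yet \<open>T\<close> contains no mark.\<close>
    define T where "T = part c - {k c}"
    have yV: "y \<in> V - T" "k c \<in> V - T" "T \<subseteq> V" using y k_part by (auto simp: T_def part_def)
    have "(y, k c) \<notin> reach (V - T)"
    proof
      assume r: "(y, k c) \<in> reach (V - T)"
      have cl: "z \<in> {y}" if "x \<in> {y}" "z \<in> V - T" "adj x z" for x z
      proof -
        have "z \<in> part c" using that adj_side[of y z] y by (auto simp: part_def)
        then show ?thesis using that n adj_sym by (auto simp: T_def)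
      qed
      have "k c \<in> {y}" by (rule reach_closed[OF r]) (use cl in blast)+
      then show False using y k_part[of c] by (auto simp: part_def)
    qed
    then obtain S where S: "S \<subseteq> T" "wcut V K S" "(y, k c) \<notin> reach (V - S)"
      using minimal_separator[of T V y "k c" K] fin_part yV by (auto simp: T_def)
    have "S \<noteq> {}" using S(3) con yV by (auto simp: conn_def)
    then obtain s where "s \<in> S" "s \<in> K" using inK S by blast
    then have "s \<in> part c \<inter> K" "s \<noteq> k c" using S by (auto simp: T_def)
    then show False using k by blast
  qed
  interpret block adj "part True" "part False" a0 b0
  proof unfold_locales
    show "\<And>b. b \<in> part False \<Longrightarrow> adj a0 b" "\<And>a. a \<in> part True \<Longrightarrow> adj b0 a"
      using dom[of _ True] dom[of _ False] by (auto simp: a0_def b0_def)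
    show "acc (part True \<union> part False) {a0, b0}" "wcut (part True \<union> part False) {a0, b0} (part True)"
      "wcut (part True \<union> part False) {a0, b0} (part False)"
      using ac cut_part V_parts K by simp_all
    show "s \<in> {a0, b0}" if "wcut (part True \<union> part False) {a0, b0} {s}" for s
      using that no_cut_vertex V_parts K by simp
  qed (use fin_part edgeless k_part in \<open>auto simp: a0_def b0_def\<close>)
  have "good_order V K prec {a0} {b0}"
  proof (rule good_orderI)
    show "prec x y \<Longrightarrow> x \<in> V \<and> y \<in> V" for x y using prec_mem V_parts by blast
    show "\<not> prec x x" for x by (simp add: prec_def)
    show "adj x y \<longleftrightarrow> \<not> prec x y \<and> \<not> prec y x" if "x \<in> V" "y \<in> V" "x \<noteq> y" for x y
      using prec_comparable that unfolding V_parts by blast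
  qed (use prec_trans prec_ends K in blast)+
  then show ?thesis by blast
qed

text \<open>All of \<open>L\<close> is put before all of \<open>R\<close>, as no edge joins them.
  Since \<open>v\<close> is maximal on the left and minimal on the right, chains through
  \<open>v\<close> only produce pairs of this kind. The end at \<open>v\<close> is used up, so the
  older marks sit at the outer ends and remain ends.\<close>

lemma good_order_glue:
  assumes o1: "good_order (insert v L) (insert v K1) lt1 Kl1 Kr1"
    and o2: "good_order (insert v R) (insert v K2) lt2 Kl2 Kr2"
    and v: "v \<in> Kr1" "v \<in> Kl2" "v \<notin> L" "v \<notin> R"
    and LR: "L \<inter> R = {}" "\<And>x y. x \<in> L \<Longrightarrow> y \<in> R \<Longrightarrow> \<not> adj x y"
    and K: "K1 \<subseteq> L" "K2 \<subseteq> R"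
  shows "good_order (insert v (L \<union> R)) (K1 \<union> K2)
    (\<lambda>x y. lt1 x y \<or> lt2 x y \<or> (x \<in> L \<and> y \<in> R)) (Kl1 \<inter> L) (Kr2 \<inter> R)"
proof -
  note D1 = good_orderD[OF o1] and D2 = good_orderD[OF o2]
  note m1 = D1(1) and m2 = D2(1) and i1 = D1(2) D2(2) and t1 = D1(3) and t2 = D2(3)
    and v1 = D1(9)[OF v(1)] D2(8)[OF v(2)] and c1 = D1(4) and c2 = D2(4)
  have Kr1: "Kr1 = {v}" and Kl2: "Kl2 = {v}" using D1(7) D2(6) v by blast+
  let ?lt = "\<lambda>x y. lt1 x y \<or> lt2 x y \<or> (x \<in> L \<and> y \<in> R)"
  have lt1R: "\<not> lt1 x y" if "x \<in> R \<or> y \<in> R" for x y using m1 that v LR by blast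
  have lt2L: "\<not> lt2 x y" if "x \<in> L \<or> y \<in> L" for x y using m2 that v LR by blast
  have trans: "?lt x z" if xy: "?lt x y" and yz: "?lt y z" for x y z
  proof (cases "lt1 x y")
    case True
    then have x: "x \<in> L" using m1 v1 by blast
    have "\<not> lt2 y z \<or> z \<in> R" using m2 v1 by blast
    then show ?thesis using True x yz t1 by blast
  next
    case False
    then have "y \<in> R" using xy m2 v1 by blast
    then have yz': "lt2 y z" "z \<in> R" using yz lt1R LR m2 v1 by blast+
    show ?thesis using False xy yz' t2 by blast
  qed
  have comp: "adj x y \<longleftrightarrow> \<not> ?lt x y \<and> \<not> ?lt y x"
    if xy: "x \<in> insert v (L \<union> R)" "y \<in> insert v (L \<union> R)" "x \<noteq> y" for x y
  proof -
    consider "x \<in> insert v L" "y \<in> insert v L" | "x \<in> insert v R" "y \<in> insert v R"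
      | "x \<in> L" "y \<in> R" | "x \<in> R" "y \<in> L" using xy by blast
    then show ?thesis
    proof cases
      case 1
      then have "\<not> lt2 x y" "\<not> lt2 y x" "\<not> (x \<in> L \<and> y \<in> R)" "\<not> (y \<in> L \<and> x \<in> R)"
        using xy m2 v LR by blast+
      then show ?thesis using c1[OF 1 xy(3)] by blast
    next
      case 2
      then have "\<not> lt1 x y" "\<not> lt1 y x" "\<not> (x \<in> L \<and> y \<in> R)" "\<not> (y \<in> L \<and> x \<in> R)"
        using xy m1 v LR by blast+
      then show ?thesis using c2[OF 2 xy(3)] by blast
    next
      case 3 then show ?thesis using LR by blast
    next
      case 4 then show ?thesis using LR adj_sym by blast
    qed
  qed
  have "K1 \<subseteq> Kl1" "K2 \<subseteq> Kr2" using D1(5) D2(5) Kr1 Kl2 K v by blast+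
  then have "K1 \<union> K2 \<subseteq> (Kl1 \<inter> L) \<union> (Kr2 \<inter> R)" using K by blast
  moreover have "\<not> ?lt x p" if "p \<in> Kl1 \<inter> L" for x p using that D1(8) lt2L LR by blast
  moreover have "\<not> ?lt p x" if "p \<in> Kr2 \<inter> R" for x p using that D2(9) lt1R LR by blast
  moreover have "x \<in> insert v (L \<union> R) \<and> y \<in> insert v (L \<union> R)" if "?lt x y" for x y
    using that m1 m2 by blast
  moreover have "\<not> ?lt x x" for x using i1 LR by blast
  moreover have "x = y" if "x \<in> Kl1 \<inter> L" "y \<in> Kl1 \<inter> L" for x y using that D1(6) by blast
  moreover have "x = y" if "x \<in> Kr2 \<inter> R" "y \<in> Kr2 \<inter> R" for x y using that D2(7) by blast
  ultimately show ?thesis using trans comp by (intro good_orderI) assumption+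
qed

end

section \<open>Cutting a piece at a cut vertex\<close>

context graph begin

text \<open>Send all of \<open>R\<close> to \<open>v\<close>. Walks enter and leave \<open>R\<close>
  only through \<open>v\<close>, so every edge touching \<open>R\<close> becomes stationary and the
  walk stays in \<open>U - R\<close>.\<close>

lemma reach_retract:
  assumes "(x, y) \<in> reach U" "x \<notin> R" "v \<in> U" "v \<notin> R"
    "\<And>a b. a \<in> U - R \<Longrightarrow> b \<in> U \<inter> R \<Longrightarrow> adj a b \<Longrightarrow> a = v"
  shows "(x, if y \<in> R then v else y) \<in> reach (U - R)"
  using assms(1)
proof (induction rule: reach_induct)
  case (step a b)
  show ?case
  proof (cases "a \<in> R")
    case True
    then have "b \<in> R \<or> b = v" using step assms(5) adj_sym by blast
    then show ?thesis using step True by auto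
  next
    case False
    show ?thesis
    proof (cases "b \<in> R")
      case True
      then have "a = v" using step False assms(5) by blast
      then show ?thesis using step True False by auto
    next
      case b: False
      then have "(a, b) \<in> reach (U - R)" using step False by (intro reach_step) auto
      then show ?thesis using step False b reach_trans by auto
    qed
  qed
qed (use assms in simp)

context
  fixes V L R K :: "'a set" and v :: 'a
  assumes V: "V = insert v (L \<union> R)" and disj: "L \<inter> R = {}" "v \<notin> L" "v \<notin> R"
    and fin: "finite V" and no_edge: "\<And>x y. x \<in> L \<Longrightarrow> y \<in> R \<Longrightarrow> \<not> adj x y"
    and connR: "conn R" and edgeR: "\<exists>r\<in>R. adj v r" and vK: "v \<notin> K" and KV: "K \<subseteq> V"
begin

lemma half_reach:
  assumes "S \<subseteq> insert v L" "x \<in> insert v L - S" "y \<in> insert v L - S" "(x, y) \<in> reach (V - S)"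
  shows "(x, y) \<in> reach (insert v L - S)"
proof (cases "v \<in> S")
  case False
  have "V - S - R = insert v L - S" using V disj assms(1) by blast
  moreover have "(x, if y \<in> R then v else y) \<in> reach (V - S - R)"
    using assms V disj False no_edge by (intro reach_retract) auto
  ultimately show ?thesis using assms disj by auto
next
  case True
  then have "V - S = (insert v L - S) \<union> R" using V disj assms(1) by blast
  then show ?thesis
    using reach_Un_no_edges[of x y "insert v L - S" R] assms no_edge True by auto
qed

lemma half_conn: "conn V \<Longrightarrow> conn (insert v L)"
  using half_reach[of "{}"] V by (auto simp: conn_def)

text \<open>If \<open>v\<close> survives, it keeps \<open>R\<close> in its own component; if it is
  deleted, the connected set \<open>R\<close> is a further component, the one for which the mark at
  \<open>v\<close> stands.\<close>

lemma half_comps: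
  assumes S: "S \<subseteq> insert v L"
  shows "card (comps (V - S)) = card (comps (insert v L - S)) + (if v \<in> S then 1 else 0)"
proof (cases "v \<in> S")
  case True
  have "V - S = (insert v L - S) \<union> R" using V disj True S by blast
  moreover have "card (comps ((insert v L - S) \<union> R)) = card (comps (insert v L - S)) + card (comps R)"
    using True disj fin V no_edge by (intro comps_Un) auto
  moreover have "card (comps R) = 1" using card_comps_conn connR edgeR by blast
  ultimately show ?thesis using True by simp
next
  case False
  obtain r where r: "r \<in> R" "adj v r" using edgeR by blast
  have RV: "R \<subseteq> V - S" using S V disj by blast
  have "card (comps (V - S)) = card (comps (insert v L - S))"
  proof (rule comps_inclusion)
    show "\<exists>u\<in>insert v L - S. (w, u) \<in> reach (V - S)" if w: "w \<in> V - S" for w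
    proof (cases "w \<in> R")
      case True
      then have "(w, r) \<in> reach (V - S)" using connR r RV reach_mono by (auto simp: conn_def)
      moreover have "(r, v) \<in> reach (V - S)"
        using r RV False V adj_sym by (intro reach_step) auto
      ultimately show ?thesis using False reach_trans by blast
    next
      case False
      then have "w \<in> insert v L - S" using w V by blast
      then show ?thesis using reach_refl by blast
    qed
  qed (use half_reach S V in auto)
  then show ?thesis using False by simp
qed

text \<open>Only \<open>s = v\<close> needs an argument. It has a neighbour in \<open>R\<close>,
  which is a component by itself once \<open>v\<close> is deleted, so touching two components
  amounts to having a neighbour in \<open>L - S\<close>: the condition for a marked vertex.\<close>

lemma half_wcut:
  assumes S: "S \<subseteq> insert v L"
  shows "wcut V K S \<longleftrightarrow> wcut (insert v L) (insert v (K \<inter> L)) S"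
proof -
  let ?V = "insert v L" and ?K = "insert v (K \<inter> L)"
  have r: "(x, y) \<in> reach (V - S) \<longleftrightarrow> (x, y) \<in> reach (?V - S)" if "x \<in> ?V - S" "y \<in> ?V - S" for x y
    using half_reach[OF S that] reach_mono[of "?V - S" "V - S"] V by blast
  have "(\<exists>u\<in>V - S. adj s u \<and> (s \<in> K \<or> (\<exists>w\<in>V - S. adj s w \<and> (u, w) \<notin> reach (V - S)))) \<longleftrightarrow>
    (\<exists>u\<in>?V - S. adj s u \<and> (s \<in> ?K \<or> (\<exists>w\<in>?V - S. adj s w \<and> (u, w) \<notin> reach (?V - S))))" (is "?P \<longleftrightarrow> ?Q")
    if s: "s \<in> S" for s
  proof (cases "s = v")
    case False
    then have "s \<in> L" using s S by blast
    then have n: "u \<in> V - S \<and> adj s u \<longleftrightarrow> u \<in> ?V - S \<and> adj s u" for u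
      using V no_edge by blast
    have k: "s \<in> K \<longleftrightarrow> s \<in> ?K" using \<open>s \<in> L\<close> False by blast
    define N where "N = {u \<in> V - S. adj s u}"
    have N: "N = {u \<in> ?V - S. adj s u}" using n unfolding N_def by blast
    have "?P \<longleftrightarrow> (\<exists>u\<in>N. s \<in> K \<or> (\<exists>w\<in>N. (u, w) \<notin> reach (V - S)))"
      unfolding N_def by blast
    also have "\<dots> \<longleftrightarrow> (\<exists>u\<in>N. s \<in> ?K \<or> (\<exists>w\<in>N. (u, w) \<notin> reach (?V - S)))"
      using k r N by (intro bex_cong disj_cong refl) auto
    also have "\<dots> \<longleftrightarrow> ?Q" unfolding N by blast
    finally show ?thesis .
  next
    case True
    have e: "V - S = (L - S) \<union> R" "?V - S = L - S" using V disj s S True by auto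
    have "?P \<longleftrightarrow> (\<exists>u\<in>L - S. adj v u)"
    proof
      assume ?P
      then obtain u w where u: "u \<in> V - S" "w \<in> V - S" "adj v u" "adj v w" "(u, w) \<notin> reach (V - S)"
        using True vK by blast
      have "\<not> (u \<in> R \<and> w \<in> R)"
        using u connR reach_mono[of R "V - S"] e by (auto simp: conn_def)
      then show "\<exists>u\<in>L - S. adj v u" using u e by blast
    next
      assume "\<exists>u\<in>L - S. adj v u"
      then obtain u where u: "u \<in> L - S" "adj v u" by blast
      obtain w where w: "w \<in> R" "adj v w" using edgeR by blast
      have "(u, w) \<notin> reach (V - S)"
        unfolding e using reach_Un_no_edges[of u w "L - S" R] u w no_edge disj by blast
      then show ?P using u w e True by blast
    qed
    then show ?thesis using e True by auto
  qed
  moreover have "S \<subseteq> V" using S V by blast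
  ultimately show ?thesis using S unfolding wcut_def by blast
qed

text \<open>For a cut set containing \<open>v\<close>, the new mark adds to
  \<open>card (S \<inter> K)\<close> the one that the loss of \<open>R\<close> takes from the
  components.\<close>

lemma half_acc:
  assumes "acc V K" shows "acc (insert v L) (insert v (K \<inter> L))"
  unfolding acc_def
proof (intro allI impI conjI)
  let ?V = "insert v L" and ?K = "insert v (K \<inter> L)"
  fix S assume c: "wcut ?V ?K S"
  then have S: "S \<subseteq> ?V" by (simp add: wcut_def)
  then have c': "wcut V K S" using half_wcut[OF S] c by simp
  have finS: "finite S" by (rule finite_subset[OF S]) (use fin V in simp)
  have "S \<inter> ?K = (S \<inter> K) \<union> (if v \<in> S then {v} else {})" using S vK by auto
  then have "card (S \<inter> ?K) = card (S \<inter> K) + (if v \<in> S then 1 else 0)"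
    using vK finS by auto
  then show "card (comps (?V - S)) + card (S \<inter> ?K) = card S + 1"
    using acc_card[OF assms c'] half_comps[OF S] by auto
  show "\<exists>s\<in>S. wcut ?V ?K (S - {s})" if "S \<noteq> {}"
    using that assms c' half_wcut[of "S - {_}"] S unfolding acc_def by blast
qed

end

end

context bip_graph begin

theorem acc_order:
  assumes "finite V" "V \<noteq> {}" "conn V" "K \<subseteq> V" "acc V K"
  shows "\<exists>lt Kl Kr. good_order V K lt Kl Kr"
  using assms
proof (induction "card V" arbitrary: V K rule: less_induct)
  case less
  show ?case
  proof (cases "\<exists>v\<in>V. \<not> conn (V - {v})")
    case False
    show ?thesis
    proof (cases "card V \<le> 2")
      case True
      then show ?thesis using order_small less.prems by blast
    next
      case c: False
      show ?thesis
        by (rule order_block) (use less.prems False c in auto)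
    qed
  next
    case True
    then obtain v where v: "v \<in> V" "\<not> conn (V - {v})" by blast
    let ?W = "V - {v}"
    obtain x y where xy: "x \<in> ?W" "y \<in> ?W" "(x, y) \<notin> reach ?W" using v by (auto simp: conn_def)
    have ins: "insert v ?W = V" using v by blast
    have nbr: "\<exists>u. adj v u \<and> (a, u) \<in> reach ?W" if "a \<in> ?W" "b \<in> ?W" "(a, b) \<notin> reach ?W" for a b
    proof -
      have "(a, b) \<in> reach (insert v ?W)" using less.prems(3) that ins by (auto simp: conn_def)
      then show ?thesis using reach_insert that by blast
    qed
    obtain u where u: "adj v u" "(x, u) \<in> reach ?W" using nbr xy by blast
    obtain w where w: "adj v w" "(y, w) \<in> reach ?W"
      using nbr[OF xy(2,1)] xy(3) reach_sym[of y x ?W] by blast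
    have uw: "u \<in> ?W" "w \<in> ?W" using u w xy reach_mem[of _ _ ?W] by blast+
    have uw: "u \<in> ?W" "w \<in> ?W" "(u, w) \<notin> reach ?W"
      subgoal using uw by simp
      subgoal using uw by simp
      subgoal by (meson u(2) w(2) xy(3) reach_trans reach_sym)
      done
    \<comment> \<open>For the cut set \<open>{v}\<close> the number of components plus the number of
      marks at \<open>v\<close> is 2. There are at least two components, so there are exactly two
      and \<open>v\<close> carries no mark yet.\<close>
    have "wcut V K {v}" unfolding wcut_def using u w uw v by blast
    then have cnt: "card (comps ?W) + card ({v} \<inter> K) = 2"
      using acc_card[OF less.prems(5), of "{v}"] by simp
    have "x \<noteq> y" using xy by auto
    have ge: "card T \<le> card (comps ?W)"
      if "T \<subseteq> ?W" "\<And>s t. s \<in> T \<Longrightarrow> t \<in> T \<Longrightarrow> (s, t) \<in> reach ?W \<Longrightarrow> s = t" for T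
      using that less.prems(1) by (intro card_comps_ge) auto
    have "card {x, y} \<le> card (comps ?W)"
      using xy reach_sym by (intro ge) auto
    then have c2: "card (comps ?W) = 2"
    proof -
      have "card {x, y} = 2" using \<open>x \<noteq> y\<close> by simp
      moreover have "card ({v} \<inter> K) \<ge> 0" by simp
      moreover have "card (comps ?W) + card ({v} \<inter> K) = 2" by (rule cnt)
      ultimately show ?thesis using \<open>card {x, y} \<le> card (comps ?W)\<close> by arith
    qed
    then have "card ({v} \<inter> K) = 0" using cnt by arith
    then have vK: "v \<notin> K" by auto
    define L where "L = {z \<in> ?W. (x, z) \<in> reach ?W}"
    define R where "R = {z \<in> ?W. (y, z) \<in> reach ?W}"
    have "(x, z) \<in> reach ?W \<or> (y, z) \<in> reach ?W" if "z \<in> ?W" for z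
    proof (rule ccontr)
      assume n: "\<not> ?thesis"
      then have "card {x, y, z} \<le> 2" unfolding c2[symmetric]
        using xy that reach_sym by (intro ge) auto
      moreover have "x \<noteq> z" "y \<noteq> z" using n by auto
      ultimately show False using \<open>x \<noteq> y\<close> by simp
    qed
    then have V: "V = insert v (L \<union> R)" "V = insert v (R \<union> L)" using v by (auto simp: L_def R_def)
    have "False" if "(x, z) \<in> reach ?W" "(y, z) \<in> reach ?W" for z
      using reach_trans[OF that(1) reach_sym[OF that(2)]] xy(3) by blast
    then have disj: "L \<inter> R = {}" "R \<inter> L = {}" "v \<notin> L" "v \<notin> R"
      by (auto simp: L_def R_def)
    have noe: "\<not> adj a b" if "a \<in> L" "b \<in> R" for a b
    proof
      assume "adj a b"
      then have "(a, b) \<in> reach ?W" using that by (intro reach_step) (auto simp: L_def R_def)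
      then have "(x, b) \<in> reach ?W" using that reach_trans[of x a ?W b] by (simp add: L_def)
      then have "b \<in> L" using that by (simp add: L_def R_def)
      then show False using that disj by blast
    qed
    then have noe': "\<not> adj b a" if "a \<in> L" "b \<in> R" for a b using that adj_sym by blast
    have connL: "conn L"
    proof -
      have W: "?W = L \<union> R" using V disj by blast
      have "(a, b) \<in> reach L" if "a \<in> L" "b \<in> L" for a b
      proof -
        have "(a, b) \<in> reach (L \<union> R)" using that reach_trans[OF reach_sym, of x a ?W b] unfolding W[symmetric] by (simp add: L_def)
        then show ?thesis using reach_Un_no_edges[of a b L R] noe that by blast
      qed
      then show ?thesis by (simp add: conn_def)
    qed
    have connR: "conn R"
    proof -
      have W: "?W = R \<union> L" using V disj by blast
      have "(a, b) \<in> reach R" if "a \<in> R" "b \<in> R" for a b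
      proof -
        have "(a, b) \<in> reach (R \<union> L)" using that reach_trans[OF reach_sym, of y a ?W b] unfolding W[symmetric] by (simp add: R_def)
        then show ?thesis using reach_Un_no_edges[of a b R L] noe' that by blast
      qed
      then show ?thesis by (simp add: conn_def)
    qed
    have uL: "u \<in> L" "w \<in> R" using u w uw by (auto simp: L_def R_def)
    have fin: "finite V" and KV: "K \<subseteq> V" using less.prems by auto
    have eL: "\<exists>r\<in>L. adj v r" and eR: "\<exists>r\<in>R. adj v r" using uL u w by auto
    have "card (insert v L) < card V"
      using fin V disj uL by (intro psubset_card_mono) auto
    then obtain lt1 Kl1 Kr1 where o1: "good_order (insert v L) (insert v (K \<inter> L)) lt1 Kl1 Kr1"
      using less.hyps[of "insert v L" "insert v (K \<inter> L)"]
        half_conn[OF V(1) disj(1,3,4) fin noe connR eR vK KV less.prems(3)]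
        half_acc[OF V(1) disj(1,3,4) fin noe connR eR vK KV less.prems(5)] fin V by auto
    have "card (insert v R) < card V"
      using fin V disj uL by (intro psubset_card_mono) auto
    then obtain lt2 Kl2 Kr2 where o2: "good_order (insert v R) (insert v (K \<inter> R)) lt2 Kl2 Kr2"
      using less.hyps[of "insert v R" "insert v (K \<inter> R)"]
        half_conn[OF V(2) disj(2,4,3) fin noe' connL eL vK KV less.prems(3)]
        half_acc[OF V(2) disj(2,4,3) fin noe' connL eL vK KV less.prems(5)] fin V by auto
    \<comment> \<open>Reversing an order exchanges its ends, so \<open>v\<close> can be made the
      right end of the first half and, below, the left end of the second.\<close>
    have "v \<in> Kl1 \<or> v \<in> Kr1" using good_orderD(5)[OF o1] by blast
    then have "\<exists>lt Kl Kr. good_order (insert v L) (insert v (K \<inter> L)) lt Kl Kr \<and> v \<in> Kr"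
      using o1 good_order_reverse[OF o1] by (elim disjE) (intro exI conjI, assumption+)+
    then obtain lt1 Kl1 Kr1 where o1: "good_order (insert v L) (insert v (K \<inter> L)) lt1 Kl1 Kr1" "v \<in> Kr1"
      by blast
    have "v \<in> Kr2 \<or> v \<in> Kl2" using good_orderD(5)[OF o2] by blast
    then have "\<exists>lt Kl Kr. good_order (insert v R) (insert v (K \<inter> R)) lt Kl Kr \<and> v \<in> Kl"
      using o2 good_order_reverse[OF o2] by (elim disjE) (intro exI conjI, assumption+)+
    then obtain lt2 Kl2 Kr2 where o2: "good_order (insert v R) (insert v (K \<inter> R)) lt2 Kl2 Kr2" "v \<in> Kl2"
      by blast
    have "K = (K \<inter> L) \<union> (K \<inter> R)" using KV V vK by blast
    then show ?thesis
      using good_order_glue[OF o1(1) o2(1) o1(2) o2(2) disj(3,4,1) noe] V by fastforce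
  qed
qed

end

text \<open>The converse of a finite strict order is well-founded, which gives a maximal element; it
  receives the largest label.\<close>

lemma linear_extension:
  assumes "finite V" "\<And>x. \<not> lt x x" "\<And>x y z. lt x y \<Longrightarrow> lt y z \<Longrightarrow> lt x z"
  shows "\<exists>f. bij_betw f V {1..card V} \<and> (\<forall>x\<in>V. \<forall>y\<in>V. lt x y \<longrightarrow> f x < (f y :: nat))"
  using assms(1)
proof (induction "card V" arbitrary: V)
  case 0
  then show ?case by (auto simp: bij_betw_def)
next
  case (Suc n)
  have "\<exists>m\<in>V. \<forall>x\<in>V. \<not> lt m x"
  proof (rule ccontr)
    assume n: "\<not> ?thesis"
    have "wf {(y, x). x \<in> V \<and> y \<in> V \<and> lt x y}"
    proof (rule finite_acyclic_wf)
      show "finite {(y, x). x \<in> V \<and> y \<in> V \<and> lt x y}"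
        by (rule finite_subset[of _ "V \<times> V"]) (use Suc.prems in auto)
      have "trans {(y, x). x \<in> V \<and> y \<in> V \<and> lt x y}" using assms(3) by (auto simp: trans_def)
      then show "acyclic {(y, x). x \<in> V \<and> y \<in> V \<and> lt x y}"
        using assms(2) by (auto simp: acyclic_def trancl_id)
    qed
    moreover obtain z where "z \<in> V" using Suc by fastforce
    ultimately obtain m where "m \<in> V" "\<And>y. (y, m) \<in> {(y, x). x \<in> V \<and> y \<in> V \<and> lt x y} \<Longrightarrow> y \<notin> V"
      by (rule wfE_min) blast
    then show False using n by blast
  qed
  then obtain m where m: "m \<in> V" "\<forall>x\<in>V. \<not> lt m x" by blast
  have c: "n = card (V - {m})" using Suc.hyps(2) Suc.prems m by simp
  then obtain f where f: "bij_betw f (V - {m}) {1..n}" "\<forall>x\<in>V - {m}. \<forall>y\<in>V - {m}. lt x y \<longrightarrow> f x < f y"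
    using Suc.hyps(1)[of "V - {m}"] Suc.prems by auto
  let ?f = "f(m := Suc n)"
  have "bij_betw ?f (V - {m}) {1..n}" using f(1) by (rule bij_betw_cong[THEN iffD1, rotated]) auto
  then have "bij_betw ?f (V - {m} \<union> {m}) ({1..n} \<union> {Suc n})"
    by (rule bij_betw_combine) (auto simp: bij_betw_def)
  moreover have "V - {m} \<union> {m} = V" "{1..n} \<union> {Suc n} = {1..card V}" using m Suc.hyps(2) by auto
  moreover have "?f x < ?f y" if "x \<in> V" "y \<in> V" "lt x y" for x y
  proof -
    have "x \<noteq> m" using that m by blast
    moreover have "f x \<le> n" using f(1) that \<open>x \<noteq> m\<close> by (auto simp: bij_betw_def)
    ultimately show ?thesis using f(2) that by auto
  qed
  ultimately show ?case by metis
qed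

section \<open>Polynomials and substitutions\<close>

text \<open>A linear order on the variables induces one on the exponents, through which the
  polynomials form an integral domain; the primality of kernels rests on this. Which order is chosen
  is immaterial.\<close>

instantiation var :: linorder
begin

definition var_key :: "var \<Rightarrow> nat" where
  "var_key v = (case v of VarX i \<Rightarrow> 2 * i | VarY i \<Rightarrow> 2 * i + 1)"

definition less_eq_var :: "var \<Rightarrow> var \<Rightarrow> bool" where
  "v \<le> w \<longleftrightarrow> var_key v \<le> var_key w"

definition less_var :: "var \<Rightarrow> var \<Rightarrow> bool" where
  "v < w \<longleftrightarrow> var_key v < var_key w"

lemma var_key_inject: "var_key v = var_key w \<Longrightarrow> v = w"
  unfolding var_key_def by (cases v; cases w) (simp_all, presburger+)

instance
  by standard (auto simp: less_eq_var_def less_var_def intro: var_key_inject)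

end

section \<open>Substitution homomorphisms\<close>

abbreviation const :: "'k \<Rightarrow> ('a::monoid_add \<Rightarrow>\<^sub>0 'k::zero)" where
  "const c \<equiv> Poly_Mapping.single 0 c"

definition eval_monom :: "('v \<Rightarrow> 'a::comm_monoid_mult) \<Rightarrow> ('v \<Rightarrow>\<^sub>0 nat) \<Rightarrow> 'a" where
  "eval_monom h m = (\<Prod>v\<in>Poly_Mapping.keys m. h v ^ Poly_Mapping.lookup m v)"

definition subst :: "(var \<Rightarrow> 'k mpoly) \<Rightarrow> 'k mpoly \<Rightarrow> 'k::field mpoly" where
  "subst h f = (\<Sum>m\<in>Poly_Mapping.keys f. const (Poly_Mapping.lookup f m) * eval_monom h m)"

lemma eval_monom_superset:
  assumes "finite W" "Poly_Mapping.keys m \<subseteq> W"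
  shows "eval_monom h m = (\<Prod>v\<in>W. h v ^ Poly_Mapping.lookup m v)"
  unfolding eval_monom_def
  by (rule prod.mono_neutral_left) (use assms in \<open>auto simp: in_keys_iff\<close>)

lemma eval_monom_zero [simp]: "eval_monom h 0 = 1"
  by (simp add: eval_monom_def)

lemma eval_monom_add: "eval_monom h (m + n) = eval_monom h m * eval_monom h n"
proof -
  let ?W = "Poly_Mapping.keys m \<union> Poly_Mapping.keys n"
  have "eval_monom h (m + n) = (\<Prod>v\<in>?W. h v ^ Poly_Mapping.lookup (m + n) v)"
    by (rule eval_monom_superset) (simp_all add: keys_add)
  also have "\<dots> = (\<Prod>v\<in>?W. h v ^ Poly_Mapping.lookup m v) * (\<Prod>v\<in>?W. h v ^ Poly_Mapping.lookup n v)"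
    by (simp add: lookup_add power_add prod.distrib)
  also have "\<dots> = eval_monom h m * eval_monom h n"
    by (simp add: eval_monom_superset[of ?W])
  finally show ?thesis .
qed

lemma eval_monom_single [simp]: "eval_monom h (Poly_Mapping.single v n) = h v ^ n"
  by (cases "n = 0") (simp_all add: eval_monom_def)

text \<open>The inner sum is the multiple of \<open>w v\<close> by its exponent, written as a
  repeated sum because the new exponents live in an arbitrary commutative monoid.\<close>

lemma eval_monom_indeterminates:
  "eval_monom (\<lambda>v. Poly_Mapping.single (w v) 1) m
     = Poly_Mapping.single (\<Sum>v\<in>Poly_Mapping.keys m. \<Sum>j<Poly_Mapping.lookup m v. w v) (1::'k::comm_semiring_1)"
  for w :: "'v \<Rightarrow> 'a::comm_monoid_add"
proof -
  have p: "Poly_Mapping.single a (1::'k) ^ n = Poly_Mapping.single (\<Sum>j<n. a) 1" for a :: 'a and n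
    by (induction n) (simp_all add: mult_single add.commute)
  have "(\<Prod>v\<in>F. Poly_Mapping.single (g v) (1::'k)) = Poly_Mapping.single (\<Sum>v\<in>F. g v) 1"
    if "finite F" for F and g :: "'v \<Rightarrow> 'a"
    using that by (induction F rule: finite_induct) (simp_all add: mult_single)
  then show ?thesis by (simp add: eval_monom_def p)
qed

lemma poly_mapping_sum_single:
  fixes f :: "'a \<Rightarrow>\<^sub>0 'b::comm_monoid_add"
  shows "f = (\<Sum>m\<in>Poly_Mapping.keys f. Poly_Mapping.single m (Poly_Mapping.lookup f m))"
proof (rule poly_mapping_eqI)
  fix k
  have "Poly_Mapping.lookup (\<Sum>m\<in>Poly_Mapping.keys f. Poly_Mapping.single m (Poly_Mapping.lookup f m)) k
      = (\<Sum>m\<in>Poly_Mapping.keys f. if m = k then Poly_Mapping.lookup f m else 0)"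
    by (simp add: lookup_sum lookup_single when_def)
  then show "Poly_Mapping.lookup f k
      = Poly_Mapping.lookup (\<Sum>m\<in>Poly_Mapping.keys f. Poly_Mapping.single m (Poly_Mapping.lookup f m)) k"
    by (simp add: in_keys_iff)
qed

text \<open>The monomial case is limited to exponents occurring in \<open>f\<close>, which keeps
  support conditions on \<open>f\<close> available there.\<close>

lemma poly_mapping_monomial_induct [case_names zero single add]:
  fixes f :: "'a \<Rightarrow>\<^sub>0 'b::comm_monoid_add"
  assumes "P 0" "\<And>m c. m \<in> Poly_Mapping.keys f \<Longrightarrow> P (Poly_Mapping.single m c)"
    "\<And>f g. P f \<Longrightarrow> P g \<Longrightarrow> P (f + g)"
  shows "P f"
proof -
  have "P (\<Sum>m\<in>M. Poly_Mapping.single m (Poly_Mapping.lookup f m))"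
    if "finite M" "M \<subseteq> Poly_Mapping.keys f" for M
    using that by (induction M rule: finite_induct) (use assms in auto)
  from this[of "Poly_Mapping.keys f"] show ?thesis by (simp flip: poly_mapping_sum_single)
qed

lemma subst_superset:
  assumes "finite M" "Poly_Mapping.keys f \<subseteq> M"
  shows "subst h f = (\<Sum>m\<in>M. const (Poly_Mapping.lookup f m) * eval_monom h m)"
  unfolding subst_def
  by (rule sum.mono_neutral_left) (use assms in \<open>auto simp: in_keys_iff\<close>)

lemma subst_zero [simp]: "subst h 0 = 0"
  by (simp add: subst_def)

lemma subst_add: "subst h (f + g) = subst h f + subst h g"
proof -
  let ?M = "Poly_Mapping.keys f \<union> Poly_Mapping.keys g"
  have "subst h (f + g) = (\<Sum>m\<in>?M. const (Poly_Mapping.lookup (f + g) m) * eval_monom h m)"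
    by (rule subst_superset) (simp_all add: keys_add)
  also have "\<dots> = (\<Sum>m\<in>?M. const (Poly_Mapping.lookup f m) * eval_monom h m)
      + (\<Sum>m\<in>?M. const (Poly_Mapping.lookup g m) * eval_monom h m)"
    by (simp add: lookup_add single_add distrib_right sum.distrib)
  also have "\<dots> = subst h f + subst h g"
    by (simp add: subst_superset[of ?M])
  finally show ?thesis .
qed

lemma subst_single: "subst h (Poly_Mapping.single m c) = const c * eval_monom h m"
  by (cases "c = 0") (simp_all add: subst_def)

lemma subst_const [simp]: "subst h (const c) = const c"
  by (simp add: subst_single)

lemma subst_one [simp]: "subst h 1 = 1"
  using subst_const[of h 1] by simp

lemma subst_mult: "subst h (f * g) = subst h f * subst h g"
proof (induction f rule: poly_mapping_monomial_induct)
  case (single m c)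
  show ?case
  proof (induction g rule: poly_mapping_monomial_induct)
    case (single n e)
    have "subst h (Poly_Mapping.single m c * Poly_Mapping.single n e)
        = const (c * e) * (eval_monom h m * eval_monom h n)"
      by (simp add: mult_single subst_single eval_monom_add)
    also have "const (c * e) = const c * (const e :: 'a mpoly)"
      by (simp add: mult_single)
    finally show ?case by (simp add: subst_single mult_ac)
  qed (simp_all add: subst_add distrib_left)
qed (simp_all add: subst_add distrib_right)

lemma subst_uminus: "subst h (- f) = - subst h f"
  using subst_add[of h f "- f"] by (simp add: eq_neg_iff_add_eq_0 add.commute)

lemma subst_diff: "subst h (f - g) = subst h f - subst h g"
  using subst_add[of h f "- g"] by (simp add: subst_uminus)

lemma subst_power: "subst h (f ^ n) = subst h f ^ n"
  by (induction n) (simp_all add: subst_mult)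

lemma subst_prod: "subst h (\<Prod>a\<in>A. f a) = (\<Prod>a\<in>A. subst h (f a))"
  by (induction A rule: infinite_finite_induct) (simp_all add: subst_mult)

lemma subst_sum: "subst h (\<Sum>a\<in>A. f a) = (\<Sum>a\<in>A. subst h (f a))"
  by (induction A rule: infinite_finite_induct) (simp_all add: subst_add)

lemma subst_subst: "subst g (subst h f) = subst (\<lambda>v. subst g (h v)) f"
  unfolding subst_def[of h] subst_sum subst_mult subst_const eval_monom_def subst_prod subst_power
  by (simp add: subst_def eval_monom_def)

lemma subst_xvar [simp]: "subst h (xvar i) = h (VarX i)"
  by (simp add: xvar_def subst_single)

lemma subst_yvar [simp]: "subst h (yvar i) = h (VarY i)"
  by (simp add: yvar_def subst_single)

section \<open>The ring in finitely many variables, its ideals and primes\<close>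

definition xy_vars :: "nat \<Rightarrow> var set" where
  "xy_vars d = VarX ` {1..d} \<union> VarY ` {1..d}"

definition xy_polys :: "nat \<Rightarrow> 'k::field mpoly set" where
  "xy_polys d = {f. \<forall>m\<in>Poly_Mapping.keys f. Poly_Mapping.keys m \<subseteq> xy_vars d}"

lemma xy_ring_simps [simp]:
  "carrier (xy_ring d) = xy_polys d" "monoid.mult (xy_ring d) = (*)" "monoid.one (xy_ring d) = 1"
  "ring.zero (xy_ring d) = 0" "ring.add (xy_ring d) = (+)"
  by (simp_all add: xy_ring_def ring_of_type_algebra_def xy_polys_def xy_vars_def fun_eq_iff)

lemma xy_polys_zero [simp]: "0 \<in> xy_polys d"
  by (simp add: xy_polys_def)

lemma xy_polys_single: "Poly_Mapping.keys m \<subseteq> xy_vars d \<Longrightarrow> Poly_Mapping.single m c \<in> xy_polys d"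
  by (simp add: xy_polys_def)

lemma xy_polys_const [simp]: "const c \<in> xy_polys d"
  by (simp add: xy_polys_single)

lemma xy_polys_one [simp]: "1 \<in> xy_polys d"
  by (simp add: xy_polys_def)

lemma xy_polys_add: "f \<in> xy_polys d \<Longrightarrow> g \<in> xy_polys d \<Longrightarrow> f + g \<in> xy_polys d"
  unfolding xy_polys_def using keys_add[of f g] by blast

lemma xy_polys_mult: "f \<in> xy_polys d \<Longrightarrow> g \<in> xy_polys d \<Longrightarrow> f * g \<in> xy_polys d"
proof -
  assume f: "f \<in> xy_polys d" and g: "g \<in> xy_polys d"
  have "Poly_Mapping.keys m \<subseteq> xy_vars d" if m: "m \<in> Poly_Mapping.keys (f * g)" for m
  proof -
    obtain a b where "m = a + b" "a \<in> Poly_Mapping.keys f" "b \<in> Poly_Mapping.keys g"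
      using keys_mult[of f g] m by blast
    then show ?thesis using f g keys_add[of a b] by (fastforce simp: xy_polys_def)
  qed
  then show ?thesis by (simp add: xy_polys_def)
qed

lemma xy_polys_minus_one [simp]: "- 1 \<in> xy_polys d"
  using xy_polys_const[of "- 1" d] by (simp add: single_uminus del: xy_polys_const)

lemma xy_polys_uminus: "f \<in> xy_polys d \<Longrightarrow> - f \<in> xy_polys d"
  using xy_polys_mult[of "- 1" d f] by simp

lemma xy_polys_diff: "f \<in> xy_polys d \<Longrightarrow> g \<in> xy_polys d \<Longrightarrow> f - g \<in> xy_polys d"
  using xy_polys_add[OF _ xy_polys_uminus, of f d g] by simp

lemma xy_polys_power: "f \<in> xy_polys d \<Longrightarrow> f ^ n \<in> xy_polys d"
  by (induction n) (simp_all add: xy_polys_mult)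

lemma xy_polys_sum: "(\<And>a. a \<in> A \<Longrightarrow> f a \<in> xy_polys d) \<Longrightarrow> (\<Sum>a\<in>A. f a) \<in> xy_polys d"
  by (induction A rule: infinite_finite_induct) (simp_all add: xy_polys_add)

lemma xvar_in [simp]: "i \<in> {1..d} \<Longrightarrow> xvar i \<in> xy_polys d"
  unfolding xvar_def by (rule xy_polys_single) (auto simp: xy_vars_def)

lemma yvar_in [simp]: "i \<in> {1..d} \<Longrightarrow> yvar i \<in> xy_polys d"
  unfolding yvar_def by (rule xy_polys_single) (auto simp: xy_vars_def)

lemma xy_ring_cring: "cring (xy_ring d :: 'k::field mpoly ring)"
proof (rule cringI)
  show "abelian_group (xy_ring d :: 'k mpoly ring)"
  proof (rule abelian_groupI)
    fix f :: "'k mpoly" assume "f \<in> carrier (xy_ring d)"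
    then show "\<exists>g\<in>carrier (xy_ring d). g \<oplus>\<^bsub>xy_ring d\<^esub> f = \<zero>\<^bsub>xy_ring d\<^esub>"
      by (intro bexI[of _ "- f"]) (simp_all add: xy_polys_uminus)
  qed (simp_all add: xy_polys_add algebra_simps)
  show "comm_monoid (xy_ring d :: 'k mpoly ring)"
    by (rule comm_monoidI) (simp_all add: xy_polys_mult mult_ac)
qed (simp add: algebra_simps)

lemma xy_a_inv: "f \<in> xy_polys d \<Longrightarrow> \<ominus>\<^bsub>xy_ring d\<^esub> f = - f"
proof -
  interpret cring "xy_ring d" by (rule xy_ring_cring)
  assume "f \<in> xy_polys d"
  then show ?thesis by (intro minus_equality) (simp_all add: xy_polys_uminus)
qed

lemma ideal_xyI:
  assumes "I \<subseteq> xy_polys d" "0 \<in> I" "\<And>f g. f \<in> I \<Longrightarrow> g \<in> I \<Longrightarrow> f + g \<in> I"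
    "\<And>f g. f \<in> xy_polys d \<Longrightarrow> g \<in> I \<Longrightarrow> f * g \<in> I"
  shows "ideal I (xy_ring d)"
proof -
  interpret cring "xy_ring d" by (rule xy_ring_cring)
  have m: "- g \<in> I" if "g \<in> I" for g
    using assms(4)[of "- 1" g] that by simp
  show ?thesis
  proof (rule idealI[OF ring_axioms])
    show "subgroup I (add_monoid (xy_ring d))"
    proof (rule group.subgroupI)
      show "Group.group (add_monoid (xy_ring d))" by (rule a_group)
      show "inv\<^bsub>add_monoid (xy_ring d)\<^esub> f \<in> I" if "f \<in> I" for f
        using that m xy_a_inv[of f d] assms(1) by (auto simp: a_inv_def)
    qed (use assms in auto)
    show "a \<otimes>\<^bsub>xy_ring d\<^esub> x \<in> I" if "a \<in> I" "x \<in> carrier (xy_ring d)" for a x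
      using assms(4)[of x a] that by (simp add: mult.commute)
  qed (use assms in auto)
qed

lemma ideal_xyD:
  assumes "ideal I (xy_ring d)"
  shows "I \<subseteq> xy_polys d" and "0 \<in> I" and "f \<in> I \<Longrightarrow> g \<in> I \<Longrightarrow> f + g \<in> I"
    and "f \<in> xy_polys d \<Longrightarrow> g \<in> I \<Longrightarrow> f * g \<in> I" and "f \<in> I \<Longrightarrow> g \<in> I \<Longrightarrow> f - g \<in> I"
proof -
  interpret ideal I "xy_ring d" by (rule assms)
  show sub: "I \<subseteq> xy_polys d" using a_subset by simp
  show "0 \<in> I" using additive_subgroup.zero_closed[OF additive_subgroup_axioms] by simp
  show add: "f \<in> I \<Longrightarrow> g \<in> I \<Longrightarrow> f + g \<in> I" for f g
    using additive_subgroup.a_closed[OF additive_subgroup_axioms, of f g] by simp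
  show mult: "f \<in> xy_polys d \<Longrightarrow> g \<in> I \<Longrightarrow> f * g \<in> I" for f g using I_l_closed[of g f] by simp
  show "f \<in> I \<Longrightarrow> g \<in> I \<Longrightarrow> f - g \<in> I"
    using add[of f "- g"] mult[of "- 1" g] by simp
qed

lemma ideal_xy_sum:
  assumes "ideal I (xy_ring d)" "\<And>a. a \<in> A \<Longrightarrow> f a \<in> I"
  shows "(\<Sum>a\<in>A. f a) \<in> I"
  using assms(2)
  by (induction A rule: infinite_finite_induct) (simp_all add: ideal_xyD[OF assms(1)])

lemma primeideal_xyD:
  assumes "primeideal P (xy_ring d)"
  shows "ideal P (xy_ring d)" and "1 \<notin> P"
    and "f \<in> xy_polys d \<Longrightarrow> g \<in> xy_polys d \<Longrightarrow> f * g \<in> P \<Longrightarrow> f \<in> P \<or> g \<in> P"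
proof -
  interpret primeideal P "xy_ring d" by (rule assms)
  show id: "ideal P (xy_ring d)" by (rule is_ideal)
  show "1 \<notin> P" using one_imp_carrier I_notcarr by auto
  show "f \<in> xy_polys d \<Longrightarrow> g \<in> xy_polys d \<Longrightarrow> f * g \<in> P \<Longrightarrow> f \<in> P \<or> g \<in> P"
    using I_prime[of f g] by simp
qed

definition subst_kernel :: "nat \<Rightarrow> (var \<Rightarrow> 'k mpoly) \<Rightarrow> 'k::field mpoly set" where
  "subst_kernel d h = {f \<in> xy_polys d. subst h f = 0}"

text \<open>The values of \<open>h\<close> may involve arbitrary variables; only the absence of zero
  divisors in the target matters.\<close>

lemma subst_kernel_prime: "primeideal (subst_kernel d h) (xy_ring d)"
proof (rule primeidealI)
  show "ideal (subst_kernel d h) (xy_ring d)"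
    by (rule ideal_xyI) (auto simp: subst_kernel_def subst_add subst_mult xy_polys_add xy_polys_mult)
  show "cring (xy_ring d :: 'a mpoly ring)" by (rule xy_ring_cring)
  have "1 \<notin> subst_kernel d h" by (simp add: subst_kernel_def)
  then show "carrier (xy_ring d) \<noteq> subst_kernel d h" by auto
qed (auto simp: subst_kernel_def subst_mult)

lemma Idl_ideal: "G \<subseteq> xy_polys d \<Longrightarrow> ideal (Idl\<^bsub>xy_ring d\<^esub> G) (xy_ring d)"
  using ring.genideal_ideal[OF cring.axioms(1)[OF xy_ring_cring], of G d] by simp

lemma Idl_self: "G \<subseteq> xy_polys d \<Longrightarrow> G \<subseteq> Idl\<^bsub>xy_ring d\<^esub> G"
  using ring.genideal_self[OF cring.axioms(1)[OF xy_ring_cring], of G d] by simp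

lemma Idl_minimal: "ideal I (xy_ring d) \<Longrightarrow> G \<subseteq> I \<Longrightarrow> Idl\<^bsub>xy_ring d\<^esub> G \<subseteq> I"
  using ring.genideal_minimal[OF cring.axioms(1)[OF xy_ring_cring]] by blast

section \<open>Heights\<close>

primrec list_monom :: "'a::comm_semiring_1 list \<Rightarrow> nat list \<Rightarrow> 'a" where
  "list_monom [] es = 1"
| "list_monom (u # us) es = u ^ hd es * list_monom us (tl es)"

text \<open>Algebraic independence modulo \<open>P\<close>, with \<open>c\<close> as coefficients of
  a polynomial relation. Lists make a repeated entry dependent once \<open>0 \<in> P\<close>, so the
  length is an honest count.\<close>

definition alg_indep :: "'k::field mpoly set \<Rightarrow> 'k mpoly list \<Rightarrow> bool" where
  "alg_indep P us \<longleftrightarrow> (\<forall>J c. finite J \<longrightarrow> (\<forall>es\<in>J. length es = length us) \<longrightarrow>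
     (\<Sum>es\<in>J. const (c es) * list_monom us es) \<in> P \<longrightarrow> (\<forall>es\<in>J. c es = 0))"

lemma alg_indepD:
  assumes "alg_indep P us" "finite J" "\<And>es. es \<in> J \<Longrightarrow> length es = length us"
    "(\<Sum>es\<in>J. const (c es) * list_monom us es) \<in> P" "es \<in> J"
  shows "c es = 0"
  using assms unfolding alg_indep_def by blast

lemma list_monom_in: "set us \<subseteq> xy_polys d \<Longrightarrow> list_monom us es \<in> xy_polys d"
  by (induction us arbitrary: es) (simp_all add: xy_polys_mult xy_polys_power)

lemma power_notin_prime:
  assumes "primeideal P (xy_ring d)" "f \<in> xy_polys d" "f \<notin> P"
  shows "f ^ n \<notin> P"
proof (induction n)
  case 0
  then show ?case using primeideal_xyD(2)[OF assms(1)] by simp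
next
  case (Suc n)
  then show ?case
    using primeideal_xyD(3)[OF assms(1,2) xy_polys_power[OF assms(2), of n]] assms(3) by auto
qed

text \<open>Going from a prime \<open>Q\<close> down to a smaller prime \<open>P\<close>, any element of \<open>Q - P\<close> is a new
  independent element: divide a relation by the highest possible power of it and reduce mod \<open>Q\<close>.\<close>

lemma alg_indep_Cons:
  assumes P: "primeideal P (xy_ring d)" and Q: "primeideal Q (xy_ring d)" and PQ: "P \<subseteq> Q"
    and f: "f \<in> Q" "f \<notin> P" and us: "set us \<subseteq> xy_polys d" and ind: "alg_indep Q us"
  shows "alg_indep P (f # us)"
  unfolding alg_indep_def
proof (intro allI impI, rule ccontr)
  fix J c
  assume fin: "finite J" and len: "\<forall>es\<in>J. length es = length (f # us)"
    and rel: "(\<Sum>es\<in>J. const (c es) * list_monom (f # us) es) \<in> P"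
    and nz: "\<not> (\<forall>es\<in>J. c es = 0)"
  note Pid = primeideal_xyD(1)[OF P] and Qid = primeideal_xyD(1)[OF Q]
  have fC: "f \<in> xy_polys d" using f ideal_xyD(1)[OF Qid] by blast
  define J' where "J' = {es \<in> J. c es \<noteq> 0}"
  define e0 where "e0 = Min (hd ` J')"
  have J': "finite J'" "J' \<noteq> {}" using fin nz by (auto simp: J'_def)
  have e0: "e0 \<in> hd ` J'" "\<And>es. es \<in> J' \<Longrightarrow> e0 \<le> hd es" using J' by (auto simp: e0_def)
  define g where "g es = const (c es) * (f ^ (hd es - e0) * list_monom us (tl es))" for es
  have gC: "g es \<in> xy_polys d" for es
    unfolding g_def by (intro xy_polys_mult xy_polys_power xy_polys_const fC list_monom_in us)
  have "(\<Sum>es\<in>J. const (c es) * list_monom (f # us) es) = (\<Sum>es\<in>J'. const (c es) * list_monom (f # us) es)"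
    by (rule sum.mono_neutral_right) (use fin in \<open>auto simp: J'_def\<close>)
  also have "\<dots> = (\<Sum>es\<in>J'. f ^ e0 * g es)"
  proof (rule sum.cong)
    fix es assume "es \<in> J'"
    then have "f ^ hd es = f ^ e0 * f ^ (hd es - e0)" using e0 by (simp flip: power_add)
    then show "const (c es) * list_monom (f # us) es = f ^ e0 * g es" by (simp add: g_def mult_ac)
  qed simp
  also have "\<dots> = f ^ e0 * (\<Sum>es\<in>J'. g es)" by (simp add: sum_distrib_left)
  finally have "f ^ e0 * (\<Sum>es\<in>J'. g es) \<in> P" using rel by simp
  then have "(\<Sum>es\<in>J'. g es) \<in> P"
    using primeideal_xyD(3)[OF P] power_notin_prime[OF P fC f(2)] xy_polys_power[OF fC] xy_polys_sum gC by metis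
  then have gQ: "(\<Sum>es\<in>J'. g es) \<in> Q" using PQ by blast
  \<comment> \<open>The terms outside \<open>J0\<close> still contain a factor \<open>f\<close> from
    \<open>Q\<close>, so modulo \<open>Q\<close> a relation among \<open>us\<close> alone remains,
    with a nonzero coefficient by the choice of \<open>e0\<close>.\<close>
  define J0 where "J0 = {es \<in> J'. hd es = e0}"
  have "(\<Sum>es\<in>J'. g es) = (\<Sum>es\<in>J0. g es) + (\<Sum>es\<in>J' - J0. g es)"
    using sum.subset_diff[of J0 J' g] J' by (simp add: J0_def add.commute)
  moreover have "(\<Sum>es\<in>J' - J0. g es) \<in> Q"
  proof (rule ideal_xy_sum[OF Qid])
    fix es assume "es \<in> J' - J0"
    then have "hd es \<noteq> e0" "e0 \<le> hd es" using e0 by (auto simp: J0_def)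
    then obtain k where "hd es - e0 = Suc k" by (metis Suc_diff_Suc le_neq_implies_less)
    then have "g es = (const (c es) * (f ^ k * list_monom us (tl es))) * f" by (simp add: g_def mult_ac)
    also have "\<dots> \<in> Q"
      by (intro ideal_xyD(4)[OF Qid] xy_polys_mult xy_polys_power xy_polys_const fC list_monom_in us f)
    finally show "g es \<in> Q" .
  qed
  ultimately have "(\<Sum>es\<in>J0. g es) \<in> Q" using gQ ideal_xyD(5)[OF Qid] by (metis add_diff_cancel_right')
  moreover have J0: "es = e0 # tl es" "length (tl es) = length us" if "es \<in> J0" for es
    using that len by (cases es; force simp: J0_def J'_def)+
  have inj: "inj_on tl J0" using J0(1) by (metis inj_onI)
  have "(\<Sum>es\<in>J0. g es) = (\<Sum>fs\<in>tl ` J0. const (c (e0 # fs)) * list_monom us fs)"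
    unfolding sum.reindex[OF inj] comp_def
    by (rule sum.cong) (use J0(1) in \<open>auto simp: g_def J0_def\<close>)
  ultimately have r: "(\<Sum>fs\<in>tl ` J0. const (c (e0 # fs)) * list_monom us fs) \<in> Q" by simp
  obtain es where es: "es \<in> J0" using e0(1) by (auto simp: J0_def)
  have "c (e0 # tl es) = 0"
    by (rule alg_indepD[OF ind _ _ r]) (use J0 es J' in \<open>auto simp: J0_def\<close>)
  then show False using es J0(1)[OF es] by (simp add: J0_def J'_def)
qed

text \<open>Each strict step down the chain contributes one new independent element.\<close>

lemma alg_indep_chain:
  assumes "\<And>i. i \<le> n \<Longrightarrow> primeideal (C i) (xy_ring d)" "\<And>i. i < n \<Longrightarrow> C i \<subset> C (Suc i)"
    and "alg_indep (C n) us" "set us \<subseteq> xy_polys d" "k \<le> n"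
  shows "\<exists>vs. length vs = length us + k \<and> alg_indep (C (n - k)) vs \<and> set vs \<subseteq> xy_polys d"
  using assms(5)
proof (induction k)
  case 0
  then show ?case using assms by auto
next
  case (Suc k)
  then obtain vs where vs: "length vs = length us + k" "alg_indep (C (n - k)) vs" "set vs \<subseteq> xy_polys d"
    by auto
  have e: "n - k = Suc (n - Suc k)" "n - Suc k < n" using Suc.prems by auto
  then have "C (n - Suc k) \<subset> C (n - k)" using assms(2) by metis
  then obtain f where f: "f \<in> C (n - k)" "f \<notin> C (n - Suc k)" by blast
  have pr: "primeideal (C (n - Suc k)) (xy_ring d)" "primeideal (C (n - k)) (xy_ring d)"
    using assms(1) by auto
  have "alg_indep (C (n - Suc k)) (f # vs)"
    by (rule alg_indep_Cons[OF pr _ f vs(3,2)]) (use \<open>C (n - Suc k) \<subset> C (n - k)\<close> in blast)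
  moreover have "f \<in> xy_polys d" using f ideal_xyD(1)[OF primeideal_xyD(1)[OF pr(2)]] by blast
  ultimately show ?case using vs by (intro exI[of _ "f # vs"]) auto
qed

section \<open>Counting monomials to bound the number of independent polynomials\<close>

definition exps_le :: "'k::zero mpoly \<Rightarrow> nat \<Rightarrow> bool" where
  "exps_le f n \<longleftrightarrow> (\<forall>m\<in>Poly_Mapping.keys f. \<forall>v. Poly_Mapping.lookup m v \<le> n)"

lemma exps_le_mono: "exps_le f n \<Longrightarrow> n \<le> n' \<Longrightarrow> exps_le f n'"
  unfolding exps_le_def using order_trans by blast

lemma exps_le_mult:
  fixes f g :: "'k::field mpoly"
  assumes "exps_le f a" "exps_le g b" shows "exps_le (f * g) (a + b)"
  unfolding exps_le_def
proof (intro ballI allI)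
  fix m v assume "m \<in> Poly_Mapping.keys (f * g)"
  then obtain m1 m2 where "m = m1 + m2" "m1 \<in> Poly_Mapping.keys f" "m2 \<in> Poly_Mapping.keys g"
    using keys_mult[of f g] by blast
  then show "Poly_Mapping.lookup m v \<le> a + b"
    using assms by (auto simp: exps_le_def lookup_add intro: add_mono)
qed

lemma exps_le_power: "exps_le f a \<Longrightarrow> exps_le (f ^ n) (n * a)" for f :: "'k::field mpoly"
proof (induction n)
  case 0
  then show ?case by (simp add: exps_le_def)
next
  case (Suc n)
  then show ?case using exps_le_mult[of f a "f ^ n" "n * a"] by simp
qed

lemma exps_le_exists: "\<exists>n. exps_le f n"
proof -
  define A where "A = (\<Union>m\<in>Poly_Mapping.keys f. Poly_Mapping.lookup m ` Poly_Mapping.keys m)"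
  have "finite A" by (auto simp: A_def)
  then have "Poly_Mapping.lookup m v \<le> Max (insert 0 A)" if "m \<in> Poly_Mapping.keys f" for m v
    using that by (cases "v \<in> Poly_Mapping.keys m") (auto simp: A_def in_keys_iff intro!: Max_ge)
  then show ?thesis unfolding exps_le_def by blast
qed

lemma exps_le_list_monom:
  fixes us :: "'k::field mpoly list"
  assumes "\<And>u. u \<in> set us \<Longrightarrow> exps_le u N" "length es = length us" "\<And>e. e \<in> set es \<Longrightarrow> e \<le> D"
  shows "exps_le (list_monom us es) (length us * (D * N))"
  using assms
proof (induction us arbitrary: es)
  case Nil
  then show ?case by (simp add: exps_le_def)
next
  case (Cons u us)
  then obtain e fs where es: "es = e # fs" by (cases es) auto
  have "exps_le (u ^ e) (D * N)"
    using exps_le_power[of u N e] exps_le_mono mult_le_mono1 Cons.prems es by (metis list.set_intros(1))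
  moreover have "exps_le (list_monom us fs) (length us * (D * N))"
    using Cons es by auto
  ultimately show ?case using exps_le_mult es by fastforce
qed

interpretation mpoly_vs: vector_space "\<lambda>(c::'k::field) (f::'k mpoly). const c * f"
  by unfold_locales (simp_all add: distrib_left distrib_right single_add mult_single flip: mult.assoc)

lemma card_monomials_le:
  defines "M \<equiv> \<lambda>d n. {m. Poly_Mapping.keys m \<subseteq> xy_vars d \<and> (\<forall>v. Poly_Mapping.lookup m v \<le> n)}"
  shows "finite (M d n)" and "card (M d n) \<le> Suc n ^ (2 * d)"
proof -
  have finv: "finite (xy_vars d)" by (simp add: xy_vars_def)
  have cardv: "card (xy_vars d) \<le> 2 * d"
    unfolding xy_vars_def using card_Un_le[of "VarX ` {1..d}" "VarY ` {1..d}"]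
      card_image_le[of "{1..d}" VarX] card_image_le[of "{1..d}" VarY] by simp
  let ?F = "xy_vars d \<rightarrow>\<^sub>E {..n}"
  have sub: "(\<lambda>m. restrict (Poly_Mapping.lookup m) (xy_vars d)) ` M d n \<subseteq> ?F" by (auto simp: M_def)
  have inj: "inj_on (\<lambda>m. restrict (Poly_Mapping.lookup m) (xy_vars d)) (M d n)"
  proof (rule inj_onI)
    fix m m' assume m: "m \<in> M d n" "m' \<in> M d n"
      "restrict (Poly_Mapping.lookup m) (xy_vars d) = restrict (Poly_Mapping.lookup m') (xy_vars d)"
    show "m = m'"
    proof (rule poly_mapping_eqI)
      fix v
      show "Poly_Mapping.lookup m v = Poly_Mapping.lookup m' v"
      proof (cases "v \<in> xy_vars d")
        case True
        then show ?thesis using fun_cong[OF m(3), of v] by simp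
      next
        case False
        then have "v \<notin> Poly_Mapping.keys m" "v \<notin> Poly_Mapping.keys m'" using m by (auto simp: M_def)
        then show ?thesis by (simp add: in_keys_iff)
      qed
    qed
  qed
  have finF: "finite ?F" using finv by (intro finite_PiE) auto
  show "finite (M d n)" using inj_on_finite[OF inj sub finF] .
  have "card (M d n) \<le> card ?F" by (rule card_inj_on_le[OF inj sub finF])
  also have "\<dots> = Suc n ^ card (xy_vars d)" using finv by (simp add: card_PiE)
  also have "\<dots> \<le> Suc n ^ (2 * d)" using cardv by (intro power_increasing) auto
  finally show "card (M d n) \<le> Suc n ^ (2 * d)" .
qed

text \<open>The \<open>D ^ length us\<close> products with exponents below \<open>D\<close> are
  linearly independent and lie in the span of the monomials with all exponents at most
  \<open>B\<close>, of which there are at most \<open>Suc B ^ (2 * d)\<close>. As \<open>B\<close>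
  is linear in \<open>D\<close>, a large \<open>D\<close> excludes more than \<open>2 * d\<close>
  polynomials.\<close>

lemma alg_indep_length:
  fixes us :: "'k::field mpoly list"
  assumes ind: "alg_indep P us" and P: "0 \<in> P" and us: "set us \<subseteq> xy_polys d"
  shows "length us \<le> 2 * d"
proof (rule ccontr)
  assume "\<not> length us \<le> 2 * d"
  then have n: "Suc (2 * d) \<le> length us" by simp
  have "\<exists>N. \<forall>u\<in>set us. exps_le u N"
  proof (induction us)
    case (Cons u us)
    then obtain N where "\<forall>u\<in>set us. exps_le u N" by blast
    moreover obtain N' where "exps_le u N'" using exps_le_exists by blast
    ultimately have "\<forall>u\<in>set (u # us). exps_le u (N + N')"
      using exps_le_mono by (metis le_add1 le_add2 set_ConsD)
    then show ?case by blast
  qed simp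
  then obtain N where N: "\<And>u. u \<in> set us \<Longrightarrow> exps_le u N" by blast
  \<comment> \<open>\<open>K\<close> is made for \<open>Suc B \<le> K * D\<close>, and
    \<open>D\<close> exceeds \<open>K ^ (2 * d)\<close>; so \<open>D ^ Suc (2 * d)\<close> is larger
    than \<open>(K * D) ^ (2 * d)\<close>.\<close>
  define K where "K = length us * N + 1"
  define D where "D = K ^ (2 * d) + 1"
  define B where "B = length us * (D * N)"
  define Es where "Es = {es. set es \<subseteq> {..<D} \<and> length es = length us}"
  define M where "M = {m. Poly_Mapping.keys m \<subseteq> xy_vars d \<and> (\<forall>v. Poly_Mapping.lookup m v \<le> B)}"
  define T where "T = (\<lambda>m. Poly_Mapping.single m (1::'k)) ` M"
  have M: "finite M" "card M \<le> Suc B ^ (2 * d)"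
    using card_monomials_le[of d B] by (simp_all add: M_def)
  have finEs: "finite Es" unfolding Es_def by (rule finite_lists_length_eq) simp
  have cardEs: "card Es = D ^ length us" unfolding Es_def by (simp add: card_lists_length_eq)
  have inj: "inj_on (list_monom us) Es"
  proof (rule inj_onI, rule ccontr)
    fix es es' assume es: "es \<in> Es" "es' \<in> Es" "list_monom us es = list_monom us es'" "es \<noteq> es'"
    define c where "c x = (if x = es then 1 else - 1 :: 'k)" for x
    have "(\<Sum>x\<in>{es, es'}. const (c x) * list_monom us x) = 0"
      using es by (simp add: c_def single_uminus)
    then have "c es = 0"
      using es P by (intro alg_indepD[OF ind, of "{es, es'}"]) (auto simp: Es_def)
    then show False by (simp add: c_def)
  qed
  have "mpoly_vs.independent (list_monom us ` Es)"
  proof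
    assume "mpoly_vs.dependent (list_monom us ` Es)"
    then obtain u where u: "\<exists>v\<in>list_monom us ` Es. u v \<noteq> 0"
        "(\<Sum>v\<in>list_monom us ` Es. const (u v) * v) = 0"
      using finEs by (auto simp: mpoly_vs.dependent_finite)
    then obtain es where es: "es \<in> Es" "u (list_monom us es) \<noteq> 0" by blast
    have r: "(\<Sum>es\<in>Es. const (u (list_monom us es)) * list_monom us es) \<in> P"
      using u(2) P by (simp add: sum.reindex[OF inj])
    have "u (list_monom us es) = 0"
      by (rule alg_indepD[OF ind finEs _ r es(1)]) (auto simp: Es_def)
    then show False using es by simp
  qed
  moreover have "list_monom us ` Es \<subseteq> mpoly_vs.span T"
  proof
    fix f assume "f \<in> list_monom us ` Es"
    then obtain es where es: "es \<in> Es" "f = list_monom us es" by blast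
    have le: "exps_le f B" unfolding es B_def
      using N es by (intro exps_le_list_monom) (auto simp: Es_def)
    have "f \<in> xy_polys d" unfolding es by (rule list_monom_in[OF us])
    then have "m \<in> M" if "m \<in> Poly_Mapping.keys f" for m
      using le that by (auto simp: M_def exps_le_def xy_polys_def)
    then have "const c * Poly_Mapping.single m 1 \<in> mpoly_vs.span T" if "m \<in> Poly_Mapping.keys f" for m c
      using that by (intro mpoly_vs.span_scale mpoly_vs.span_base) (auto simp: T_def)
    then have "(\<Sum>m\<in>Poly_Mapping.keys f. Poly_Mapping.single m (Poly_Mapping.lookup f m)) \<in> mpoly_vs.span T"
      by (intro mpoly_vs.span_sum) (simp add: mult_single)
    then show "f \<in> mpoly_vs.span T" using poly_mapping_sum_single[of f] by simp
  qed
  ultimately have "card (list_monom us ` Es) \<le> card T"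
    using mpoly_vs.independent_span_bound[of T] M by (auto simp: T_def)
  also have "card T \<le> card M" unfolding T_def using M by (intro card_image_le)
  finally have "D ^ length us \<le> Suc B ^ (2 * d)" using M cardEs card_image[OF inj] by simp
  moreover have "D ^ Suc (2 * d) \<le> D ^ length us" using n by (intro power_increasing) (auto simp: D_def)
  moreover have "Suc B \<le> K * D" by (simp add: B_def K_def D_def algebra_simps)
  then have "Suc B ^ (2 * d) \<le> K ^ (2 * d) * D ^ (2 * d)"
    by (metis power_mono power_mult_distrib zero_le)
  ultimately have "D ^ Suc (2 * d) \<le> K ^ (2 * d) * D ^ (2 * d)" by linarith
  then have "D * D ^ (2 * d) \<le> K ^ (2 * d) * D ^ (2 * d)" unfolding power_Suc .
  moreover have "D ^ (2 * d) > 0" by (simp add: D_def)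
  ultimately have "D \<le> K ^ (2 * d)" using mult_le_cancel2 by blast
  then show False by (simp add: D_def)
qed

text \<open>A chain of \<open>n\<close> steps ending in \<open>P\<close> lengthens an independent
  list by \<open>n\<close> at its bottom prime, where the length is at most
  \<open>2 * d\<close>.\<close>

lemma ideal_height_le:
  fixes us :: "'k::field mpoly list"
  assumes "alg_indep P us" "set us \<subseteq> xy_polys d"
  shows "ideal_height (xy_ring d) P \<le> enat (2 * d - length us)"
  unfolding ideal_height_def
proof (rule Sup_least)
  fix z assume "z \<in> {enat n | n. \<exists>C. (\<forall>i\<le>n. primeideal (C i) (xy_ring d)) \<and>
    (\<forall>i<n. C i \<subset> C (Suc i)) \<and> C n = P}"
  then obtain n C where z: "z = enat n" and C: "\<And>i. i \<le> n \<Longrightarrow> primeideal (C i) (xy_ring d)"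
    "\<And>i. i < n \<Longrightarrow> C i \<subset> C (Suc i)" "C n = P" by blast
  obtain vs where vs: "length vs = length us + n" "alg_indep (C 0) vs" "set vs \<subseteq> xy_polys d"
    using alg_indep_chain[of n C d us n] C assms by auto
  have "0 \<in> C 0" using C(1)[of 0] ideal_xyD(2)[OF primeideal_xyD(1)] by blast
  then have "length vs \<le> 2 * d" using alg_indep_length vs by blast
  then show "z \<le> enat (2 * d - length us)" using z vs by simp
qed

section \<open>Chains of kernels as lower bounds for heights\<close>

definition chain_to :: "nat \<Rightarrow> 'k::field mpoly set \<Rightarrow> nat \<Rightarrow> bool" where
  "chain_to d P n \<longleftrightarrow> (\<exists>C. (\<forall>i\<le>n. primeideal (C i) (xy_ring d)) \<and> (\<forall>i<n. C i \<subset> C (Suc i)) \<and> C n = P)"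

lemma chain_to_0: "primeideal P (xy_ring d) \<Longrightarrow> chain_to d P 0"
  unfolding chain_to_def by (intro exI[of _ "\<lambda>_. P"]) simp

lemma chain_to_Suc:
  assumes "chain_to d P n" "primeideal Q (xy_ring d)" "P \<subset> Q"
  shows "chain_to d Q (Suc n)"
proof -
  obtain C where C: "\<forall>i\<le>n. primeideal (C i) (xy_ring d)" "\<forall>i<n. C i \<subset> C (Suc i)" "C n = P"
    using assms unfolding chain_to_def by blast
  show ?thesis unfolding chain_to_def
    using C assms by (intro exI[of _ "C(Suc n := Q)"]) (auto simp: less_Suc_eq le_Suc_eq)
qed

lemma ideal_height_ge: "chain_to d P n \<Longrightarrow> enat n \<le> ideal_height (xy_ring d) P"
  unfolding ideal_height_def chain_to_def by (rule Sup_upper) blast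

definition indet :: "var \<Rightarrow> 'k::field mpoly" where
  "indet v = Poly_Mapping.single (Poly_Mapping.single v 1) 1"

lemma xvar_indet: "xvar i = indet (VarX i)" and yvar_indet: "yvar i = indet (VarY i)"
  by (simp_all add: xvar_def yvar_def indet_def)

lemma subst_indet [simp]: "subst h (indet v) = h v"
  by (simp add: indet_def subst_single)

lemma indet_nonzero [simp]: "indet v \<noteq> 0"
  by (simp add: indet_def) (metis lookup_single_eq lookup_zero zero_neq_one)

lemma indet_inject [simp]: "indet v = (indet w :: 'k::field mpoly) \<longleftrightarrow> v = w"
proof
  assume e: "indet v = (indet w :: 'k mpoly)"
  have "Poly_Mapping.keys (indet v :: 'k mpoly) = {Poly_Mapping.single v 1}"
    "Poly_Mapping.keys (indet w :: 'k mpoly) = {Poly_Mapping.single w 1}" by (simp_all add: indet_def)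
  then have "Poly_Mapping.single v (1::nat) = Poly_Mapping.single w 1" using e by simp
  then have "Poly_Mapping.keys (Poly_Mapping.single v (1::nat)) = Poly_Mapping.keys (Poly_Mapping.single w (1::nat))"
    by simp
  then show "v = w" by simp
qed simp

lemma indet_in: "v \<in> xy_vars d \<Longrightarrow> indet v \<in> xy_polys d"
  unfolding indet_def by (rule xy_polys_single) simp

lemma subst_kernel_psubset:
  assumes "\<And>v. subst g (h v) = h' v" "f \<in> xy_polys d" "subst h' f = 0" "subst h f \<noteq> 0"
  shows "subst_kernel d h \<subset> subst_kernel d h'"
proof -
  have "subst h' f = subst g (subst h f)" for f using assms(1) by (simp add: subst_subst)
  then show ?thesis using assms(2-4) by (auto simp: subst_kernel_def)
qed

text \<open>\<open>comp_subst S r\<close> sends \<open>x\<^sub>i, y\<^sub>i\<close> to \<open>0\<close> for \<open>i \<in> S\<close> and to \<open>x\<^sub>i, x\<^sub>i y\<^sub>r\<^sub>i\<close> otherwise. When \<open>r\<close> picks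
  a representative of each component of \<open>G - S\<close>, its kernel is the prime of \<open>S\<close>.\<close>

definition comp_subst :: "nat set \<Rightarrow> (nat \<Rightarrow> nat) \<Rightarrow> var \<Rightarrow> 'k::field mpoly" where
  "comp_subst S r v = (case v of VarX i \<Rightarrow> if i \<in> S then 0 else xvar i
     | VarY i \<Rightarrow> if i \<in> S then 0 else xvar i * yvar (r i))"

text \<open>Interpolates between the identity-like substitution and \<open>comp_subst S r\<close>: only the variables
  in \<open>Z\<close> are killed and only the indices in \<open>M\<close> are merged with their representative.\<close>

definition partial_subst :: "nat set \<Rightarrow> (nat \<Rightarrow> nat) \<Rightarrow> var set \<Rightarrow> nat set \<Rightarrow> var \<Rightarrow> 'k::field mpoly" where
  "partial_subst S r Z M v = (if v \<in> Z then 0 else case v of VarX i \<Rightarrow> xvar i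
     | VarY i \<Rightarrow> if i \<in> S then yvar i else xvar i * yvar (if i \<in> M then r i else i))"

text \<open>Keeps of the representatives only an idempotent map on the vertices outside
  \<open>S\<close>; no graph is involved. All other indices are fixed, so
  \<open>{i. r i \<noteq> i}\<close> consists of such vertices.\<close>

locale rep_fun =
  fixes d :: nat and S :: "nat set" and r :: "nat \<Rightarrow> nat"
  assumes S: "S \<subseteq> {1..d}"
    and r_in: "i \<in> {1..d} - S \<Longrightarrow> r i \<in> {1..d} - S"
    and r_idem: "i \<in> {1..d} - S \<Longrightarrow> r (r i) = r i"
    and r_out: "i \<notin> {1..d} - S \<Longrightarrow> r i = i"
begin

lemma finS: "finite S"
  using S finite_subset by blast

text \<open>Every step merges one index or kills one variable. Merging \<open>j\<close> is detected
  by the binomial of \<open>j\<close> and \<open>r j\<close>. For \<open>i \<in> S\<close> the image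
  of \<open>VarY i\<close> carries no factor \<open>xvar i\<close>, so killing \<open>VarX i\<close>
  and killing \<open>VarY i\<close> are two separate steps.\<close>

lemma chain_partial:
  assumes "finite Z" "Z \<subseteq> VarX ` S \<union> VarY ` S" "finite M" "M \<subseteq> {i. r i \<noteq> i}"
  shows "chain_to d (subst_kernel d (partial_subst S r Z M) :: 'k::field mpoly set) (card M + card Z)"
  using assms(1,2)
proof (induction Z rule: finite_induct)
  case empty
  show ?case using assms(3,4)
  proof (induction M rule: finite_induct)
    case empty
    then show ?case using chain_to_0[OF subst_kernel_prime] by simp
  next
    case (insert j M)
    have j: "j \<in> {1..d} - S" "r j \<noteq> j" using insert.prems r_out by blast+
    have rj: "r j \<in> {1..d} - S" "r (r j) = r j" using r_in r_idem j by blast+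
    have rjM: "r j \<notin> insert j M" using insert.prems rj j by auto
    let ?h = "partial_subst S r {} M :: var \<Rightarrow> 'k mpoly"
    let ?h' = "partial_subst S r {} (insert j M) :: var \<Rightarrow> 'k mpoly"
    have psub: "subst_kernel d ?h \<subset> subst_kernel d ?h'"
    proof (rule subst_kernel_psubset)
      show "subst (\<lambda>v. if v = VarY j then yvar (r j) else indet v) (?h v) = ?h' v" for v
      proof (cases v)
        case (VarX i)
        then show ?thesis by (simp add: partial_subst_def xvar_indet)
      next
        case (VarY i)
        \<comment> \<open>\<open>j\<close> is not a representative, so no index merged before points
          to it, and renaming \<open>VarY j\<close> alters the value at \<open>VarY j\<close>
          only.\<close>
        have "r i \<noteq> j" if "i \<in> M"
        proof
          assume "r i = j"
          then have "i \<in> {1..d} - S" using r_out j insert.hyps that by metis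
          then show False using r_idem[of i] \<open>r i = j\<close> j by simp
        qed
        then show ?thesis using VarY j insert.hyps
          by (auto simp: partial_subst_def xvar_indet yvar_indet subst_mult)
      qed
      show "xvar j * yvar (r j) - xvar (r j) * yvar j \<in> xy_polys d"
        using j rj by (intro xy_polys_diff xy_polys_mult xvar_in yvar_in) auto
      show "subst ?h' (xvar j * yvar (r j) - xvar (r j) * yvar j) = 0"
        using j rj rjM by (simp add: subst_diff subst_mult partial_subst_def)
      have "subst ?h (xvar j * yvar (r j) - xvar (r j) * yvar j) = indet (VarX j) * indet (VarX (r j)) *
          (indet (VarY (r j)) - indet (VarY j))"
        using j rj rjM insert.hyps
        by (simp add: subst_diff subst_mult partial_subst_def xvar_indet yvar_indet algebra_simps)
      then show "subst ?h (xvar j * yvar (r j) - xvar (r j) * yvar j) \<noteq> 0" using j by simp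
    qed
    show ?case
      using chain_to_Suc[OF _ subst_kernel_prime psub] insert by simp
  qed
next
  case (insert z Z)
  let ?h = "partial_subst S r Z M :: var \<Rightarrow> 'k mpoly"
  let ?h' = "partial_subst S r (insert z Z) M :: var \<Rightarrow> 'k mpoly"
  have z: "z \<in> VarX ` S \<union> VarY ` S" using insert.prems by blast
  have zv: "z \<in> xy_vars d" using z S by (auto simp: xy_vars_def)
  have psub: "subst_kernel d ?h \<subset> subst_kernel d ?h'"
  proof (rule subst_kernel_psubset)
    show "subst (\<lambda>v. if v = z then 0 else indet v) (?h v) = ?h' v" for v
    proof (cases v)
      case (VarX i)
      then show ?thesis by (auto simp: partial_subst_def xvar_indet)
    next
      case (VarY i)
      have "(if i \<in> M then r i else i) \<notin> S" if "i \<notin> S"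
        using that r_in[of i] r_out[of i] by (cases "i \<in> {1..d} - S") auto
      then show ?thesis using VarY z
        by (auto simp: partial_subst_def xvar_indet yvar_indet subst_mult)
    qed
    show "indet z \<in> xy_polys d" using indet_in zv by blast
    show "subst ?h' (indet z) = 0" by (simp add: partial_subst_def)
    show "subst ?h (indet z) \<noteq> 0"
      using z insert.hyps by (auto simp: partial_subst_def xvar_indet yvar_indet)
  qed
  show ?case
    using chain_to_Suc[OF _ subst_kernel_prime psub] insert by simp
qed

definition reps :: "nat set" where
  "reps = r ` ({1..d} - S)"

lemma reps: "reps = {i \<in> {1..d} - S. r i = i}"
  unfolding reps_def using r_in r_idem by force

lemma card_reps_le: "card reps + card S \<le> d"
proof -
  have "card reps \<le> card ({1..d} - S)" unfolding reps by (intro card_mono) auto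
  also have "\<dots> = d - card S" using S finS by (simp add: card_Diff_subset)
  finally show ?thesis using card_mono[OF _ S] by simp
qed

text \<open>Two killed variables per element of \<open>S\<close>, plus one merge for each vertex
  outside \<open>S\<close> that is not a representative.\<close>

lemma height_ge: "enat (d + card S - card reps) \<le> ideal_height (xy_ring d) (subst_kernel d (comp_subst S r) :: 'k::field mpoly set)"
proof -
  let ?Z = "VarX ` S \<union> VarY ` S" and ?M = "{i \<in> {1..d} - S. r i \<noteq> i}"
  have "partial_subst S r ?Z ?M v = (comp_subst S r v :: 'k mpoly)" for v
    using r_out by (cases v) (auto simp: partial_subst_def comp_subst_def)
  then have e: "partial_subst S r ?Z ?M = (comp_subst S r :: var \<Rightarrow> 'k mpoly)" by blast
  have "card (VarX ` S) = card S" "card (VarY ` S) = card S"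
    by (auto intro!: card_image inj_onI)
  then have "card ?Z = 2 * card S" using finS by (subst card_Un_disjoint) auto
  moreover have "card ?M + card reps = d - card S"
  proof -
    have "{1..d} - S = ?M \<union> reps" "?M \<inter> reps = {}" by (auto simp: reps)
    moreover have "finite reps" by (simp add: reps)
    ultimately have "card ({1..d} - S) = card ?M + card reps" by (metis (lifting) card_Un_disjoint finite_Diff finite_Un finite_atLeastAtMost)
    then show ?thesis using S finS by (simp add: card_Diff_subset)
  qed
  ultimately have "card ?M + card ?Z = d + card S - card reps" using card_reps_le by simp
  moreover have "chain_to d (subst_kernel d (partial_subst S r ?Z ?M) :: 'k mpoly set) (card ?M + card ?Z)"
    using finS by (intro chain_partial) auto
  ultimately show ?thesis using ideal_height_ge e by metis
qed

end

text \<open>A criterion for multiplicative independence of monomials: the variable \<open>z\<close>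
  of the head is absent from the tail, so its exponent in a product reveals the first entry of the
  exponent list.\<close>

primrec triangular :: "('v \<Rightarrow> 'w \<Rightarrow>\<^sub>0 nat) \<Rightarrow> 'v list \<Rightarrow> bool" where
  "triangular w [] = True"
| "triangular w (v # vs) \<longleftrightarrow> triangular w vs \<and>
     (\<exists>z. Poly_Mapping.lookup (w v) z = 1 \<and> (\<forall>v'\<in>set vs. Poly_Mapping.lookup (w v') z = 0))"

primrec list_exponent :: "('v \<Rightarrow> 'w \<Rightarrow>\<^sub>0 nat) \<Rightarrow> 'v list \<Rightarrow> nat list \<Rightarrow> 'w \<Rightarrow>\<^sub>0 nat" where
  "list_exponent w [] es = 0"
| "list_exponent w (v # vs) es = (\<Sum>j<hd es. w v) + list_exponent w vs (tl es)"

lemma list_exponent_lookup_zero: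
  "\<forall>v'\<in>set vs. Poly_Mapping.lookup (w v') z = 0 \<Longrightarrow> Poly_Mapping.lookup (list_exponent w vs es) z = 0"
  by (induction vs arbitrary: es) (simp_all add: lookup_add lookup_sum)

lemma list_exponent_inject:
  assumes "triangular w vs" "length es = length vs" "length fs = length vs"
    "list_exponent w vs es = list_exponent w vs fs"
  shows "es = fs"
  using assms
proof (induction vs arbitrary: es fs)
  case (Cons v vs)
  obtain e es' where es: "es = e # es'" using Cons.prems(2) by (cases es) auto
  obtain f fs' where fs: "fs = f # fs'" using Cons.prems(3) by (cases fs) auto
  obtain z where z: "Poly_Mapping.lookup (w v) z = 1" "\<forall>v'\<in>set vs. Poly_Mapping.lookup (w v') z = 0"
    using Cons.prems(1) by auto
  have "Poly_Mapping.lookup (list_exponent w (v # vs) es) z = e" "Poly_Mapping.lookup (list_exponent w (v # vs) fs) z = f"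
    using z list_exponent_lookup_zero[OF z(2)] es fs by (simp_all add: lookup_add lookup_sum)
  then have "e = f" using Cons.prems(4) by simp
  moreover have "es' = fs'" using Cons es fs \<open>e = f\<close> by auto
  ultimately show ?case using es fs by simp
qed simp

text \<open>\<open>h\<close> sends products with different exponent lists to different monomials, so
  nothing can cancel in the image of a relation.\<close>

lemma alg_indep_kernel:
  fixes h :: "var \<Rightarrow> 'k::field mpoly"
  assumes w: "\<And>v. v \<in> set vs \<Longrightarrow> h v = Poly_Mapping.single (w v) 1" and tri: "triangular w vs"
  shows "alg_indep (subst_kernel d h) (map indet vs)"
  unfolding alg_indep_def
proof (intro allI impI ballI)
  fix J and c :: "nat list \<Rightarrow> 'k" and fs
  assume fin: "finite J" and len: "\<forall>es\<in>J. length es = length (map indet vs)"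
    and rel: "(\<Sum>es\<in>J. const (c es) * list_monom (map indet vs) es) \<in> subst_kernel d h" and fs: "fs \<in> J"
  have pw: "Poly_Mapping.single a (1::'k) ^ n = Poly_Mapping.single (\<Sum>j<n. a) 1" for a :: "var \<Rightarrow>\<^sub>0 nat" and n
    by (induction n) (simp_all add: mult_single add.commute)
  have "subst h (list_monom (map indet vs) es) = Poly_Mapping.single (list_exponent w vs es) 1" for es
    using w by (induction vs arbitrary: es) (simp_all add: subst_mult subst_power pw mult_single)
  then have "(\<Sum>es\<in>J. Poly_Mapping.single (list_exponent w vs es) (c es)) = 0"
    using rel by (simp add: subst_kernel_def subst_sum subst_mult mult_single)
  then have "0 = Poly_Mapping.lookup (\<Sum>es\<in>J. Poly_Mapping.single (list_exponent w vs es) (c es)) (list_exponent w vs fs)"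
    by simp
  also have "\<dots> = (\<Sum>es\<in>J. if es = fs then c es else 0)"
    unfolding lookup_sum
  proof (rule sum.cong)
    fix es assume "es \<in> J"
    then show "Poly_Mapping.lookup (Poly_Mapping.single (list_exponent w vs es) (c es)) (list_exponent w vs fs)
        = (if es = fs then c es else 0)"
      using list_exponent_inject[OF tri, of es fs] len fs by (auto simp: lookup_single when_def)
  qed simp
  also have "\<dots> = c fs" using fin fs by simp
  finally show "c fs = 0" by simp
qed

context rep_fun begin

text \<open>The independent elements are \<open>x_i\<close> for all \<open>i\<close> outside
  \<open>S\<close> and \<open>y_t\<close> for the representatives \<open>t\<close>, with images
  \<open>x_i\<close> and \<open>x_t y_t\<close>. Listing the \<open>y_t\<close> first makes the
  system triangular.\<close>

lemma height_le: "ideal_height (xy_ring d) (subst_kernel d (comp_subst S r) :: 'k::field mpoly set) \<le> enat (d + card S - card reps)"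
proof -
  define xs where "xs = map VarX (sorted_list_of_set ({1..d} - S))"
  define ys where "ys = map VarY (sorted_list_of_set reps)"
  define w where "w v = (case v of VarX i \<Rightarrow> Poly_Mapping.single (VarX i) (1::nat)
    | VarY i \<Rightarrow> Poly_Mapping.single (VarX i) 1 + Poly_Mapping.single (VarY i) 1)" for v
  have finr: "finite reps" by (simp add: reps)
  have tx: "triangular w (map VarX l)" if "distinct l" for l
    using that by (induction l) (auto simp: w_def lookup_single when_def intro!: exI[of _ "VarX _"])
  have "triangular w (map VarY l @ xs)" if "distinct l" for l
    using that
  proof (induction l)
    case Nil
    then show ?case using tx by (simp add: xs_def)
  next
    case (Cons i l)
    then show ?case
      by (auto simp: w_def xs_def lookup_single lookup_add when_def intro!: exI[of _ "VarY i"])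
  qed
  then have tri: "triangular w (ys @ xs)" by (simp add: ys_def)
  have "comp_subst S r v = (Poly_Mapping.single (w v) 1 :: 'k mpoly)" if "v \<in> set (ys @ xs)" for v
    using that finr
    by (auto simp: ys_def xs_def reps comp_subst_def w_def xvar_def yvar_def mult_single)
  then have "alg_indep (subst_kernel d (comp_subst S r) :: 'k mpoly set) (map indet (ys @ xs))"
    using alg_indep_kernel tri by blast
  moreover have "set (map indet (ys @ xs)) \<subseteq> (xy_polys d :: 'k mpoly set)"
    using finr by (auto simp: ys_def xs_def reps intro!: indet_in) (auto simp: xy_vars_def)
  ultimately have "ideal_height (xy_ring d) (subst_kernel d (comp_subst S r) :: 'k mpoly set)
      \<le> enat (2 * d - length (map indet (ys @ xs) :: 'k mpoly list))"
    by (rule ideal_height_le)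
  moreover have "length (map indet (ys @ xs) :: 'k mpoly list) = card reps + (d - card S)"
    using finr S finS by (simp add: ys_def xs_def card_Diff_subset)
  moreover have "2 * d - (card reps + (d - card S)) = d + card S - card reps"
    using card_reps_le by simp
  ultimately show ?thesis by simp
qed

lemma height_eq: "ideal_height (xy_ring d) (subst_kernel d (comp_subst S r) :: 'k::field mpoly set) = enat (d + card S - card reps)"
  using height_le height_ge by (rule antisym)

end

section \<open>The primes of a binomial edge ideal\<close>

definition edge_binom :: "nat \<Rightarrow> nat \<Rightarrow> 'k::field mpoly" where
  "edge_binom i j = xvar i * yvar j - xvar j * yvar i"

lemma edge_binom_in: "i \<in> {1..d} \<Longrightarrow> j \<in> {1..d} \<Longrightarrow> edge_binom i j \<in> xy_polys d"
  unfolding edge_binom_def by (intro xy_polys_diff xy_polys_mult xvar_in yvar_in)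

lemma eval_monom_cong: "(\<And>v. v \<in> Poly_Mapping.keys m \<Longrightarrow> h v = h' v) \<Longrightarrow> eval_monom h m = eval_monom h' m"
  by (simp add: eval_monom_def)

section \<open>Generators of the kernel\<close>

context rep_fun begin

abbreviation "live \<equiv> {1..d} - S"

definition weight :: "var \<Rightarrow> (var \<Rightarrow>\<^sub>0 nat)" where
  "weight v = (case v of VarX i \<Rightarrow> Poly_Mapping.single (VarX i) 1
    | VarY i \<Rightarrow> Poly_Mapping.single (VarX i) 1 + Poly_Mapping.single (VarY (r i)) 1)"

definition image_monom :: "(var \<Rightarrow>\<^sub>0 nat) \<Rightarrow> (var \<Rightarrow>\<^sub>0 nat)" where
  "image_monom m = (\<Sum>v\<in>Poly_Mapping.keys m. \<Sum>j<Poly_Mapping.lookup m v. weight v)"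

definition live_monom :: "(var \<Rightarrow>\<^sub>0 nat) \<Rightarrow> bool" where
  "live_monom m \<longleftrightarrow> Poly_Mapping.keys m \<subseteq> VarX ` live \<union> VarY ` live"

lemma subst_live_monom:
  assumes "live_monom m"
  shows "subst (comp_subst S r) (Poly_Mapping.single m c) = Poly_Mapping.single (image_monom m) (c::'k::field)"
proof -
  have "eval_monom (comp_subst S r) m = eval_monom (\<lambda>v. Poly_Mapping.single (weight v) (1::'k)) m"
    using assms by (intro eval_monom_cong)
      (auto simp: live_monom_def comp_subst_def weight_def xvar_def yvar_def mult_single)
  then show ?thesis
    by (simp add: subst_single eval_monom_indeterminates image_monom_def mult_single)
qed

lemma subst_dead_monom:
  assumes "Poly_Mapping.keys m \<subseteq> xy_vars d" "\<not> live_monom m"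
  shows "\<exists>v\<in>VarX ` S \<union> VarY ` S. v \<in> Poly_Mapping.keys m"
    and "subst (comp_subst S r) (Poly_Mapping.single m c) = (0::'k::field mpoly)"
proof -
  show ex: "\<exists>v\<in>VarX ` S \<union> VarY ` S. v \<in> Poly_Mapping.keys m"
  proof -
    obtain v where v: "v \<in> Poly_Mapping.keys m" "v \<notin> VarX ` live \<union> VarY ` live"
      using assms(2) by (auto simp: live_monom_def)
    then have "v \<in> xy_vars d" using assms(1) by blast
    then show ?thesis using v by (auto simp: xy_vars_def)
  qed
  then obtain v where v: "v \<in> VarX ` S \<union> VarY ` S" "v \<in> Poly_Mapping.keys m" by blast
  have "comp_subst S r v ^ Poly_Mapping.lookup m v = (0::'k mpoly)"
    using v by (auto simp: comp_subst_def in_keys_iff)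
  then have "eval_monom (comp_subst S r) m = (0::'k mpoly)"
    unfolding eval_monom_def using v by (intro prod_zero) auto
  then show "subst (comp_subst S r) (Poly_Mapping.single m c) = (0::'k mpoly)"
    by (simp add: subst_single)
qed

lemma image_monom_live:
  assumes "live_monom m"
  shows "image_monom m = (\<Sum>i\<in>live. \<Sum>j<Poly_Mapping.lookup m (VarX i). weight (VarX i))
    + (\<Sum>i\<in>live. \<Sum>j<Poly_Mapping.lookup m (VarY i). weight (VarY i))"
proof -
  have "image_monom m = (\<Sum>v\<in>VarX ` live \<union> VarY ` live. \<Sum>j<Poly_Mapping.lookup m v. weight v)"
    unfolding image_monom_def
    by (rule sum.mono_neutral_left) (use assms in \<open>auto simp: live_monom_def in_keys_iff\<close>)
  also have "\<dots> = (\<Sum>v\<in>VarX ` live. \<Sum>j<Poly_Mapping.lookup m v. weight v)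
      + (\<Sum>v\<in>VarY ` live. \<Sum>j<Poly_Mapping.lookup m v. weight v)"
    by (rule sum.union_disjoint) auto
  finally show ?thesis by (simp add: sum.reindex inj_on_def)
qed

lemma lookup_image_X:
  assumes "live_monom m" "i \<in> live"
  shows "Poly_Mapping.lookup (image_monom m) (VarX i) = Poly_Mapping.lookup m (VarX i) + Poly_Mapping.lookup m (VarY i)"
proof -
  have "Poly_Mapping.lookup (image_monom m) (VarX i)
      = (\<Sum>k\<in>live. if k = i then Poly_Mapping.lookup m (VarX k) else 0)
      + (\<Sum>k\<in>live. if k = i then Poly_Mapping.lookup m (VarY k) else 0)"
    unfolding image_monom_live[OF assms(1)] lookup_add lookup_sum
    by (intro arg_cong2[of _ _ _ _ "(+)"] sum.cong refl)
      (simp_all add: weight_def lookup_single lookup_add when_def)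
  then show ?thesis using assms(2) by simp
qed

lemma lookup_image_Y:
  assumes "live_monom m"
  shows "Poly_Mapping.lookup (image_monom m) (VarY t) = (\<Sum>i\<in>{i\<in>live. r i = t}. Poly_Mapping.lookup m (VarY i))"
proof -
  have "Poly_Mapping.lookup (image_monom m) (VarY t)
      = (\<Sum>k\<in>live. 0) + (\<Sum>k\<in>live. if r k = t then Poly_Mapping.lookup m (VarY k) else 0)"
    unfolding image_monom_live[OF assms(1)] lookup_add lookup_sum
    by (intro arg_cong2[of _ _ _ _ "(+)"] sum.cong refl)
      (simp_all add: weight_def lookup_single lookup_add when_def)
  also have "\<dots> = (\<Sum>i\<in>{i\<in>live. r i = t}. Poly_Mapping.lookup m (VarY i))"
    by (subst sum.inter_filter) simp_all
  finally show ?thesis .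
qed

text \<open>Two monomials with the same image differ by swaps \<open>y\<^sub>i x\<^sub>j \<rightarrow> x\<^sub>i y\<^sub>j\<close> inside a component.\<close>

lemma monom_congruent:
  fixes I :: "'k::field mpoly set"
  assumes I: "ideal I (xy_ring d)"
    and binom: "\<And>i j. i \<in> live \<Longrightarrow> j \<in> live \<Longrightarrow> r i = r j \<Longrightarrow> edge_binom i j \<in> I"
    and "live_monom m" "live_monom m'" "image_monom m = image_monom m'"
  shows "Poly_Mapping.single m 1 - Poly_Mapping.single m' 1 \<in> I"
  using assms(3,5)
\<comment> \<open>The measure is the total excess of \<open>m\<close> over \<open>m'\<close> in the
  exponents of the \<open>y\<close> variables; truncated subtraction ignores vertices with a
  deficit.\<close>
proof (induction "\<Sum>i\<in>live. Poly_Mapping.lookup m (VarY i) - Poly_Mapping.lookup m' (VarY i)"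
    arbitrary: m rule: less_induct)
  case less
  let ?b = "\<lambda>i. Poly_Mapping.lookup m (VarY i)" and ?b' = "\<lambda>i. Poly_Mapping.lookup m' (VarY i)"
  let ?a = "\<lambda>i. Poly_Mapping.lookup m (VarX i)" and ?a' = "\<lambda>i. Poly_Mapping.lookup m' (VarX i)"
  have ab: "?a i + ?b i = ?a' i + ?b' i" if "i \<in> live" for i
    using lookup_image_X[OF less.prems(1) that] lookup_image_X[OF assms(4) that] less.prems(2) by simp
  have bs: "(\<Sum>i\<in>{i\<in>live. r i = t}. ?b i) = (\<Sum>i\<in>{i\<in>live. r i = t}. ?b' i)" for t
    using lookup_image_Y[OF less.prems(1)] lookup_image_Y[OF assms(4)] less.prems(2) by metis
  show ?case
  proof (cases "\<exists>i\<in>live. ?b i > ?b' i")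
    case False
    have beq: "?b i = ?b' i" if i: "i \<in> live" for i
    proof (rule ccontr)
      assume "?b i \<noteq> ?b' i"
      then have "?b i < ?b' i" using False i by force
      then have "(\<Sum>k\<in>{k\<in>live. r k = r i}. ?b k) < (\<Sum>k\<in>{k\<in>live. r k = r i}. ?b' k)"
        using False i by (intro sum_strict_mono_ex1) (auto simp: not_less)
      then show False using bs by simp
    qed
    have "m = m'"
    proof (rule poly_mapping_eqI)
      fix v
      consider i where "i \<in> live" "v = VarX i" | i where "i \<in> live" "v = VarY i"
        | "v \<notin> VarX ` live \<union> VarY ` live" by blast
      then show "Poly_Mapping.lookup m v = Poly_Mapping.lookup m' v"
      proof cases
        case 1 then show ?thesis using ab[of i] beq[of i] by simp
      next
        case 2 then show ?thesis using beq by simp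
      next
        case 3
        then have "v \<notin> Poly_Mapping.keys m" "v \<notin> Poly_Mapping.keys m'"
          using less.prems(1) assms(4) by (auto simp: live_monom_def)
        then show ?thesis by (simp add: in_keys_iff)
      qed
    qed
    then show ?thesis using ideal_xyD(2)[OF I] by simp
  next
    case True
    then obtain i where i: "i \<in> live" "?b i > ?b' i" by blast
    \<comment> \<open>Over a class of \<open>r\<close> both monomials have the same total
      \<open>y\<close> exponent, so an excess at \<open>i\<close> forces a deficit at some
      \<open>j\<close> of its class. The \<open>x\<close> and \<open>y\<close> exponents at
      \<open>j\<close> have equal sums in \<open>m\<close> and \<open>m'\<close>, so
      \<open>x_j\<close> divides \<open>m\<close> and a swap is possible.\<close>
    have "\<exists>j\<in>{k\<in>live. r k = r i}. ?b j < ?b' j"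
    proof (rule ccontr)
      assume "\<not> ?thesis"
      then have "(\<Sum>k\<in>{k\<in>live. r k = r i}. ?b' k) < (\<Sum>k\<in>{k\<in>live. r k = r i}. ?b k)"
        using i by (intro sum_strict_mono_ex1) (auto simp: not_less)
      then show False using bs by simp
    qed
    then obtain j where j: "j \<in> live" "r j = r i" "?b j < ?b' j" by blast
    have ij: "i \<noteq> j" using i j by auto
    have aj: "?a j > 0" using ab[OF j(1)] j(3) by simp
    let ?s = "\<lambda>v. Poly_Mapping.single v (1::nat)"
    define q where "q = m - (?s (VarY i) + ?s (VarX j))"
    have m: "m = q + (?s (VarY i) + ?s (VarX j))"
    proof (rule poly_mapping_eqI)
      fix v
      show "Poly_Mapping.lookup m v = Poly_Mapping.lookup (q + (?s (VarY i) + ?s (VarX j))) v"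
        using i aj by (auto simp: q_def lookup_add lookup_minus lookup_single when_def)
    qed
    define m2 where "m2 = q + (?s (VarX i) + ?s (VarY j))"
    have kq: "Poly_Mapping.keys q \<subseteq> Poly_Mapping.keys m"
      by (auto simp: q_def in_keys_iff lookup_minus)
    have live2: "live_monom m2"
      unfolding live_monom_def
    proof
      fix v assume "v \<in> Poly_Mapping.keys m2"
      then have "v \<in> Poly_Mapping.keys q \<or> v = VarX i \<or> v = VarY j"
        by (auto simp: m2_def in_keys_iff lookup_add lookup_single when_def split: if_splits)
      then show "v \<in> VarX ` live \<union> VarY ` live"
        using kq less.prems(1) i(1) j(1) by (auto simp: live_monom_def)
    qed
    have s1: "Poly_Mapping.single m 1 = Poly_Mapping.single q 1 * (xvar j * yvar i :: 'k mpoly)"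
      unfolding m xvar_def yvar_def by (simp add: mult_single add_ac)
    have s2: "Poly_Mapping.single m2 1 = Poly_Mapping.single q 1 * (xvar i * yvar j :: 'k mpoly)"
      unfolding m2_def xvar_def yvar_def by (simp add: mult_single add_ac)
    have "Poly_Mapping.keys q \<subseteq> xy_vars d"
      using kq less.prems(1) by (auto simp: live_monom_def xy_vars_def)
    then have "Poly_Mapping.single q (1::'k) \<in> xy_polys d" by (rule xy_polys_single)
    then have "Poly_Mapping.single q 1 * edge_binom j i \<in> I"
      using binom[OF j(1) i(1) j(2)] ideal_xyD(4)[OF I] by blast
    then have d1: "Poly_Mapping.single m 1 - Poly_Mapping.single m2 (1::'k) \<in> I"
      unfolding s1 s2 edge_binom_def by (simp add: algebra_simps)
    have "subst (comp_subst S r) (Poly_Mapping.single m 1) = (subst (comp_subst S r) (Poly_Mapping.single m2 1) :: 'k mpoly)"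
      unfolding s1 s2 using i(1) j(1,2) by (simp add: subst_mult comp_subst_def mult_ac)
    then have "Poly_Mapping.single (image_monom m) (1::'k) = Poly_Mapping.single (image_monom m2) 1"
      unfolding subst_live_monom[OF less.prems(1)] subst_live_monom[OF live2] .
    then have "Poly_Mapping.keys (Poly_Mapping.single (image_monom m) (1::'k)) = Poly_Mapping.keys (Poly_Mapping.single (image_monom m2) (1::'k))"
      by simp
    then have im2: "image_monom m2 = image_monom m'" using less.prems(2) by simp
    have l2: "Poly_Mapping.lookup m2 (VarY k) = (if k = j then ?b j + 1 else if k = i then ?b i - 1 else ?b k)" for k
      using ij by (simp add: m2_def q_def lookup_add lookup_minus lookup_single when_def)
    have "(\<Sum>k\<in>live. Poly_Mapping.lookup m2 (VarY k) - ?b' k) < (\<Sum>k\<in>live. ?b k - ?b' k)"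
    proof (rule sum_strict_mono_ex1)
      show "\<forall>k\<in>live. Poly_Mapping.lookup m2 (VarY k) - ?b' k \<le> ?b k - ?b' k"
        using j by (auto simp: l2)
      show "\<exists>k\<in>live. Poly_Mapping.lookup m2 (VarY k) - ?b' k < ?b k - ?b' k"
        using i ij by (intro bexI[of _ i]) (auto simp: l2)
    qed simp
    then have "Poly_Mapping.single m2 1 - Poly_Mapping.single m' (1::'k) \<in> I"
      using less.hyps live2 im2 by blast
    then show ?thesis using ideal_xyD(3)[OF I d1] by fastforce
  qed
qed

text \<open>\<open>T\<close> is an additive map back from the image that chooses a live monomial
  over each exponent. Modulo \<open>I\<close> it undoes the substitution: live monomials with equal
  image are congruent, and a monomial with a variable from \<open>S\<close> lies in
  \<open>I\<close>. On a kernel element \<open>T\<close> receives 0.\<close>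

lemma kernel_subset:
  fixes I :: "'k::field mpoly set"
  assumes I: "ideal I (xy_ring d)"
    and binom: "\<And>i j. i \<in> live \<Longrightarrow> j \<in> live \<Longrightarrow> r i = r j \<Longrightarrow> edge_binom i j \<in> I"
    and vars: "\<And>i. i \<in> S \<Longrightarrow> xvar i \<in> I" "\<And>i. i \<in> S \<Longrightarrow> yvar i \<in> I"
  shows "subst_kernel d (comp_subst S r) \<subseteq> I"
proof -
  define lift where "lift e = (SOME m. live_monom m \<and> image_monom m = e)" for e
  define T where "T g = (\<Sum>e\<in>Poly_Mapping.keys g. Poly_Mapping.single (lift e) (Poly_Mapping.lookup g e))"
    for g :: "'k mpoly"
  have lift: "live_monom (lift (image_monom m))" "image_monom (lift (image_monom m)) = image_monom m"
    if "live_monom m" for m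
    unfolding lift_def using someI[of "\<lambda>n. live_monom n \<and> image_monom n = image_monom m" m] that by blast+
  have Tsup: "T g = (\<Sum>e\<in>M. Poly_Mapping.single (lift e) (Poly_Mapping.lookup g e))"
    if "finite M" "Poly_Mapping.keys g \<subseteq> M" for g M
    unfolding T_def by (rule sum.mono_neutral_left) (use that in \<open>auto simp: in_keys_iff\<close>)
  have Tadd: "T (f + g) = T f + T g" for f g
  proof -
    let ?M = "Poly_Mapping.keys f \<union> Poly_Mapping.keys g"
    have "T (f + g) = (\<Sum>e\<in>?M. Poly_Mapping.single (lift e) (Poly_Mapping.lookup (f + g) e))"
      by (rule Tsup) (simp_all add: keys_add)
    then show ?thesis by (simp add: lookup_add single_add sum.distrib Tsup[of ?M])
  qed
  have Tsingle: "T (Poly_Mapping.single e c) = Poly_Mapping.single (lift e) c" for e c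
    by (cases "c = 0") (simp_all add: T_def)
  have main: "T (subst (comp_subst S r) f) - f \<in> I" if f: "f \<in> xy_polys d" for f :: "'k mpoly"
  proof (induction f rule: poly_mapping_monomial_induct)
    case zero
    then show ?case using ideal_xyD(2)[OF I] by (simp add: T_def)
  next
    case (single m c)
    then have km: "Poly_Mapping.keys m \<subseteq> xy_vars d" using f by (auto simp: xy_polys_def)
    show ?case
    proof (cases "live_monom m")
      case True
      have "Poly_Mapping.single (lift (image_monom m)) 1 - Poly_Mapping.single m (1::'k) \<in> I"
        using lift[OF True] True by (intro monom_congruent[OF I binom]) auto
      then have "const c * (Poly_Mapping.single (lift (image_monom m)) 1 - Poly_Mapping.single m 1) \<in> I"
        by (intro ideal_xyD(4)[OF I] xy_polys_const)
      then show ?thesis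
        using True by (simp add: subst_live_monom Tsingle right_diff_distrib mult_single)
    next
      case False
      obtain v where v: "v \<in> VarX ` S \<union> VarY ` S" "v \<in> Poly_Mapping.keys m"
        using subst_dead_monom(1)[OF km False] by blast
      define q where "q = m - Poly_Mapping.single v 1"
      have m: "m = q + Poly_Mapping.single v 1"
        by (rule poly_mapping_eqI)
          (use v in \<open>auto simp: q_def lookup_add lookup_minus lookup_single when_def in_keys_iff\<close>)
      have "Poly_Mapping.keys q \<subseteq> xy_vars d"
        using km by (auto simp: q_def in_keys_iff lookup_minus)
      then have "Poly_Mapping.single q (- c) \<in> xy_polys d" by (rule xy_polys_single)
      moreover have "indet v \<in> I" using v vars by (auto simp: xvar_indet yvar_indet)
      ultimately have "Poly_Mapping.single q (- c) * indet v \<in> I" by (rule ideal_xyD(4)[OF I])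
      moreover have "Poly_Mapping.single q (- c) * indet v = - Poly_Mapping.single m c"
        by (subst m) (simp add: indet_def mult_single single_uminus)
      ultimately show ?thesis
        using subst_dead_monom(2)[OF km False, of c] by (simp add: T_def)
    qed
  next
    case (add f g)
    then show ?case using ideal_xyD(3)[OF I add] by (simp add: subst_add Tadd algebra_simps)
  qed
  show ?thesis
  proof
    fix f :: "'k mpoly" assume "f \<in> subst_kernel d (comp_subst S r)"
    then have "- f \<in> I" using main[of f] by (simp add: subst_kernel_def T_def)
    then show "f \<in> I" using ideal_xyD(4)[OF I, of "- 1" "- f"] by simp
  qed
qed

lemma edge_binom_kernel_iff:
  assumes "i \<in> {1..d}" "j \<in> {1..d}"
  shows "(edge_binom i j :: 'k::field mpoly) \<in> subst_kernel d (comp_subst S r) \<longleftrightarrow> i \<in> S \<or> j \<in> S \<or> r i = r j"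
proof (cases "i \<in> S \<or> j \<in> S")
  case True
  then show ?thesis using edge_binom_in[OF assms]
    by (auto simp: subst_kernel_def edge_binom_def subst_diff subst_mult comp_subst_def)
next
  case False
  then have "subst (comp_subst S r) (edge_binom i j)
      = (indet (VarX i) * indet (VarX j) * (indet (VarY (r j)) - indet (VarY (r i))) :: 'k mpoly)"
    by (simp add: edge_binom_def subst_diff subst_mult comp_subst_def xvar_indet yvar_indet algebra_simps)
  then show ?thesis using edge_binom_in[OF assms] False by (auto simp: subst_kernel_def)
qed

lemma xvar_kernel_iff:
  assumes "i \<in> {1..d}"
  shows "(xvar i :: 'k::field mpoly) \<in> subst_kernel d (comp_subst S r) \<longleftrightarrow> i \<in> S"
  using xvar_in[OF assms] by (auto simp: subst_kernel_def comp_subst_def xvar_indet)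

end

section \<open>Cut primes as kernels\<close>

locale edge_graph =
  fixes d :: nat and E :: "nat set set"
  assumes simple: "simple_graph d E"

sublocale edge_graph \<subseteq> graph "\<lambda>u v. {u, v} \<in> E"
  by unfold_locales (simp add: insert_commute)

context edge_graph begin

lemma edgeD: "{u, v} \<in> E \<Longrightarrow> u \<in> {1..d} \<and> v \<in> {1..d} \<and> u \<noteq> v"
  using simple unfolding simple_graph_def by (metis doubleton_eq_iff)

lemma induced_adj_reach: "(induced_adj E U)\<^sup>* = reach U"
  by (simp add: induced_adj_def reach_def)

lemma components_comps: "components d E S = comps ({1..d} - S)"
  by (simp add: components_def comps_def induced_adj_reach)

definition rep :: "nat set \<Rightarrow> nat \<Rightarrow> nat" where
  "rep S = comp_rep ({1..d} - S)"

lemma rep_eq_iff: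
  "i \<in> {1..d} - S \<Longrightarrow> j \<in> {1..d} - S \<Longrightarrow> rep S i = rep S j \<longleftrightarrow> (i, j) \<in> reach ({1..d} - S)"
  unfolding rep_def by (rule comp_rep_eq_iff)

lemma rep_fun_rep: "S \<subseteq> {1..d} \<Longrightarrow> rep_fun d S (rep S)"
proof (unfold_locales, goal_cases)
  case (2 i)
  then show ?case unfolding rep_def by (rule_tac comp_rep_in)
next
  case (3 i)
  then have "rep S i \<in> {1..d} - S" unfolding rep_def by (rule_tac comp_rep_in)
  then show ?case using 3 rep_eq_iff reach_sym comp_rep_reach by (simp add: rep_def)
next
  case (4 i)
  then show ?case unfolding rep_def comp_rep_def by presburger
qed

definition cut_kernel :: "nat set \<Rightarrow> 'k::field mpoly set" where
  "cut_kernel S = subst_kernel d (comp_subst S (rep S))"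

lemma cut_kernel_prime: "primeideal (cut_kernel S) (xy_ring d)"
  unfolding cut_kernel_def by (rule subst_kernel_prime)

lemmas cut_kernel_ideal = primeideal_xyD(1)[OF cut_kernel_prime]

lemma edge_binom_cut_kernel_iff:
  assumes "S \<subseteq> {1..d}" "i \<in> {1..d}" "j \<in> {1..d}"
  shows "(edge_binom i j :: 'k::field mpoly) \<in> cut_kernel S \<longleftrightarrow> i \<in> S \<or> j \<in> S \<or> (i, j) \<in> reach ({1..d} - S)"
  unfolding cut_kernel_def
  using rep_fun.edge_binom_kernel_iff[OF rep_fun_rep[OF assms(1)] assms(2,3)] rep_eq_iff[of i S j] assms
  by blast

lemma var_cut_kernel:
  assumes "S \<subseteq> {1..d}" "i \<in> S"
  shows "xvar i \<in> (cut_kernel S :: 'k::field mpoly set)" "yvar i \<in> (cut_kernel S :: 'k::field mpoly set)"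
proof -
  have "i \<in> {1..d}" using assms by blast
  then show "xvar i \<in> (cut_kernel S :: 'k mpoly set)" "yvar i \<in> (cut_kernel S :: 'k mpoly set)"
    using assms(2) by (auto simp: cut_kernel_def subst_kernel_def comp_subst_def)
qed

lemma xvar_cut_kernel_iff:
  assumes "S \<subseteq> {1..d}" "i \<in> {1..d}"
  shows "(xvar i :: 'k::field mpoly) \<in> cut_kernel S \<longleftrightarrow> i \<in> S"
  unfolding cut_kernel_def using rep_fun.xvar_kernel_iff[OF rep_fun_rep] assms by blast

lemma cut_kernel_subset:
  fixes I :: "'k::field mpoly set"
  assumes S: "S \<subseteq> {1..d}" and I: "ideal I (xy_ring d)"
    and binom: "\<And>i j. i \<in> {1..d} - S \<Longrightarrow> j \<in> {1..d} - S \<Longrightarrow> (i, j) \<in> reach ({1..d} - S) \<Longrightarrow> edge_binom i j \<in> I"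
    and vars: "\<And>i. i \<in> S \<Longrightarrow> xvar i \<in> I" "\<And>i. i \<in> S \<Longrightarrow> yvar i \<in> I"
  shows "cut_kernel S \<subseteq> I"
  unfolding cut_kernel_def
  by (rule rep_fun.kernel_subset[OF rep_fun_rep[OF S] I]) (use binom vars rep_eq_iff in auto)

lemma edge_binom_refl [simp]: "edge_binom i i = 0"
  by (simp add: edge_binom_def)

lemma binomial_edge_ideal_eq:
  "binomial_edge_ideal d F = Idl\<^bsub>xy_ring d\<^esub> {edge_binom i j | i j. {i, j} \<in> F}"
  by (simp add: binomial_edge_ideal_def edge_binom_def)

lemma binomial_edge_ideal_facts:
  assumes "\<And>i j. {i, j} \<in> F \<Longrightarrow> i \<in> {1..d} \<and> j \<in> {1..d}"
  shows "ideal (binomial_edge_ideal d F :: 'k::field mpoly set) (xy_ring d)"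
    and "{i, j} \<in> F \<Longrightarrow> (edge_binom i j :: 'k mpoly) \<in> binomial_edge_ideal d F"
proof -
  have "{edge_binom i j | i j. {i, j} \<in> F} \<subseteq> (xy_polys d :: 'k mpoly set)"
    using assms edge_binom_in by blast
  then show "ideal (binomial_edge_ideal d F :: 'k mpoly set) (xy_ring d)"
    and "{i, j} \<in> F \<Longrightarrow> (edge_binom i j :: 'k mpoly) \<in> binomial_edge_ideal d F"
    unfolding binomial_edge_ideal_eq using Idl_ideal Idl_self by blast+
qed

lemma J_ideal: "ideal (binomial_edge_ideal d E) (xy_ring d)"
  by (rule binomial_edge_ideal_facts(1)) (use edgeD in blast)

lemma J_edge: "{i, j} \<in> E \<Longrightarrow> edge_binom i j \<in> binomial_edge_ideal d E"
  by (rule binomial_edge_ideal_facts(2)) (use edgeD in blast)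

lemma J_subset_cut_kernel:
  assumes S: "S \<subseteq> {1..d}"
  shows "binomial_edge_ideal d E \<subseteq> (cut_kernel S :: 'k::field mpoly set)"
  unfolding binomial_edge_ideal_eq
proof (rule Idl_minimal[OF cut_kernel_ideal], safe)
  fix i j assume e: "{i, j} \<in> E"
  then have "i \<in> S \<or> j \<in> S \<or> (i, j) \<in> reach ({1..d} - S)"
    using reach_step[of i "{1..d} - S" j] edgeD by blast
  then show "(edge_binom i j :: 'k mpoly) \<in> cut_kernel S"
    using edge_binom_cut_kernel_iff[OF S] edgeD[OF e] by blast
qed

text \<open>The generators of the cut prime are killed by the substitution, and they include
  everything that \<open>cut_kernel_subset\<close> asks of an ideal containing the kernel. Thus the
  cut prime is indeed prime, with known height.\<close>

lemma cut_prime_eq: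
  assumes S: "S \<subseteq> {1..d}"
  shows "cut_prime d E S = (cut_kernel S :: 'k::field mpoly set)"
proof -
  let ?G = "(\<Union>T\<in>components d E S. binomial_edge_ideal d (complete_edges T)) \<union> xvar ` S \<union> yvar ` S :: 'k mpoly set"
  have T: "i \<in> {1..d} - S \<and> j \<in> {1..d} - S \<and> (i, j) \<in> reach ({1..d} - S)"
    if "T \<in> components d E S" "i \<in> T" "j \<in> T" for T i j
  proof -
    obtain u where u: "u \<in> {1..d} - S" "T = reach ({1..d} - S) `` {u}"
      using \<open>T \<in> _\<close> by (auto simp: components_comps comps_eq)
    then have "(u, i) \<in> reach ({1..d} - S)" "(u, j) \<in> reach ({1..d} - S)" using that by auto
    then show ?thesis using u reach_mem reach_trans reach_sym by blast
  qed
  have ce: "i \<in> T \<and> j \<in> T" if "{i, j} \<in> complete_edges T" for i j T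
    using that unfolding complete_edges_def by (auto simp: doubleton_eq_iff)
  have fid: "ideal (binomial_edge_ideal d (complete_edges T) :: 'k mpoly set) (xy_ring d)"
    "\<And>i j. {i, j} \<in> complete_edges T \<Longrightarrow> (edge_binom i j :: 'k mpoly) \<in> binomial_edge_ideal d (complete_edges T)"
    if "T \<in> components d E S" for T
  proof -
    have "\<And>i j. {i, j} \<in> complete_edges T \<Longrightarrow> i \<in> {1..d} \<and> j \<in> {1..d}" using ce T[OF that] by blast
    from binomial_edge_ideal_facts[OF this]
    show "ideal (binomial_edge_ideal d (complete_edges T) :: 'k mpoly set) (xy_ring d)"
      "\<And>i j. {i, j} \<in> complete_edges T \<Longrightarrow> (edge_binom i j :: 'k mpoly) \<in> binomial_edge_ideal d (complete_edges T)"
      by blast+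
  qed
  have GC: "?G \<subseteq> xy_polys d"
  proof -
    have "xvar ` S \<subseteq> (xy_polys d :: 'k mpoly set)" "yvar ` S \<subseteq> (xy_polys d :: 'k mpoly set)"
      using S by auto
    then show ?thesis using ideal_xyD(1)[OF fid(1)] by blast
  qed
  show ?thesis
  proof
    show "cut_prime d E S \<subseteq> (cut_kernel S :: 'k mpoly set)"
      unfolding cut_prime_def
    proof (rule Idl_minimal[OF cut_kernel_ideal], intro Un_least UN_least)
      fix C assume C: "C \<in> components d E S"
      have "(edge_binom i j :: 'k mpoly) \<in> cut_kernel S" if "{i, j} \<in> complete_edges C" for i j
        using edge_binom_cut_kernel_iff[OF S] T[OF C] ce[OF that] by blast
      then show "binomial_edge_ideal d (complete_edges C) \<subseteq> (cut_kernel S :: 'k mpoly set)"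
        unfolding binomial_edge_ideal_eq by (intro Idl_minimal[OF cut_kernel_ideal]) blast
    qed (use var_cut_kernel[OF S] in auto)
    show "cut_kernel S \<subseteq> (cut_prime d E S :: 'k mpoly set)"
      unfolding cut_prime_def
    proof (rule cut_kernel_subset[OF S Idl_ideal[OF GC]])
      note self = subsetD[OF Idl_self[OF GC]]
      fix i j assume ij: "i \<in> {1..d} - S" "j \<in> {1..d} - S" "(i, j) \<in> reach ({1..d} - S)"
      define C where "C = reach ({1..d} - S) `` {i}"
      have C: "C \<in> components d E S" "i \<in> C" "j \<in> C"
        using ij by (auto simp: C_def components_comps comps_eq)
      show "edge_binom i j \<in> Idl\<^bsub>xy_ring d\<^esub> ?G"
      proof (cases "i = j")
        case True
        then show ?thesis using ideal_xyD(2)[OF Idl_ideal[OF GC]] by simp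
      next
        case False
        then have "{i, j} \<in> complete_edges C" using C by (auto simp: complete_edges_def)
        then show ?thesis using self fid(2)[OF C(1)] C(1) by blast
      qed
    next
      show "xvar i \<in> Idl\<^bsub>xy_ring d\<^esub> ?G" if "i \<in> S" for i
        using subsetD[OF Idl_self[OF GC]] that by blast
      show "yvar i \<in> Idl\<^bsub>xy_ring d\<^esub> ?G" if "i \<in> S" for i
        using subsetD[OF Idl_self[OF GC]] that by blast
    qed
  qed
qed

text \<open>With \<open>f_ij\<close> for \<open>edge_binom i j\<close>, the identity
  \<open>x_k f_il = x_i f_kl + x_l f_ik\<close> extends a walk from \<open>k\<close> to its
  neighbour \<open>l\<close>. The witness collects the \<open>x_k\<close> on the way; none lies in
  the prime, as the walk avoids \<open>S\<close>.\<close>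

lemma path_witness:
  fixes S :: "nat set"
  assumes S: "S \<subseteq> {1..d}" and i: "i \<in> {1..d} - S" and r: "(i, j) \<in> reach ({1..d} - S)"
  shows "\<exists>w\<in>xy_polys d. w \<notin> cut_kernel S \<and> w * edge_binom i j \<in> (binomial_edge_ideal d E :: 'k::field mpoly set)"
  using r
proof (induction rule: reach_induct)
  case refl
  show ?case
    using primeideal_xyD(2)[OF cut_kernel_prime] ideal_xyD(2)[OF J_ideal] by (intro bexI[of _ 1]) auto
next
  case (step k l)
  then obtain w where w: "w \<in> xy_polys d" "w \<notin> (cut_kernel S :: 'k mpoly set)"
    "w * edge_binom i k \<in> (binomial_edge_ideal d E :: 'k mpoly set)" by blast
  have x: "xvar i \<in> (xy_polys d :: 'k mpoly set)" "xvar k \<in> (xy_polys d :: 'k mpoly set)"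
    "xvar l \<in> (xy_polys d :: 'k mpoly set)" using i step.hyps by auto
  have "w * xvar i * edge_binom k l + xvar l * (w * edge_binom i k) \<in> (binomial_edge_ideal d E :: 'k mpoly set)"
    using step.hyps(4) by (intro ideal_xyD(3,4)[OF J_ideal] xy_polys_mult w x J_edge)
  also have "w * xvar i * edge_binom k l + xvar l * (w * edge_binom i k) = (w * xvar k) * edge_binom i l"
    by (simp add: edge_binom_def algebra_simps)
  finally have "(w * xvar k) * edge_binom i l \<in> (binomial_edge_ideal d E :: 'k mpoly set)" .
  moreover have "xvar k \<notin> (cut_kernel S :: 'k mpoly set)"
    using xvar_cut_kernel_iff[OF S] step.hyps(2) by blast
  then have "w * xvar k \<notin> (cut_kernel S :: 'k mpoly set)"
    using primeideal_xyD(3)[OF cut_kernel_prime w(1) x(2)] w(2) by blast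
  ultimately show ?case using w x xy_polys_mult by blast
qed

text \<open>Multiply the individual witnesses; primality keeps the product outside
  \<open>P\<close>.\<close>

lemma common_witness:
  fixes P J :: "'k::field mpoly set"
  assumes P: "primeideal P (xy_ring d)" and J: "ideal J (xy_ring d)" and "finite G"
    and "\<And>g. g \<in> G \<Longrightarrow> \<exists>w\<in>xy_polys d. w \<notin> P \<and> w * g \<in> J"
  shows "\<exists>w\<in>xy_polys d. w \<notin> P \<and> (\<forall>g\<in>G. w * g \<in> J)"
  using assms(3,4)
proof (induction G rule: finite_induct)
  case empty
  then show ?case using primeideal_xyD(2)[OF P] by (intro bexI[of _ 1]) auto
next
  case (insert g G)
  obtain w where w: "w \<in> xy_polys d" "w \<notin> P" "\<forall>g\<in>G. w * g \<in> J" using insert by blast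
  obtain v where v: "v \<in> xy_polys d" "v \<notin> P" "v * g \<in> J" using insert.prems by blast
  have "v * w * h \<in> J" if "h \<in> insert g G" for h
  proof (cases "h = g")
    case True
    then show ?thesis using ideal_xyD(4)[OF J w(1) v(3)] by (simp add: mult_ac)
  next
    case False
    then have "w * h \<in> J" using that w by blast
    then show ?thesis using ideal_xyD(4)[OF J v(1)] by (simp add: mult.assoc)
  qed
  moreover have "v * w \<notin> P" using primeideal_xyD(3)[OF P v(1) w(1)] v w by blast
  ultimately show ?case using v w xy_polys_mult by blast
qed

text \<open>If \<open>s\<close> touches two components of \<open>G - S\<close> at \<open>i\<close> and \<open>k\<close>, the binomial of \<open>i, k\<close> lies
  outside the prime of \<open>S\<close> and multiplies \<open>x\<^sub>s\<close> and \<open>y\<^sub>s\<close> into \<open>J\<^sub>G\<close>.\<close>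

lemma cut_witness:
  assumes cut: "wcut {1..d} {} S"
  shows "\<exists>w\<in>xy_polys d. w \<notin> cut_kernel S \<and>
    (\<forall>g\<in>cut_kernel S. w * g \<in> (binomial_edge_ideal d E :: 'k::field mpoly set))"
proof -
  let ?J = "binomial_edge_ideal d E :: 'k mpoly set"
  have S: "S \<subseteq> {1..d}" using cut by (simp add: wcut_def)
  let ?U = "{1..d} - S"
  define G :: "'k mpoly set" where
    "G = (\<lambda>(i, j). edge_binom i j) ` {(i, j) \<in> ?U \<times> ?U. (i, j) \<in> reach ?U} \<union> xvar ` S \<union> yvar ` S"
  have "finite {(i, j) \<in> ?U \<times> ?U. (i, j) \<in> reach ?U}" by (rule finite_subset[of _ "?U \<times> ?U"]) auto
  then have finG: "finite G" using S finite_subset unfolding G_def by blast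
  have "\<exists>w\<in>xy_polys d. w \<notin> cut_kernel S \<and> w * g \<in> ?J" if g: "g \<in> G" for g
  proof -
    consider i j where "g = edge_binom i j" "i \<in> ?U" "(i, j) \<in> reach ?U"
      | s where "s \<in> S" "g = xvar s \<or> g = yvar s"
      using g unfolding G_def by auto
    then show ?thesis
    proof cases
      case 1
      then show ?thesis using path_witness[OF S] by blast
    next
      case 2
      then obtain i k where ik: "i \<in> ?U" "k \<in> ?U" "{s, i} \<in> E" "{s, k} \<in> E" "(i, k) \<notin> reach ?U"
        using cut unfolding wcut_def by blast
      have w: "edge_binom i k \<notin> (cut_kernel S :: 'k mpoly set)" "edge_binom i k \<in> (xy_polys d :: 'k mpoly set)"
        using edge_binom_cut_kernel_iff[OF S] ik edge_binom_in by blast+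
      have e: "edge_binom s k \<in> ?J" "edge_binom i s \<in> ?J"
        using ik by (auto intro!: J_edge simp: insert_commute)
      have "edge_binom i k * xvar s = xvar i * edge_binom s k + xvar k * (edge_binom i s :: 'k mpoly)"
        "edge_binom i k * yvar s = yvar k * edge_binom i s + yvar i * (edge_binom s k :: 'k mpoly)"
        by (simp_all add: edge_binom_def algebra_simps)
      moreover have "xvar i * edge_binom s k + xvar k * edge_binom i s \<in> ?J"
        "yvar k * edge_binom i s + yvar i * edge_binom s k \<in> ?J"
        using ik e by (auto intro!: ideal_xyD(3,4)[OF J_ideal])
      ultimately have "edge_binom i k * g \<in> ?J" using 2 by auto
      then show ?thesis using w by blast
    qed
  qed
  then obtain w where w: "w \<in> xy_polys d" "w \<notin> cut_kernel S" "\<forall>g\<in>G. w * g \<in> ?J"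
    using common_witness[OF cut_kernel_prime J_ideal finG] by blast
  \<comment> \<open>The colon ideal of the edge ideal by \<open>w\<close>: once it contains the
    generators, it contains the whole prime.\<close>
  define I where "I = {g \<in> xy_polys d. w * g \<in> ?J}"
  have I: "ideal I (xy_ring d)"
  proof (rule ideal_xyI)
    show "f * g \<in> I" if "f \<in> xy_polys d" "g \<in> I" for f g
    proof -
      have "f * (w * g) \<in> ?J"
        using ideal_xyD(4)[OF J_ideal, of f "w * g"] that by (simp add: I_def)
      then show ?thesis using that by (simp add: I_def xy_polys_mult mult.left_commute)
    qed
  qed (use ideal_xyD[OF J_ideal] in \<open>auto simp: I_def distrib_left xy_polys_add\<close>)
  have "G \<subseteq> xy_polys d" using S edge_binom_in by (auto simp: G_def)
  then have GI: "G \<subseteq> I" using w by (auto simp: I_def)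
  have "cut_kernel S \<subseteq> I"
    by (rule cut_kernel_subset[OF S I]) (use GI in \<open>auto simp: G_def\<close>)
  then show ?thesis using w by (auto simp: I_def)
qed

text \<open>A prime \<open>Q\<close> in between contains \<open>w * g\<close> for each
  \<open>g\<close> in the cut prime but not \<open>w\<close>, hence contains
  \<open>g\<close>.\<close>

lemma cut_minimal_prime:
  assumes cut: "wcut {1..d} {} S"
  shows "minimal_prime (xy_ring d) (binomial_edge_ideal d E) (cut_kernel S :: 'k::field mpoly set)"
  unfolding minimal_prime_def
proof (intro conjI allI impI)
  have S: "S \<subseteq> {1..d}" using cut by (simp add: wcut_def)
  show "binomial_edge_ideal d E \<subseteq> (cut_kernel S :: 'k mpoly set)" by (rule J_subset_cut_kernel[OF S])
  show "primeideal (cut_kernel S :: 'k mpoly set) (xy_ring d)" by (rule cut_kernel_prime)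
  fix Q :: "'k mpoly set"
  assume Q: "primeideal Q (xy_ring d) \<and> binomial_edge_ideal d E \<subseteq> Q \<and> Q \<subseteq> cut_kernel S"
  obtain w where w: "w \<in> xy_polys d" "w \<notin> (cut_kernel S :: 'k mpoly set)"
    "\<forall>g\<in>cut_kernel S. w * g \<in> (binomial_edge_ideal d E :: 'k mpoly set)" using cut_witness[OF cut] by blast
  have "g \<in> Q" if g: "g \<in> cut_kernel S" for g
  proof -
    have "g \<in> xy_polys d" using g ideal_xyD(1)[OF cut_kernel_ideal] by blast
    moreover have "w * g \<in> Q" "w \<notin> Q" using g w Q by blast+
    ultimately show ?thesis using primeideal_xyD(3) Q w(1) by blast
  qed
  then show "Q = cut_kernel S" using Q by blast
qed

text \<open>The cut prime is the colon ideal of the edge ideal by the same \<open>w\<close>.\<close>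

lemma cut_associated_prime:
  assumes cut: "wcut {1..d} {} S"
  shows "cut_kernel S \<in> associated_primes (xy_ring d) (binomial_edge_ideal d E :: 'k::field mpoly set)"
proof -
  have S: "S \<subseteq> {1..d}" using cut by (simp add: wcut_def)
  obtain w where w: "w \<in> xy_polys d" "w \<notin> (cut_kernel S :: 'k mpoly set)"
    "\<forall>g\<in>cut_kernel S. w * g \<in> (binomial_edge_ideal d E :: 'k mpoly set)" using cut_witness[OF cut] by blast
  have "cut_kernel S = {g \<in> xy_polys d. g * w \<in> (binomial_edge_ideal d E :: 'k mpoly set)}"
  proof
    show "cut_kernel S \<subseteq> {g \<in> xy_polys d. g * w \<in> (binomial_edge_ideal d E :: 'k mpoly set)}"
      using w ideal_xyD(1)[OF cut_kernel_ideal] by (auto simp: mult.commute)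
    show "{g \<in> xy_polys d. g * w \<in> (binomial_edge_ideal d E :: 'k mpoly set)} \<subseteq> cut_kernel S"
      using primeideal_xyD(3)[OF cut_kernel_prime _ w(1)] w(2) J_subset_cut_kernel[OF S] by blast
  qed
  then show ?thesis unfolding associated_primes_def mem_Collect_eq
    by (intro conjI cut_kernel_prime bexI[of _ w]) (simp_all add: w(1))
qed

text \<open>If the neighbours of \<open>s\<close> outside \<open>S\<close> lie in one component,
  putting \<open>s\<close> back merges no components. The prime of \<open>S - {s}\<close> is then
  contained in that of \<open>S\<close>, properly because it misses \<open>xvar s\<close>.\<close>

lemma minimal_prime_cut:
  assumes S: "S \<subseteq> {1..d}"
    and min: "minimal_prime (xy_ring d) (binomial_edge_ideal d E) (cut_kernel S :: 'k::field mpoly set)"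
  shows "wcut {1..d} {} S"
proof (rule ccontr)
  assume "\<not> wcut {1..d} {} S"
  then obtain s where s: "s \<in> S" and n: "\<And>u w. u \<in> {1..d} - S \<Longrightarrow> w \<in> {1..d} - S \<Longrightarrow>
      {s, u} \<in> E \<Longrightarrow> {s, w} \<in> E \<Longrightarrow> (u, w) \<in> reach ({1..d} - S)"
    using S unfolding wcut_def by blast
  let ?S = "S - {s}"
  have S': "?S \<subseteq> {1..d}" using S by blast
  have U: "{1..d} - ?S = insert s ({1..d} - S)" using S s by blast
  have "cut_kernel ?S \<subseteq> (cut_kernel S :: 'k mpoly set)"
  proof (rule cut_kernel_subset[OF S' cut_kernel_ideal])
    fix i j assume ij: "i \<in> {1..d} - ?S" "j \<in> {1..d} - ?S" "(i, j) \<in> reach ({1..d} - ?S)"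
    have "i = s \<or> j = s \<or> (i, j) \<in> reach ({1..d} - S)"
    proof (rule ccontr)
      assume c: "\<not> ?thesis"
      then have iU: "i \<in> {1..d} - S" "j \<in> {1..d} - S" using ij U by auto
      obtain u where u: "{s, u} \<in> E" "(i, u) \<in> reach ({1..d} - S)"
        using reach_insert[OF ij(3)[unfolded U] iU(1)] c by blast
      obtain w where w: "{s, w} \<in> E" "(j, w) \<in> reach ({1..d} - S)"
        using reach_insert[OF reach_sym[OF ij(3)[unfolded U]] iU(2)] c reach_sym by blast
      have "(u, w) \<in> reach ({1..d} - S)" using n u w iU reach_mem by blast
      then show False using c u w reach_trans reach_sym by blast
    qed
    then show "(edge_binom i j :: 'k mpoly) \<in> cut_kernel S"
      using edge_binom_cut_kernel_iff[OF S] ij s by blast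
  qed (use var_cut_kernel[OF S] in auto)
  then have "cut_kernel ?S = (cut_kernel S :: 'k mpoly set)"
    using min cut_kernel_prime J_subset_cut_kernel[OF S'] unfolding minimal_prime_def by blast
  moreover have "xvar s \<in> (cut_kernel S :: 'k mpoly set)" using var_cut_kernel[OF S s] by blast
  moreover have "xvar s \<notin> (cut_kernel ?S :: 'k mpoly set)"
    using xvar_cut_kernel_iff[OF S'] s S by blast
  ultimately show False by blast
qed

lemma cut_set_iff: "cut_set TYPE('k::field) d E S \<longleftrightarrow> wcut {1..d} {} S"
proof (cases "S \<subseteq> {1..d}")
  case True
  then show ?thesis
    unfolding cut_set_def cut_prime_eq[OF True] using cut_minimal_prime minimal_prime_cut by blast
qed (auto simp: cut_set_def wcut_def)

lemma height_cut_kernel: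
  assumes S: "S \<subseteq> {1..d}"
  shows "ideal_height (xy_ring d) (cut_kernel S :: 'k::field mpoly set) = enat (d + card S - card (comps ({1..d} - S)))"
    and "card (comps ({1..d} - S)) + card S \<le> d"
proof -
  interpret rep_fun d S "rep S" by (rule rep_fun_rep[OF S])
  have "card reps = card (comps ({1..d} - S))" unfolding reps_def by (simp add: rep_def card_comps_comp_rep)
  then show "ideal_height (xy_ring d) (cut_kernel S :: 'k mpoly set) = enat (d + card S - card (comps ({1..d} - S)))"
    and "card (comps ({1..d} - S)) + card S \<le> d"
    using height_eq card_reps_le by (simp_all add: cut_kernel_def)
qed

text \<open>The empty set is a cut set, and its prime has height \<open>d - 1\<close> by
  connectedness; comparing heights gives the count. The bounds from \<open>height_cut_kernel\<close>
  exclude truncation in the subtractions.\<close>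

lemma accessible_acc:
  assumes acc: "accessible TYPE('k::field) d E" and con: "connected_graph d E"
  shows "acc {1..d} {}"
  unfolding acc_def
proof (intro allI impI conjI)
  fix S assume cut: "wcut {1..d} {} S"
  then have S: "S \<subseteq> {1..d}" by (simp add: wcut_def)
  have c0: "wcut {1..d} {} {}" by (simp add: wcut_def)
  have un: "unmixed (xy_ring d) (binomial_edge_ideal d E :: 'k mpoly set)"
    using acc by (simp add: accessible_def)
  have "ideal_height (xy_ring d) (cut_kernel S :: 'k mpoly set) = ideal_height (xy_ring d) (cut_kernel {} :: 'k mpoly set)"
    using un cut_associated_prime[OF cut] cut_associated_prime[OF c0] unfolding unmixed_def by blast
  then have "d + card S - card (comps ({1..d} - S)) = d - card (comps {1..d})"
    using height_cut_kernel(1)[OF S, where 'k = 'k] height_cut_kernel(1)[of "{}", where 'k = 'k] by simp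
  moreover have "card (comps {1..d}) = 1"
    using con by (intro card_comps_conn) (auto simp: connected_graph_def conn_def induced_adj_reach)
  moreover have "card (comps ({1..d} - S)) + card S \<le> d" "d \<ge> 1"
    using height_cut_kernel(2)[OF S] con by (auto simp: connected_graph_def)
  ultimately show "card (comps ({1..d} - S)) + card (S \<inter> {}) = card S + 1" by simp
  show "\<exists>s\<in>S. wcut {1..d} {} (S - {s})" if "S \<noteq> {}"
    using acc cut that unfolding accessible_def cut_set_iff by blast
qed

end

theorem proposition4p22:
  fixes p d :: nat and E :: "nat set set"
  assumes "Factorial_Ring.prime p" and "CHAR('k::field) = p" and "F_finite TYPE('k)"
    and "simple_graph d E" and "connected_graph d E" and "bipartite d E"
    and "accessible TYPE('k) d E"
  shows "weakly_closed d E"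
proof -
  interpret edge_graph d E by unfold_locales (rule assms(4))
  obtain A B where AB: "A \<inter> B = {}" "\<forall>e\<in>E. \<exists>a\<in>A. \<exists>b\<in>B. e = {a, b}"
    using assms(6) unfolding bipartite_def by blast
  interpret bip_graph "\<lambda>u v. {u, v} \<in> E" "\<lambda>v. v \<in> A"
    by unfold_locales (use AB in \<open>fastforce simp: doubleton_eq_iff\<close>)
  have con: "conn {1..d}" "{1..d} \<noteq> {}"
    using assms(5) by (auto simp: connected_graph_def conn_def induced_adj_reach)
  obtain lt Kl Kr where o: "good_order {1..d} {} lt Kl Kr"
    using acc_order[OF _ con(2,1) _ accessible_acc[OF assms(7,5)]] by auto
  note D = good_orderD[OF o]
  obtain \<sigma> where \<sigma>: "bij_betw \<sigma> {1..d} {1..d}" "\<forall>x\<in>{1..d}. \<forall>y\<in>{1..d}. lt x y \<longrightarrow> \<sigma> x < \<sigma> y"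
    using linear_extension[of "{1..d}" lt] D(2,3) by auto
  show ?thesis
    unfolding weakly_closed_def
  proof (intro exI conjI allI impI)
    show "bij_betw \<sigma> {1..d} {1..d}" by (rule \<sigma>)
    fix i j k assume ijk: "{i, k} \<in> (`) \<sigma> ` E \<and> i < j \<and> j < k"
    then obtain e where e: "e \<in> E" "{i, k} = \<sigma> ` e" by blast
    obtain u0 w0 where uw0: "e = {u0, w0}" "u0 \<in> {1..d}" "w0 \<in> {1..d}"
      using assms(4) e(1) unfolding simple_graph_def by blast
    then have "\<sigma> u0 = i \<and> \<sigma> w0 = k \<or> \<sigma> w0 = i \<and> \<sigma> u0 = k" using e(2) by (auto simp: doubleton_eq_iff)
    then obtain u w where uw: "{u, w} \<in> E" "u \<in> {1..d}" "w \<in> {1..d}" "\<sigma> u = i" "\<sigma> w = k"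
      using uw0 e(1) by (metis insert_commute)
    have "i \<in> {1..d}" "k \<in> {1..d}" using uw \<sigma>(1) by (auto simp: bij_betw_def)
    then have "j \<in> {1..d}" using ijk by auto
    then obtain v where v: "v \<in> {1..d}" "\<sigma> v = j" using \<sigma>(1) by (metis bij_betw_imp_surj_on imageE)
    have ne: "u \<noteq> v" "v \<noteq> w" using uw v ijk by auto
    have "{u, v} \<in> E \<or> {v, w} \<in> E"
    proof (rule ccontr)
      assume n: "\<not> ?thesis"
      \<comment> \<open>The two non-adjacent pairs are comparable, and the labels decide the
        direction; by transitivity \<open>u\<close> and \<open>w\<close> would be comparable
        although they are adjacent.\<close>
      have "\<not> lt v u" "\<not> lt w v" using \<sigma>(2) uw v ijk by (metis order_less_asym)+
      then have "lt u v" "lt v w" using D(4) n ne uw v by blast+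
      then have "lt u w" using D(3) by blast
      then show False using D(4)[of u w] uw edgeD by blast
    qed
    moreover have "{\<sigma> u, \<sigma> v} \<in> (`) \<sigma> ` E" if "{u, v} \<in> E" for u v
      using imageI[OF that, of "(`) \<sigma>"] by simp
    ultimately show "{i, j} \<in> (`) \<sigma> ` E \<or> {j, k} \<in> (`) \<sigma> ` E" using uw v by blast
  qed
qed

end
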